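(* Let $(S,\mathfrak{S},\mu)$ and $(T,\mathfrak{T},\nu)$ be arbitrary measure spaces (in the sense of the context: $\mathfrak{S},\mathfrak{T}$ are $\sigma$-rings and no $\sigma$-finiteness is assumed), and let $\mu\otimes\nu$ be their product measure on $\mathfrak{S}\otimes\mathfrak{T}$. (i) The Lebesgue integral $\int d(\mu\otimes\nu)$ is equal to the Daniell--Stone integral $\int d(\tilde\mu\otimes\tilde\nu)$ restricted to $\mathfrak{S}\otimes\mathfrak{T}$-measurable functions; that is, a real-valued $\mathfrak{S}\otimes\mathfrak{T}$-measurable function $f$ on $S\times T$ belongs to $\mathcal{I}(S\times T,\mu\otimes\nu)$ if and only if it is Daniell--Stone integrable with respect to $\tilde\mu\otimes\tilde\nu$, and then $\int f\,d(\mu\otimes\nu)=\int f\,d(\tilde\mu\otimes\tilde\nu)$. (ii) (Fubini) For any $\mu\otimes\nu$-integrable function $f\colon S\times T\to[-\infty,\infty]$ one has $$\int f\,d(\mu\otimes\nu)=\int\Big(s\mapsto\int f(s,\cdot)\,d\nu\Big)d\mu=\int\Big(t\mapsto\int f(\cdot,t)\,d\mu\Big)d\nu,\qquad( * )$$ where the inner integrands $f(s,\cdot)$ and $f(\cdot,t)$ are integrable (with respect to $\nu$ and $\mu$) for $\mu$-almost every $s$ and $\nu$-almost every $t$, respectively. (iii) (Tonelli) The equalities $( * )$ remain valid if $f\in\mathcal{M}^+(S\times T,\mathfrak{S}\otimes\mathfrak{T})$ is $\mathfrak{S}_\mu^\sigma\otimes\mathfrak{T}_\nu^\sigma$-measurable,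 i.e. such that the set $\{x\in S\times T:\ f(x)\neq 0\}$ is $\sigma$-finite with respect to $\mu\otimes\nu$. In that case, if any one of the three sides of $( * )$ is finite, then $f$ is $\mu\otimes\nu$-integrable.
   Context: **Measure spaces.** A $\sigma$-ring is a family of sets (containing $\emptyset$) closed under countable unions and under differences $A\setminus B$. A measurable space is a pair $(S,\mathfrak{S})$ with $S$ a nonempty set and $\mathfrak{S}$ a $\sigma$-ring of subsets of $S$ ($S\in\mathfrak{S}$ is not required). A measure on $\mathfrak{S}$ is a $\sigma$-additive function $\mu\colon\mathfrak{S}\to[0,\infty]$ with $\mu(\emptyset)=0$; then $(S,\mathfrak{S},\mu)$ is a measure space. Put $\mathfrak{S}_\mu^{\mathrm f}=\{A\in\mathfrak{S}:\mu(A)<\infty\}$ and let $\mathfrak{S}_\mu^\sigma$ be the $\sigma$-ring of all countable unions of members of $\mathfrak{S}_\mu^{\mathrm f}$ (the $\sigma$-finite sets). The $\sigma$-finite component of $\mu$ is $\mu^\sigma=\mu|_{\mathfrak{S}_\mu^\sigma}$. **Product measure.** $\sigma(\mathfrak{C})$ denotes the smallest $\sigma$-ring containing the family $\mathfrak{C}$, and $\mathfrak{S}\otimes\mathfrak{T}=\sigma(\{A\times B:A\in\mathfrak{S},B\in\mathfrak{T}\})$. When both $\sigma$-rings are generated by sets of finite measure, $\mu\otimes\nu$ is the classical (Halmos) product: the unique measure on $\mathfrak{S}\otimes\mathfrak{T}$ with $(\mu\otimes\nu)(A\times B)=\mu(A)\nu(B)$ for $A\in\mathfrak{S},B\in\mathfrak{T}$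 (with $\infty\cdot0=0$). For arbitrary measures, $\mu\otimes\nu$ is the unique measure on $\mathfrak{S}\otimes\mathfrak{T}$ whose $\sigma$-finite component (including its domain) is the classical product $\mu^\sigma\otimes\nu^\sigma$ on $\mathfrak{S}_\mu^\sigma\otimes\mathfrak{T}_\nu^\sigma$; equivalently it equals $\mu^\sigma\otimes\nu^\sigma$ on $\mathfrak{S}_\mu^\sigma\otimes\mathfrak{T}_\nu^\sigma$ and $\infty$ on all other members of $\mathfrak{S}\otimes\mathfrak{T}$. **Measurable functions.** A real (or extended real) function $f$ on $S$ is $\mathfrak{S}$-measurable if it is measurable with respect to the $\sigma$-algebra $\sigma(\mathfrak{S}\cup\{S\})=\mathfrak{S}\cup\{S\setminus A:A\in\mathfrak{S}\}$ and $\{x:f(x)\neq0\}\in\mathfrak{S}$. $\mathcal{M}^+(S,\mathfrak{S})$ is the cone of $\mathfrak{S}$-measurable functions $S\to[0,\infty]$. **Lebesgue integral.** The Lebesgue integral with respect to $\mu$ is the unique non-negative linear functional $\int d\mu\colon\mathcal{I}(S,\mu)\to\mathbb{R}$ on a linear space $\mathcal{I}(S,\mu)$ of finite real $\mathfrak{S}$-measurable functions such that: (1) for $A\in\mathfrak{S}$, $1_A\in\mathcal{I}(S,\mu)$ iff $\mu(A)<\infty$, and then $\int1_A\,d\mu=\mu(A)$; (2) for every non-decreasing sequence $(f_n)$ in $\mathcal{I}(S,\mu)$ bounded at each point, if $(\int f_n\,d\mu)$ is bounded then $f=\lim f_n\in\mathcal{I}(S,\mu)$ and $\int f\,d\mu=\lim\int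 f_n\,d\mu$; (3) $f\in\mathcal{I}(S,\mu)$ implies $|f|,\min(f,1)\in\mathcal{I}(S,\mu)$. The extended Lebesgue integral is the unique non-decreasing function $\int d\mu\colon\mathcal{M}^+(S,\mathfrak{S})\to[0,\infty]$ that agrees with the Lebesgue integral $\int d\mu\colon\mathcal{I}(S,\mu)\to\mathbb{R}$ on non-negative members of $\mathcal{I}(S,\mu)$, satisfies $\int1_A\,d\mu=\mu(A)$ for all $A\in\mathfrak{S}$, and satisfies $\int\lim f_n\,d\mu=\lim\int f_n\,d\mu$ for every non-decreasing sequence in $\mathcal{M}^+(S,\mathfrak{S})$. An extended real-valued $\mathfrak{S}$-measurable $f$ is $\mu$-integrable if $\int|f|\,d\mu<\infty$, and then, as usual, $\int f\,d\mu=\int f^+\,d\mu-\int f^-\,d\mu$. A property holds for almost every $s$ if it holds outside a set $N\in\mathfrak{S}$ with $\mu(N)=0$; a function defined only almost everywhere is integrated after being set to $0$ on such an exceptional null set. **The functional $\tilde\mu\otimes\tilde\nu$.** $\mathcal{P}_\mu$ is the linear span of $\{1_A:A\in\mathfrak{S}_\mu^{\mathrm f}\}$, and $\tilde\mu\colon\mathcal{P}_\mu\to\mathbb{R}$ is the linear functional with $\tilde\mu(1_A)=\mu(A)$; similarly $\mathcal{P}_\nu,\tilde\nu$. $\mathcal{P}_\mu\otimes\mathcal{P}_\nu$ is identified with the linear space of functions on $S\times T$ spanned by $1_{A\times B}$, $A\in\mathfrak{S}_\mu^{\mathrm f}$, $B\in\mathfrak{T}_\nu^{\mathrm f}$, and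 $(\tilde\mu\otimes\tilde\nu)(f)=\tilde\mu(s\mapsto\tilde\nu(f(s,\cdot)))=\tilde\nu(t\mapsto\tilde\mu(f(\cdot,t)))$. **Daniell--Stone integral** (standard notion). For a vector lattice $L$ of real functions on a set $X$ and a positive linear functional $I$ on $L$ with $I(f_n)\to0$ whenever $f_n\downarrow0$ pointwise: let $L^\uparrow$ be the set of pointwise limits $h=\lim h_n\in(-\infty,\infty]^X$ of non-decreasing sequences in $L$, with $I(h)=\lim I(h_n)$; for $f\colon X\to\mathbb{R}$ put $\overline I(f)=\inf\{I(h):h\in L^\uparrow,h\ge f\}$ ($\inf\emptyset=\infty$) and $\underline I(f)=-\overline I(-f)$. Then $f$ is Daniell--Stone integrable if $\overline I(f)=\underline I(f)\in\mathbb{R}$, and this common value is $\int f\,dI$. Here $L=\mathcal{P}_\mu\otimes\mathcal{P}_\nu$ and $I=\tilde\mu\otimes\tilde\nu$.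
   Formalization: The extended Lebesgue integral is additionally required to be positively homogeneous, since the listed properties do not determine it uniquely when there are atoms of infinite measure (e.g. a one-point space of measure ∞); this gives the standard integral. *)

theory Defs
  imports "HOL-Analysis.Analysis"
begin

text \<open>
  Measures here live on \<open>\<sigma>\<close>-rings, so the type \<open>'a measure\<close> (which carries a
  \<open>\<sigma>\<close>-algebra) is not used for them. A measure is a function \<open>'a set \<Rightarrow> ennreal\<close> of which only the
  values on the \<open>\<sigma>\<close>-ring matter. Likewise a function on a set \<open>S\<close> is a function on the whole
  type of which only the values on \<open>S\<close> matter.
\<close>

section \<open>Measures on \<open>\<sigma>\<close>-rings\<close>

locale sigma_ring = subset_class S \<SS> for S :: "'a set" and \<SS> :: "'a set set" +
  assumes empty: "{} \<in> \<SS>"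
    and countable_UN: "\<And>A :: nat \<Rightarrow> 'a set. range A \<subseteq> \<SS> \<Longrightarrow> (\<Union>i. A i) \<in> \<SS>"
    and Diff: "\<And>A B. A \<in> \<SS> \<Longrightarrow> B \<in> \<SS> \<Longrightarrow> A - B \<in> \<SS>"

definition ring_measure :: "'a set set \<Rightarrow> ('a set \<Rightarrow> ennreal) \<Rightarrow> bool" where
  "ring_measure \<SS> \<mu> \<longleftrightarrow> positive \<SS> \<mu> \<and> countably_additive \<SS> \<mu>"

locale ring_measure_space = sigma_ring S \<SS>
  for S :: "'a set" and \<SS> :: "'a set set" and \<mu> :: "'a set \<Rightarrow> ennreal" +
  assumes nonempty: "S \<noteq> {}"
    and measure: "ring_measure \<SS> \<mu>"

definition finite_sets :: "'a set set \<Rightarrow> ('a set \<Rightarrow> ennreal) \<Rightarrow> 'a set set" where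
  "finite_sets \<SS> \<mu> = {A \<in> \<SS>. \<mu> A < \<infinity>}"

definition sigma_finite_sets :: "'a set set \<Rightarrow> ('a set \<Rightarrow> ennreal) \<Rightarrow> 'a set set" where
  "sigma_finite_sets \<SS> \<mu> = {\<Union>i. A i | A :: nat \<Rightarrow> 'a set. range A \<subseteq> finite_sets \<SS> \<mu>}"


section \<open>The product measure\<close>

definition generated_sigma_ring :: "'a set set \<Rightarrow> 'a set set" where
  "generated_sigma_ring C = \<Inter>{R. sigma_ring UNIV R \<and> C \<subseteq> R}"

definition ring_prod :: "'a set set \<Rightarrow> 'b set set \<Rightarrow> ('a \<times> 'b) set set" (infixr "\<otimes>\<^sub>R" 70) where
  "\<SS> \<otimes>\<^sub>R \<TT> = generated_sigma_ring {A \<times> B | A B. A \<in> \<SS> \<and> B \<in> \<TT>}"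

text \<open>The classical product, for \<open>\<sigma>\<close>-rings generated by their sets of finite measure. In this and
  the next definition the value \<open>0\<close> outside the \<open>\<sigma>\<close>-ring only serves to make the
  description definite.\<close>

definition classical_product ::
  "'a set set \<Rightarrow> ('a set \<Rightarrow> ennreal) \<Rightarrow> 'b set set \<Rightarrow> ('b set \<Rightarrow> ennreal) \<Rightarrow> ('a \<times> 'b) set \<Rightarrow> ennreal" where
  "classical_product \<SS> \<mu> \<TT> \<nu> = (THE \<pi>.
     ring_measure (\<SS> \<otimes>\<^sub>R \<TT>) \<pi> \<and>
     (\<forall>A\<in>\<SS>. \<forall>B\<in>\<TT>. \<pi> (A \<times> B) = \<mu> A * \<nu> B) \<and>
     (\<forall>E. E \<notin> \<SS> \<otimes>\<^sub>R \<TT> \<longrightarrow> \<pi> E = 0))"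

definition product_measure ::
  "'a set set \<Rightarrow> ('a set \<Rightarrow> ennreal) \<Rightarrow> 'b set set \<Rightarrow> ('b set \<Rightarrow> ennreal) \<Rightarrow> ('a \<times> 'b) set \<Rightarrow> ennreal" where
  "product_measure \<SS> \<mu> \<TT> \<nu> = (THE \<pi>.
     ring_measure (\<SS> \<otimes>\<^sub>R \<TT>) \<pi> \<and>
     sigma_finite_sets (\<SS> \<otimes>\<^sub>R \<TT>) \<pi> = sigma_finite_sets \<SS> \<mu> \<otimes>\<^sub>R sigma_finite_sets \<TT> \<nu> \<and>
     (\<forall>E \<in> sigma_finite_sets \<SS> \<mu> \<otimes>\<^sub>R sigma_finite_sets \<TT> \<nu>.
        \<pi> E = classical_product (sigma_finite_sets \<SS> \<mu>) \<mu> (sigma_finite_sets \<TT> \<nu>) \<nu> E) \<and>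
     (\<forall>E. E \<notin> \<SS> \<otimes>\<^sub>R \<TT> \<longrightarrow> \<pi> E = 0))"


section \<open>Measurable functions and the Lebesgue integral\<close>

definition ring_measurable ::
  "'a set \<Rightarrow> 'a set set \<Rightarrow> ('a \<Rightarrow> 'c::{topological_space, zero}) \<Rightarrow> bool" where
  "ring_measurable S \<SS> f \<longleftrightarrow>
     f \<in> borel_measurable (sigma S (\<SS> \<union> {S})) \<and> {x \<in> S. f x \<noteq> 0} \<in> \<SS>"

definition function_space :: "('a \<Rightarrow> real) set \<Rightarrow> bool" where
  "function_space L \<longleftrightarrow> (\<lambda>x. 0) \<in> L \<and>
     (\<forall>f\<in>L. \<forall>g\<in>L. (\<lambda>x. f x + g x) \<in> L) \<and> (\<forall>f\<in>L. \<forall>c. (\<lambda>x. c * f x) \<in> L)"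

definition linear_functional :: "('a \<Rightarrow> real) set \<Rightarrow> (('a \<Rightarrow> real) \<Rightarrow> real) \<Rightarrow> bool" where
  "linear_functional L I \<longleftrightarrow>
     (\<forall>f\<in>L. \<forall>g\<in>L. I (\<lambda>x. f x + g x) = I f + I g) \<and> (\<forall>f\<in>L. \<forall>c. I (\<lambda>x. c * f x) = c * I f)"

text \<open>The monotone convergence clause, applied to constant sequences, makes membership in \<open>D\<close> and
  the value of \<open>I\<close> depend only on the restriction of a function to \<open>S\<close>. Boundedness of a
  non-decreasing sequence at a point is expressed as convergence to a real number.\<close>

definition is_lebesgue_integral ::
  "'a set \<Rightarrow> 'a set set \<Rightarrow> ('a set \<Rightarrow> ennreal) \<Rightarrow> ('a \<Rightarrow> real) set \<Rightarrow> (('a \<Rightarrow> real) \<Rightarrow> real) \<Rightarrow> bool" where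
  "is_lebesgue_integral S \<SS> \<mu> D I \<longleftrightarrow>
     function_space D \<and> (\<forall>f\<in>D. ring_measurable S \<SS> f) \<and>
     linear_functional D I \<and> (\<forall>f\<in>D. (\<forall>x\<in>S. 0 \<le> f x) \<longrightarrow> 0 \<le> I f) \<and>
     (\<forall>A\<in>\<SS>. (indicator A \<in> D \<longleftrightarrow> \<mu> A < \<infinity>) \<and>
             (indicator A \<in> D \<longrightarrow> ennreal (I (indicator A)) = \<mu> A)) \<and>
     (\<forall>F f. (\<forall>n. F n \<in> D) \<and>
            (\<forall>x\<in>S. incseq (\<lambda>n. F n x) \<and> (\<lambda>n. F n x) \<longlonglongrightarrow> f x) \<and>
            bdd_above (range (\<lambda>n. I (F n)))
            \<longrightarrow> f \<in> D \<and> (\<lambda>n. I (F n)) \<longlonglongrightarrow> I f) \<and>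
     (\<forall>f\<in>D. (\<lambda>x. \<bar>f x\<bar>) \<in> D \<and> (\<lambda>x. min (f x) 1) \<in> D)"

definition lebesgue_space ::
  "'a set \<Rightarrow> 'a set set \<Rightarrow> ('a set \<Rightarrow> ennreal) \<Rightarrow> ('a \<Rightarrow> real) set" where
  "lebesgue_space S \<SS> \<mu> = (THE D. \<exists>I. is_lebesgue_integral S \<SS> \<mu> D I)"

text \<open>Meaningful for \<open>f \<in> lebesgue_space S \<SS> \<mu>\<close> only.\<close>

definition lebesgue_functional ::
  "'a set \<Rightarrow> 'a set set \<Rightarrow> ('a set \<Rightarrow> ennreal) \<Rightarrow> ('a \<Rightarrow> real) \<Rightarrow> real" where
  "lebesgue_functional S \<SS> \<mu> f =
     (THE c. \<exists>I. is_lebesgue_integral S \<SS> \<mu> (lebesgue_space S \<SS> \<mu>) I \<and> I f = c)"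

definition nonneg_measurable :: "'a set \<Rightarrow> 'a set set \<Rightarrow> ('a \<Rightarrow> ennreal) set" where
  "nonneg_measurable S \<SS> = {f. ring_measurable S \<SS> f}"

text \<open>Positive homogeneity is needed for uniqueness: on a one-point space of infinite measure every
  non-decreasing left-continuous \<open>\<phi> : [0,\<infinity>] \<rightarrow> [0,\<infinity>]\<close> with \<open>\<phi> 0 = 0\<close> and
  \<open>\<phi> 1 = \<infinity>\<close> would give a functional with all the other properties.\<close>

definition is_extended_integral ::
  "'a set \<Rightarrow> 'a set set \<Rightarrow> ('a set \<Rightarrow> ennreal) \<Rightarrow> (('a \<Rightarrow> ennreal) \<Rightarrow> ennreal) \<Rightarrow> bool" where
  "is_extended_integral S \<SS> \<mu> J \<longleftrightarrow>
     (\<forall>f \<in> nonneg_measurable S \<SS>. \<forall>g \<in> nonneg_measurable S \<SS>.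
        (\<forall>x\<in>S. f x \<le> g x) \<longrightarrow> J f \<le> J g) \<and>
     (\<forall>f \<in> nonneg_measurable S \<SS>. \<forall>c::real. 0 < c \<longrightarrow> J (\<lambda>x. ennreal c * f x) = ennreal c * J f) \<and>
     (\<forall>f \<in> lebesgue_space S \<SS> \<mu>. (\<forall>x\<in>S. 0 \<le> f x) \<longrightarrow>
        J (\<lambda>x. ennreal (f x)) = ennreal (lebesgue_functional S \<SS> \<mu> f)) \<and>
     (\<forall>A\<in>\<SS>. J (indicator A) = \<mu> A) \<and>
     (\<forall>F f. (\<forall>n. F n \<in> nonneg_measurable S \<SS>) \<and>
            (\<forall>x\<in>S. incseq (\<lambda>n. F n x) \<and> (\<lambda>n. F n x) \<longlonglongrightarrow> f x)
            \<longrightarrow> (\<lambda>n. J (F n)) \<longlonglongrightarrow> J f)"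

text \<open>Meaningful for \<open>f \<in> nonneg_measurable S \<SS>\<close> only.\<close>

definition extended_integral ::
  "'a set \<Rightarrow> 'a set set \<Rightarrow> ('a set \<Rightarrow> ennreal) \<Rightarrow> ('a \<Rightarrow> ennreal) \<Rightarrow> ennreal" where
  "extended_integral S \<SS> \<mu> f = (THE c. \<exists>J. is_extended_integral S \<SS> \<mu> J \<and> J f = c)"

definition ring_integrable ::
  "'a set \<Rightarrow> 'a set set \<Rightarrow> ('a set \<Rightarrow> ennreal) \<Rightarrow> ('a \<Rightarrow> ereal) \<Rightarrow> bool" where
  "ring_integrable S \<SS> \<mu> f \<longleftrightarrow>
     ring_measurable S \<SS> f \<and> extended_integral S \<SS> \<mu> (\<lambda>x. e2ennreal \<bar>f x\<bar>) < \<infinity>"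

definition ring_integral ::
  "'a set \<Rightarrow> 'a set set \<Rightarrow> ('a set \<Rightarrow> ennreal) \<Rightarrow> ('a \<Rightarrow> ereal) \<Rightarrow> real" where
  "ring_integral S \<SS> \<mu> f =
     enn2real (extended_integral S \<SS> \<mu> (\<lambda>x. e2ennreal (max 0 (f x)))) -
     enn2real (extended_integral S \<SS> \<mu> (\<lambda>x. e2ennreal (max 0 (- f x))))"

definition exceptional_null_set ::
  "'a set \<Rightarrow> 'a set set \<Rightarrow> ('a set \<Rightarrow> ennreal) \<Rightarrow> ('a \<Rightarrow> bool) \<Rightarrow> 'a set \<Rightarrow> bool" where
  "exceptional_null_set S \<SS> \<mu> Q N \<longleftrightarrow> N \<in> \<SS> \<and> \<mu> N = 0 \<and> (\<forall>x \<in> S - N. Q x)"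

definition ring_almost_every ::
  "'a set \<Rightarrow> 'a set set \<Rightarrow> ('a set \<Rightarrow> ennreal) \<Rightarrow> ('a \<Rightarrow> bool) \<Rightarrow> bool" where
  "ring_almost_every S \<SS> \<mu> Q \<longleftrightarrow> (\<exists>N. exceptional_null_set S \<SS> \<mu> Q N)"

text \<open>\<open>g\<close>, defined where \<open>Q\<close> holds and hence almost everywhere, is integrable with integral \<open>c\<close>,
  whichever exceptional null set is used to modify it.\<close>

definition has_ae_integral ::
  "'a set \<Rightarrow> 'a set set \<Rightarrow> ('a set \<Rightarrow> ennreal) \<Rightarrow> ('a \<Rightarrow> bool) \<Rightarrow> ('a \<Rightarrow> ereal) \<Rightarrow> real \<Rightarrow> bool" where
  "has_ae_integral S \<SS> \<mu> Q g c \<longleftrightarrow>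
     ring_almost_every S \<SS> \<mu> Q \<and>
     (\<forall>N. exceptional_null_set S \<SS> \<mu> Q N \<longrightarrow>
        ring_integrable S \<SS> \<mu> (\<lambda>x. if x \<in> N then 0 else g x) \<and>
        ring_integral S \<SS> \<mu> (\<lambda>x. if x \<in> N then 0 else g x) = c)"


section \<open>Elementary functions and the Daniell--Stone integral\<close>

definition function_span :: "('a \<Rightarrow> real) set \<Rightarrow> ('a \<Rightarrow> real) set" where
  "function_span B = {\<lambda>x. \<Sum>i<n. c i * b i x | (n::nat) c b. \<forall>i<n. b i \<in> B}"

definition elementary :: "'a set set \<Rightarrow> ('a set \<Rightarrow> ennreal) \<Rightarrow> ('a \<Rightarrow> real) set" where
  "elementary \<SS> \<mu> = function_span {indicator A | A. A \<in> finite_sets \<SS> \<mu>}"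

text \<open>Meaningful for \<open>f \<in> elementary \<SS> \<mu>\<close> only.\<close>

definition elementary_functional ::
  "'a set set \<Rightarrow> ('a set \<Rightarrow> ennreal) \<Rightarrow> ('a \<Rightarrow> real) \<Rightarrow> real" where
  "elementary_functional \<SS> \<mu> f = (THE c. \<exists>I. linear_functional (elementary \<SS> \<mu>) I \<and>
     (\<forall>A \<in> finite_sets \<SS> \<mu>. I (indicator A) = enn2real (\<mu> A)) \<and> I f = c)"

definition elementary_prod ::
  "'a set set \<Rightarrow> ('a set \<Rightarrow> ennreal) \<Rightarrow> 'b set set \<Rightarrow> ('b set \<Rightarrow> ennreal) \<Rightarrow> ('a \<times> 'b \<Rightarrow> real) set" where
  "elementary_prod \<SS> \<mu> \<TT> \<nu> =
     function_span {indicator (A \<times> B) | A B. A \<in> finite_sets \<SS> \<mu> \<and> B \<in> finite_sets \<TT> \<nu>}"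

definition elementary_prod_functional ::
  "'a set set \<Rightarrow> ('a set \<Rightarrow> ennreal) \<Rightarrow> 'b set set \<Rightarrow> ('b set \<Rightarrow> ennreal) \<Rightarrow> ('a \<times> 'b \<Rightarrow> real) \<Rightarrow> real" where
  "elementary_prod_functional \<SS> \<mu> \<TT> \<nu> f =
     elementary_functional \<SS> \<mu> (\<lambda>s. elementary_functional \<TT> \<nu> (\<lambda>t. f (s, t)))"

definition increasing_limit ::
  "'a set \<Rightarrow> ('a \<Rightarrow> real) set \<Rightarrow> (nat \<Rightarrow> 'a \<Rightarrow> real) \<Rightarrow> ('a \<Rightarrow> ereal) \<Rightarrow> bool" where
  "increasing_limit X L F h \<longleftrightarrow>
     (\<forall>n. F n \<in> L) \<and> (\<forall>x\<in>X. incseq (\<lambda>n. F n x) \<and> (\<lambda>n. ereal (F n x)) \<longlonglongrightarrow> h x)"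

definition daniell_up :: "'a set \<Rightarrow> ('a \<Rightarrow> real) set \<Rightarrow> ('a \<Rightarrow> ereal) set" where
  "daniell_up X L = {h. \<exists>F. increasing_limit X L F h}"

definition daniell_up_functional ::
  "'a set \<Rightarrow> ('a \<Rightarrow> real) set \<Rightarrow> (('a \<Rightarrow> real) \<Rightarrow> real) \<Rightarrow> ('a \<Rightarrow> ereal) \<Rightarrow> ereal" where
  "daniell_up_functional X L I h =
     (THE l. \<exists>F. increasing_limit X L F h \<and> (\<lambda>n. ereal (I (F n))) \<longlonglongrightarrow> l)"

definition daniell_upper ::
  "'a set \<Rightarrow> ('a \<Rightarrow> real) set \<Rightarrow> (('a \<Rightarrow> real) \<Rightarrow> real) \<Rightarrow> ('a \<Rightarrow> real) \<Rightarrow> ereal" where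
  "daniell_upper X L I f =
     (INF h \<in> {h \<in> daniell_up X L. \<forall>x\<in>X. ereal (f x) \<le> h x}. daniell_up_functional X L I h)"

definition daniell_lower ::
  "'a set \<Rightarrow> ('a \<Rightarrow> real) set \<Rightarrow> (('a \<Rightarrow> real) \<Rightarrow> real) \<Rightarrow> ('a \<Rightarrow> real) \<Rightarrow> ereal" where
  "daniell_lower X L I f = - daniell_upper X L I (\<lambda>x. - f x)"

definition daniell_integrable ::
  "'a set \<Rightarrow> ('a \<Rightarrow> real) set \<Rightarrow> (('a \<Rightarrow> real) \<Rightarrow> real) \<Rightarrow> ('a \<Rightarrow> real) \<Rightarrow> bool" where
  "daniell_integrable X L I f \<longleftrightarrow>
     daniell_upper X L I f = daniell_lower X L I f \<and> \<bar>daniell_upper X L I f\<bar> \<noteq> \<infinity>"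

definition daniell_integral ::
  "'a set \<Rightarrow> ('a \<Rightarrow> real) set \<Rightarrow> (('a \<Rightarrow> real) \<Rightarrow> real) \<Rightarrow> ('a \<Rightarrow> real) \<Rightarrow> real" where
  "daniell_integral X L I f = real_of_ereal (daniell_upper X L I f)"

end

theory Submission
  imports Defs
begin

text \<open>
  A measure on a \<open>\<sigma>\<close>-ring extends to the \<open>\<sigma>\<close>-algebra generated by the ring and the whole space if
  all new sets get the value \<open>\<infinity>\<close> (\<open>ring_extension\<close>). With this choice every function with a finite
  integral vanishes off a \<open>\<sigma>\<close>-finite member of the ring. The axioms that characterise the Lebesgue
  integral and the extended Lebesgue integral therefore single out the Bochner integral and the
  nonnegative integral of the extension (\<open>lebesgue_integral_unique\<close>, \<open>extended_integral_unique\<close>),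
  and all statements become statements about measures on \<open>\<sigma>\<close>-algebras.

  For the product, any countable family in the product of the rings of \<open>\<sigma>\<close>-finite sets lies in one
  rectangle \<open>A \<times> B\<close> with \<open>\<sigma>\<close>-finite sides. Inside that rectangle the product of the two measures,
  cut off by the indicators of \<open>A\<close> and \<open>B\<close>, is a product of \<open>\<sigma>\<close>-finite measures. These local
  products fit together to the measure \<open>E \<mapsto> \<integral>\<^sup>+s. \<nu> (E\<^sub>s) d\<mu>\<close>, which is the classical product; its
  extension by \<open>\<infinity>\<close> is the product measure (\<open>product_measure_eq\<close>). A function with \<open>\<sigma>\<close>-finite
  support has the same integral for the product measure and for a local product, so Tonelli's theorem
  for \<open>\<sigma>\<close>-finite measures carries over (\<open>tonelli\<close>). An integrable function has \<open>\<sigma>\<close>-finite support,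
  and Fubini's theorem follows by splitting it into positive and negative parts
  (\<open>has_ae_integral_sections\<close>).

  The functional on elementary functions is integration with respect to the product measure. So for
  the Daniell--Stone integral the point is that an integrable \<open>f\<close> has majorants, limits of increasing
  sequences of elementary functions, with integrals arbitrarily close to that of \<open>f\<close>
  (\<open>approximable_integrable\<close>). The functions \<open>f\<close> for which both \<open>f\<close> and \<open>- f\<close> have this property form
  a linear space that is closed under integrable monotone limits. It contains the indicators of
  rectangles with sides of finite measure, hence by Dynkin's argument those of all sets of finite
  measure, hence all integrable functions. Conversely, a finite upper integral of \<open>f\<close> gives a majorant
  of \<open>f\<close> with finite integral, and with one of \<open>- f\<close> as well \<open>f\<close> is integrable.
\<close>

section \<open>\<open>\<sigma>\<close>-rings\<close>

sublocale sigma_ring \<subseteq> ring: ring_of_sets S \<SS>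
proof (rule ring_of_setsI)
  show "\<SS> \<subseteq> Pow S" by (rule space_closed)
  show "{} \<in> \<SS>" by (rule empty)
  show "A - B \<in> \<SS>" if "A \<in> \<SS>" "B \<in> \<SS>" for A B using that by (rule Diff)
  show "A \<union> B \<in> \<SS>" if "A \<in> \<SS>" "B \<in> \<SS>" for A B
    unfolding Un_range_binary by (rule countable_UN) (simp add: range_binary_eq that)
qed

context sigma_ring
begin

lemma sigma_sets_eq_ring_or_co_ring: "sigma_sets S (\<SS> \<union> {S}) = \<SS> \<union> {S - A |A. A \<in> \<SS>}"
proof
  show "sigma_sets S (\<SS> \<union> {S}) \<subseteq> \<SS> \<union> {S - A |A. A \<in> \<SS>}"
  proof
    fix E assume "E \<in> sigma_sets S (\<SS> \<union> {S})"
    then show "E \<in> \<SS> \<union> {S - A |A. A \<in> \<SS>}"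
    proof induction
      case (Basic a)
      then show ?case using empty by auto
    next
      case (Compl a)
      then show ?case using sets_into_space by (auto simp: double_diff)
    next
      case (Union A)
      show ?case
      proof (cases "range A \<subseteq> \<SS>")
        case True
        then show ?thesis using countable_UN by auto
      next
        case False
        then obtain i C where C: "C \<in> \<SS>" "A i = S - C" using Union.IH by fast
        have "C \<inter> A j \<in> \<SS>" for j
        proof -
          from Union.IH[of j] consider "A j \<in> \<SS>" | D where "D \<in> \<SS>" "A j = S - D" by auto
          then show ?thesis
          proof cases
            case 2
            then have "C \<inter> A j = C - D" using C sets_into_space by auto
            then show ?thesis using 2 C by auto
          qed (use C in auto)
        qed
        \<comment> \<open>One member \<open>S - C\<close> of the union puts the complement of the union inside \<open>C\<close>.\<close>
        then have "(\<Union>j. C \<inter> A j) \<in> \<SS>" by (intro countable_UN) auto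
        then have "C - (\<Union>j. C \<inter> A j) \<in> \<SS>" using C by auto
        moreover have "(\<Union>j. A j) = S - (C - (\<Union>j. C \<inter> A j))"
        proof -
          have eq: "U = S - (C - C \<inter> U)" if "U \<subseteq> S" "S - C \<subseteq> U" for U using that by blast
          have sub: "A j \<subseteq> S" for j
            using sigma_sets_into_sp[OF _ Union.hyps(1)[of j]] space_closed by auto
          have "(\<Union>j. A j) \<subseteq> S" by (rule UN_least) (rule sub)
          moreover have "S - C \<subseteq> (\<Union>j. A j)" unfolding C(2)[symmetric] by (rule UN_upper) simp
          moreover have "(\<Union>j. C \<inter> A j) = C \<inter> (\<Union>j. A j)" by simp
          ultimately show ?thesis using eq by metis
        qed
        ultimately show ?thesis by (intro UnI2 CollectI exI conjI)
      qed
    qed (use empty in auto)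
  qed
  have "S - A \<in> sigma_sets S (\<SS> \<union> {S})" if "A \<in> \<SS>" for A
    using that by (intro sigma_sets.Compl sigma_sets.Basic) auto
  then show "\<SS> \<union> {S - A |A. A \<in> \<SS>} \<subseteq> sigma_sets S (\<SS> \<union> {S})" by auto
qed

text \<open>The \<open>\<sigma>\<close>-ring is an ideal of the \<open>\<sigma>\<close>-algebra that defines measurability; this is why a
  measurable function that vanishes off a member of the \<open>\<sigma>\<close>-ring is measurable in the strict sense.\<close>

lemma sigma_sets_Int_ring:
  assumes "E \<in> sigma_sets S (\<SS> \<union> {S})" "A \<in> \<SS>"
  shows "E \<inter> A \<in> \<SS>"
proof -
  from assms(1) consider "E \<in> \<SS>" | D where "D \<in> \<SS>" "E = S - D"
    unfolding sigma_sets_eq_ring_or_co_ring by auto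
  then show ?thesis
  proof cases
    case 2
    then have "E \<inter> A = A - D" using assms sets_into_space by auto
    then show ?thesis using 2 assms by auto
  qed (use assms in auto)
qed

end

lemma sigma_ring_generated: "sigma_ring UNIV (generated_sigma_ring C)"
  unfolding generated_sigma_ring_def
proof
  show "(\<Union>i. A i) \<in> \<Inter> {R. sigma_ring UNIV R \<and> C \<subseteq> R}"
    if "range A \<subseteq> \<Inter> {R. sigma_ring UNIV R \<and> C \<subseteq> R}" for A :: "nat \<Rightarrow> _"
    using that by (auto intro!: sigma_ring.countable_UN)
qed (auto intro: sigma_ring.empty sigma_ring.Diff)

lemma subset_generated_sigma_ring: "C \<subseteq> generated_sigma_ring C"
  unfolding generated_sigma_ring_def by auto

lemma generated_sigma_ring_induct [consumes 1, case_names basic empty Diff union]: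
  assumes "E \<in> generated_sigma_ring C"
    and "\<And>A. A \<in> C \<Longrightarrow> P A" "P {}" "\<And>A B. P A \<Longrightarrow> P B \<Longrightarrow> P (A - B)"
    and "\<And>A :: nat \<Rightarrow> _. (\<And>i. P (A i)) \<Longrightarrow> P (\<Union>i. A i)"
  shows "P E"
proof -
  have "sigma_ring UNIV {E. P E}"
    by unfold_locales (use assms(3-4) in \<open>auto intro!: assms(5)\<close>)
  then have "generated_sigma_ring C \<subseteq> {E. P E}"
    unfolding generated_sigma_ring_def using assms(2) by auto
  with assms(1) show ?thesis by auto
qed

lemma ring_prod_induct [consumes 1, case_names times empty Diff union]:
  assumes "E \<in> \<SS> \<otimes>\<^sub>R \<TT>"
    and "\<And>A B. A \<in> \<SS> \<Longrightarrow> B \<in> \<TT> \<Longrightarrow> P (A \<times> B)" "P {}" "\<And>A B. P A \<Longrightarrow> P B \<Longrightarrow> P (A - B)"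
    and "\<And>A :: nat \<Rightarrow> _. (\<And>i. P (A i)) \<Longrightarrow> P (\<Union>i. A i)"
  shows "P E"
  using assms(1) unfolding ring_prod_def
  by (induction rule: generated_sigma_ring_induct) (use assms(2-) in auto)

lemma times_in_ring_prod: "A \<in> \<SS> \<Longrightarrow> B \<in> \<TT> \<Longrightarrow> A \<times> B \<in> \<SS> \<otimes>\<^sub>R \<TT>"
  unfolding ring_prod_def using subset_generated_sigma_ring by fastforce

interpretation ring_prod: sigma_ring UNIV "\<SS> \<otimes>\<^sub>R \<TT>" for \<SS> :: "'a set set" and \<TT> :: "'b set set"
  unfolding ring_prod_def by (rule sigma_ring_generated)

lemma ring_prod_countable_UN: "(\<And>i. A i \<in> \<SS> \<otimes>\<^sub>R \<TT>) \<Longrightarrow> (\<Union>i::nat. A i) \<in> \<SS> \<otimes>\<^sub>R \<TT>"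
  by (rule ring_prod.countable_UN) auto

lemma ring_prod_mono:
  assumes "\<SS>' \<subseteq> \<SS>" "\<TT>' \<subseteq> \<TT>"
  shows "\<SS>' \<otimes>\<^sub>R \<TT>' \<subseteq> \<SS> \<otimes>\<^sub>R \<TT>"
proof
  fix E assume "E \<in> \<SS>' \<otimes>\<^sub>R \<TT>'"
  then show "E \<in> \<SS> \<otimes>\<^sub>R \<TT>"
  proof (induction rule: ring_prod_induct)
    case (times A B)
    then show ?case using assms by (intro times_in_ring_prod) auto
  next
    case (union A)
    then show ?case by (rule ring_prod_countable_UN)
  qed (rule ring_prod.empty, rule ring_prod.Diff)
qed

text \<open>Cutting with \<open>A \<times> B\<close> maps rectangles to rectangles and commutes with differences and countable
  unions. The ideals that matter are the families of \<open>\<sigma>\<close>-finite sets.\<close>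

lemma ring_prod_Int_times_in_ideal:
  assumes "E \<in> \<SS> \<otimes>\<^sub>R \<TT>" "A \<in> \<SS>'" "B \<in> \<TT>'"
    and "\<And>X Y. X \<in> \<SS>' \<Longrightarrow> Y \<in> \<SS> \<Longrightarrow> Y \<inter> X \<in> \<SS>'"
    and "\<And>X Y. X \<in> \<TT>' \<Longrightarrow> Y \<in> \<TT> \<Longrightarrow> Y \<inter> X \<in> \<TT>'"
  shows "E \<inter> A \<times> B \<in> \<SS>' \<otimes>\<^sub>R \<TT>'"
  using assms(1)
proof (induction rule: ring_prod_induct)
  case (times X Y)
  have "X \<times> Y \<inter> A \<times> B = (X \<inter> A) \<times> (Y \<inter> B)" by auto
  then show ?case using times assms by (simp add: times_in_ring_prod)
next
  case (Diff X Y)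
  have "(X - Y) \<inter> A \<times> B = (X \<inter> A \<times> B) - (Y \<inter> A \<times> B)" by auto
  then show ?case using Diff by (simp only: ring_prod.Diff)
next
  case (union X)
  have "(\<Union>i. X i) \<inter> A \<times> B = (\<Union>i. X i \<inter> A \<times> B)" by auto
  then show ?case using union by (simp only: ring_prod_countable_UN)
qed (simp add: ring_prod.empty)

lemma ring_prod_subset_pair_measure:
  assumes "\<SS> \<subseteq> sets M" "\<TT> \<subseteq> sets N" "E \<in> \<SS> \<otimes>\<^sub>R \<TT>"
  shows "E \<in> sets (M \<Otimes>\<^sub>M N)"
  using assms(3) by (induction rule: ring_prod_induct) (use assms in auto)

locale sigma_ring_pair = left: sigma_ring S \<SS> + right: sigma_ring T \<TT>
  for S :: "'a set" and \<SS> and T :: "'b set" and \<TT>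
begin

text \<open>The sides of countably many rectangles can be united inside the \<open>\<sigma>\<close>-rings. So even a countable
  family of members of the product lies in one rectangle, and can be studied there.\<close>

lemma ring_prod_subset_times:
  assumes "E \<in> \<SS> \<otimes>\<^sub>R \<TT>"
  obtains A B where "A \<in> \<SS>" "B \<in> \<TT>" "E \<subseteq> A \<times> B"
proof -
  from assms have "\<exists>A\<in>\<SS>. \<exists>B\<in>\<TT>. E \<subseteq> A \<times> B"
  proof (induction rule: ring_prod_induct)
    case (union E)
    then obtain A B where AB: "\<And>i. A i \<in> \<SS>" "\<And>i. B i \<in> \<TT>" "\<And>i. E i \<subseteq> A i \<times> B i" by metis
    then have "(\<Union>i. A i) \<in> \<SS>" "(\<Union>i. B i) \<in> \<TT>"
      by (auto intro!: left.countable_UN right.countable_UN)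
    moreover have "(\<Union>i. E i) \<subseteq> (\<Union>i. A i) \<times> (\<Union>i. B i)" using AB by fastforce
    ultimately show ?case by blast
  next
    case empty
    then show ?case by (meson left.empty right.empty empty_subsetI)
  qed blast+
  then show thesis using that by blast
qed

lemma sigma_ring_ring_prod: "sigma_ring (S \<times> T) (\<SS> \<otimes>\<^sub>R \<TT>)"
proof
  show "\<SS> \<otimes>\<^sub>R \<TT> \<subseteq> Pow (S \<times> T)"
  proof
    fix E assume "E \<in> \<SS> \<otimes>\<^sub>R \<TT>"
    then obtain A B where AB: "A \<in> \<SS>" "B \<in> \<TT>" "E \<subseteq> A \<times> B" by (rule ring_prod_subset_times)
    then have "A \<subseteq> S" "B \<subseteq> T" using left.sets_into_space right.sets_into_space by auto
    with AB show "E \<in> Pow (S \<times> T)" by auto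
  qed
qed (rule ring_prod.empty, rule ring_prod.countable_UN, assumption, rule ring_prod.Diff)

lemma ring_prod_section:
  assumes "E \<in> \<SS> \<otimes>\<^sub>R \<TT>"
  shows "Pair s -` E \<in> \<TT>" and "(\<lambda>s. (s, t)) -` E \<in> \<SS>"
proof -
  show "Pair s -` E \<in> \<TT>" using assms
  proof (induction rule: ring_prod_induct)
    case (times A B)
    then show ?case by (cases "s \<in> A") (simp_all add: vimage_def right.empty)
  next
    case (union E)
    then show ?case unfolding vimage_UN by (intro right.countable_UN) auto
  qed (simp_all add: vimage_Diff right.Diff right.empty)
  show "(\<lambda>s. (s, t)) -` E \<in> \<SS>" using assms
  proof (induction rule: ring_prod_induct)
    case (times A B)
    then show ?case by (cases "t \<in> B") (simp_all add: vimage_def left.empty)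
  next
    case (union E)
    then show ?case unfolding vimage_UN by (intro left.countable_UN) auto
  qed (simp_all add: vimage_Diff left.Diff left.empty)
qed

end

section \<open>Extending a measure on a \<open>\<sigma>\<close>-ring to a \<open>\<sigma>\<close>-algebra\<close>

text \<open>This carries the theory of measures on \<open>\<sigma>\<close>-algebras over to \<open>\<sigma>\<close>-rings. The value \<open>\<infinity>\<close> off
  the \<open>\<sigma>\<close>-ring is the largest choice: it forces every function that is integrable for the extension
  to vanish off a member of the \<open>\<sigma>\<close>-ring, so that no integrable function is gained.\<close>

definition ring_extension :: "'a set \<Rightarrow> 'a set set \<Rightarrow> ('a set \<Rightarrow> ennreal) \<Rightarrow> 'a measure" where
  "ring_extension S \<SS> \<mu> = measure_of S (\<SS> \<union> {S}) (\<lambda>A. if A \<in> \<SS> then \<mu> A else \<infinity>)"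

context ring_measure_space
begin

abbreviation M where "M \<equiv> ring_extension S \<SS> \<mu>"

lemma space_M [simp]: "space M = S"
  unfolding ring_extension_def using sets_into_space by (auto intro!: space_measure_of)

lemma sets_M_eq_sigma_sets: "sets M = sigma_sets S (\<SS> \<union> {S})"
  unfolding ring_extension_def using sets_into_space by (auto intro!: sets_measure_of)

lemma sets_M: "sets M = \<SS> \<union> {S - A |A. A \<in> \<SS>}"
  unfolding sets_M_eq_sigma_sets sigma_sets_eq_ring_or_co_ring ..

lemma ring_subset_sets_M [simp, intro]: "A \<in> \<SS> \<Longrightarrow> A \<in> sets M"
  unfolding sets_M by auto

lemma sets_M_Int_ring: "E \<in> sets M \<Longrightarrow> A \<in> \<SS> \<Longrightarrow> E \<inter> A \<in> \<SS>"
  unfolding sets_M_eq_sigma_sets by (rule sigma_sets_Int_ring)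

lemma sets_M_subset_ring: "E \<in> sets M \<Longrightarrow> A \<in> \<SS> \<Longrightarrow> E \<subseteq> A \<Longrightarrow> E \<in> \<SS>"
  by (metis sets_M_Int_ring inf.absorb1)

lemma measurable_M: "borel_measurable (sigma S (\<SS> \<union> {S})) = borel_measurable M"
  by (rule measurable_cong_sets)
    (use sets_into_space in \<open>auto simp: sets_M_eq_sigma_sets intro!: sets_measure_of\<close>)

text \<open>A countable union that contains a set \<open>S - A\<close> with \<open>A \<in> \<SS>\<close> can only belong to \<open>\<SS>\<close> if
  \<open>S\<close> does, in which case \<open>\<SS>\<close> is already a \<open>\<sigma>\<close>-algebra; hence the value \<open>\<infinity>\<close> is additive.\<close>

lemma emeasure_M:
  assumes "E \<in> sets M"
  shows "emeasure M E = (if E \<in> \<SS> then \<mu> E else \<infinity>)"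
proof -
  let ?e = "\<lambda>A. if A \<in> \<SS> then \<mu> A else \<infinity>"
  have ca: "countably_additive (sets M) ?e"
    unfolding countably_additive_def
  proof safe
    fix A :: "nat \<Rightarrow> 'a set"
    assume A: "range A \<subseteq> sets M" "disjoint_family A" "\<Union> (range A) \<in> sets M"
    show "(\<Sum>i. ?e (A i)) = ?e (\<Union> (range A))"
    proof (cases "range A \<subseteq> \<SS>")
      case True
      then have "(\<Sum>i. \<mu> (A i)) = \<mu> (\<Union> (range A))"
        using A measure countable_UN unfolding ring_measure_def countably_additive_def by auto
      then show ?thesis using True countable_UN by (auto simp: range_subsetD)
    next
      case False
      then obtain i where i: "A i \<notin> \<SS>" by auto
      then have "\<Union> (range A) \<notin> \<SS>"
        using sets_M_subset_ring[of "A i" "\<Union> (range A)"] A by auto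
      moreover have "(\<Sum>i. ?e (A i)) \<ge> (\<Sum>j\<in>{i}. ?e (A j))"
        by (intro sum_le_suminf) auto
      then have "(\<Sum>i. ?e (A i)) = \<infinity>" using i by (auto simp: top_unique)
      ultimately show ?thesis by simp
    qed
  qed
  have "positive (sets M) ?e"
    using measure empty unfolding ring_measure_def positive_def by auto
  with ca show ?thesis
    using emeasure_measure_of[OF ring_extension_def _ _ _ assms] sets_into_space
    by (simp add: Un_subset_iff subset_iff Pow_iff)
qed

lemma emeasure_M_ring [simp]: "A \<in> \<SS> \<Longrightarrow> emeasure M A = \<mu> A"
  by (simp add: emeasure_M)

lemma finite_emeasure_M_in_ring: "E \<in> sets M \<Longrightarrow> emeasure M E < \<infinity> \<Longrightarrow> E \<in> \<SS>"
  by (auto simp: emeasure_M split: if_splits)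

lemma measure_mono: "A \<in> \<SS> \<Longrightarrow> B \<in> \<SS> \<Longrightarrow> A \<subseteq> B \<Longrightarrow> \<mu> A \<le> \<mu> B"
  using emeasure_mono[of A B M] by simp

lemma ring_measurable_iff:
  "ring_measurable S \<SS> f \<longleftrightarrow> f \<in> borel_measurable M \<and> {x \<in> S. f x \<noteq> 0} \<in> \<SS>"
  unfolding ring_measurable_def measurable_M ..

lemma ring_measurable_if_support_subset:
  fixes f :: "'a \<Rightarrow> 'c :: {t1_space, zero}"
  assumes "f \<in> borel_measurable M" "A \<in> \<SS>" "\<And>x. x \<in> S \<Longrightarrow> x \<notin> A \<Longrightarrow> f x = 0"
  shows "ring_measurable S \<SS> f"
proof -
  have "f -` (- {0}) \<inter> space M \<in> sets M"
    by (rule measurable_sets[OF assms(1)]) auto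
  then have "{x \<in> S. f x \<noteq> 0} \<in> sets M"
    by (auto simp: vimage_def Int_def conj_commute)
  then have "{x \<in> S. f x \<noteq> 0} \<in> \<SS>"
    by (rule sets_M_subset_ring[OF _ assms(2)]) (use assms(3) in auto)
  with assms(1) show ?thesis by (simp add: ring_measurable_iff)
qed

end

section \<open>The Lebesgue integral of a measure on a \<open>\<sigma>\<close>-ring\<close>

text \<open>Cutting a function off from above at \<open>n\<close> and from below at \<open>1 / (n + 1)\<close> leaves a bounded
  function that lives on a level set. Nonnegative functions are increasing limits of such cut-offs,
  and the integral of a cut-off is controlled by the measure of a single level set.\<close>

definition truncation :: "nat \<Rightarrow> ennreal \<Rightarrow> real" where
  "truncation n y = (if ennreal (1 / Suc n) < y then enn2real (min y (of_nat n)) else 0)"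

lemma truncation_nonneg [simp]: "0 \<le> truncation n y"
  by (simp add: truncation_def)

lemma ennreal_truncation:
  "ennreal (truncation n y) = (if ennreal (1 / Suc n) < y then min y (of_nat n) else 0)"
proof -
  have "min y (of_nat n) < top" by (simp add: min_less_iff_disj of_nat_less_top)
  then show ?thesis by (simp add: truncation_def ennreal_enn2real)
qed

lemma truncation_le: "ennreal (truncation n y) \<le> y"
  by (simp add: ennreal_truncation)

lemma truncation_le_nat: "truncation n y \<le> real n"
proof -
  have "ennreal (truncation n y) \<le> ennreal (real n)"
    by (simp add: ennreal_truncation ennreal_of_nat_eq_real_of_nat)
  then show ?thesis by (simp add: ennreal_le_iff)
qed

lemma truncation_zero [simp]: "truncation n 0 = 0"
  by (simp add: truncation_def)

lemma truncation_mono: "m \<le> n \<Longrightarrow> truncation m y \<le> truncation n y"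
proof -
  assume "m \<le> n"
  then have "ennreal (1 / Suc n) \<le> ennreal (1 / Suc m)"
    by (intro ennreal_leI) (simp add: field_simps)
  moreover from \<open>m \<le> n\<close> have "min y (of_nat m) \<le> min y (of_nat n)" by (intro min.mono) auto
  ultimately have "ennreal (truncation m y) \<le> ennreal (truncation n y)"
    unfolding ennreal_truncation using order.strict_trans1[of "ennreal (1 / Suc n)" "ennreal (1 / Suc m)" y]
    by auto
  then show ?thesis by (simp add: ennreal_le_iff)
qed

lemma tendsto_truncation: "(\<lambda>n. ennreal (truncation n y)) \<longlonglongrightarrow> y"
proof (cases "y = 0")
  case False
  have "(\<lambda>n. ennreal (1 / Suc n)) \<longlonglongrightarrow> ennreal 0"
    by (intro tendsto_ennrealI) (rule LIMSEQ_Suc[OF lim_1_over_n])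
  then have small: "eventually (\<lambda>n. ennreal (1 / Suc n) < y) sequentially"
    by (rule order_tendstoD) (use False in \<open>auto simp: zero_less_iff_neq_zero\<close>)
  have "(\<lambda>n. min y (of_nat n)) \<longlonglongrightarrow> min y top"
    by (intro tendsto_min tendsto_const of_nat_tendsto_top_ennreal)
  then have "(\<lambda>n. min y (of_nat n)) \<longlonglongrightarrow> y" by (simp add: min_top2)
  then show ?thesis
    by (rule Lim_transform_eventually)
      (use small in eventually_elim, simp add: ennreal_truncation)
qed simp

lemma borel_measurable_truncation [measurable]: "truncation n \<in> borel_measurable borel"
  unfolding truncation_def[abs_def] by measurable

lemma nn_integral_truncation_tendsto:
  assumes "f \<in> borel_measurable M"
  shows "(\<lambda>n. \<integral>\<^sup>+x. truncation n (f x) \<partial>M) \<longlonglongrightarrow> (\<integral>\<^sup>+x. f x \<partial>M)"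
  using assms
  by (intro nn_integral_LIMSEQ tendsto_truncation)
    (auto simp: incseq_def le_fun_def truncation_mono intro!: ennreal_leI)

lemma integrable_truncation:
  assumes [measurable]: "f \<in> borel_measurable M"
    and "emeasure M {x \<in> space M. ennreal (1 / Suc n) < f x} < \<infinity>"
  shows "integrable M (\<lambda>x. truncation n (f x))"
  by (rule integrableI_bounded_set[where A="{x \<in> space M. ennreal (1 / Suc n) < f x}" and B=n])
    (use assms in \<open>auto simp: truncation_le_nat, auto simp: truncation_def\<close>)

context ring_measure_space
begin

text \<open>By Markov's inequality the sets \<open>{x. 1 \<le> n * f x}\<close>, whose union is the support, have finite
  measure.\<close>

lemma nn_integral_finite_support:
  assumes f [measurable]: "f \<in> borel_measurable M" and "(\<integral>\<^sup>+x. f x \<partial>M) < \<infinity>"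
  shows "{x \<in> S. f x \<noteq> 0} \<in> sigma_finite_sets \<SS> \<mu>"
proof -
  have sets_S: "S \<in> sets M" using sets.top[of M] by simp
  define A where "A n = {x \<in> S. 1 \<le> ennreal (real n) * f x}" for n
  have A_sets: "A n \<in> sets M" for n
  proof -
    have "{x \<in> space M. 1 \<le> ennreal (real n) * f x} \<in> sets M" by measurable
    then show ?thesis by (simp add: A_def)
  qed
  have "emeasure M (A n) < \<infinity>" for n
  proof -
    have "emeasure M (A n) \<le> ennreal (real n) * (\<integral>\<^sup>+x. f x * indicator (space M) x \<partial>M)"
      using nn_integral_Markov_inequality[OF _ sets.top, of f M "ennreal (real n)"]
      unfolding A_def space_M by (simp add: borel_measurable_times_ennreal borel_measurable_indicator sets_S)
    also have "\<dots> = ennreal (real n) * (\<integral>\<^sup>+x. f x \<partial>M)"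
      by (intro arg_cong2[where f="(*)"] refl nn_integral_cong) simp
    also have "\<dots> < \<infinity>" using assms by (simp add: ennreal_mult_less_top)
    finally show ?thesis .
  qed
  then have "A n \<in> finite_sets \<SS> \<mu>" for n
    using finite_emeasure_M_in_ring[OF A_sets[of n]] by (auto simp: finite_sets_def simp flip: emeasure_M_ring)
  moreover have "{x \<in> S. f x \<noteq> 0} = (\<Union>n. A n)"
  proof -
    have "\<exists>n. 1 \<le> ennreal (real n) * y" if "y \<noteq> 0" for y :: ennreal
    proof (cases y)
      case (real r)
      then have "0 < r" using that by (simp add: le_less)
      then obtain n where "1 < real n * r" using reals_Archimedean3 by blast
      then show ?thesis using real by (intro exI[of _ n]) (simp add: ennreal_mult[symmetric] flip: ennreal_1)
    next
      case top
      then show ?thesis by (intro exI[of _ 1]) simp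
    qed
    then show ?thesis by (auto simp: A_def)
  qed
  ultimately show ?thesis unfolding sigma_finite_sets_def by blast
qed

lemma sigma_finite_sets_subset: "sigma_finite_sets \<SS> \<mu> \<subseteq> \<SS>"
  unfolding sigma_finite_sets_def finite_sets_def by (auto intro!: countable_UN)

lemma integrable_ring_measurable:
  fixes f :: "'a \<Rightarrow> real"
  assumes "integrable M f"
  shows "ring_measurable S \<SS> f"
proof -
  have "(\<integral>\<^sup>+x. ennreal \<bar>f x\<bar> \<partial>M) < \<infinity>" using assms by (auto simp: integrable_iff_bounded)
  from nn_integral_finite_support[OF _ this] have "{x \<in> S. f x \<noteq> 0} \<in> \<SS>"
    using assms sigma_finite_sets_subset by auto
  then show ?thesis using assms by (auto simp: ring_measurable_iff)
qed

lemma integrable_indicator_ring: "A \<in> \<SS> \<Longrightarrow> integrable M (indicator A :: 'a \<Rightarrow> real) \<longleftrightarrow> \<mu> A < \<infinity>"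
  using sets_into_space[of A] by (simp add: integrable_indicator_iff Int_absorb2)

lemma integrable_monotone_convergence_space:
  fixes F :: "nat \<Rightarrow> 'a \<Rightarrow> real"
  assumes F: "\<And>n. integrable M (F n)" and "\<And>x. x \<in> S \<Longrightarrow> incseq (\<lambda>n. F n x)"
    and lim: "\<And>x. x \<in> S \<Longrightarrow> (\<lambda>n. F n x) \<longlonglongrightarrow> f x"
    and "bdd_above (range (\<lambda>n. integral\<^sup>L M (F n)))"
  shows "integrable M f" "(\<lambda>n. integral\<^sup>L M (F n)) \<longlonglongrightarrow> integral\<^sup>L M f"
proof -
  have "incseq (\<lambda>n. integral\<^sup>L M (F n))"
    using assms by (auto simp: incseq_def intro!: integral_mono)
  then have conv: "(\<lambda>n. integral\<^sup>L M (F n)) \<longlonglongrightarrow> (SUP n. integral\<^sup>L M (F n))"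
    using assms(4) by (intro LIMSEQ_incseq_SUP)
  have f: "f \<in> borel_measurable M"
    by (rule borel_measurable_LIMSEQ_real[of _ F]) (use F lim in auto)
  have AE: "AE x in M. mono (\<lambda>n. F n x)" "AE x in M. (\<lambda>n. F n x) \<longlonglongrightarrow> f x"
    using assms(2,3) by (auto intro!: AE_I2)
  show "integrable M f"
    by (rule integrable_monotone_convergence[OF F AE conv]) fact
  have "integral\<^sup>L M f = (SUP n. integral\<^sup>L M (F n))"
    by (rule integral_monotone_convergence[OF F AE conv]) fact
  with conv show "(\<lambda>n. integral\<^sup>L M (F n)) \<longlonglongrightarrow> integral\<^sup>L M f" by simp
qed

lemma is_lebesgue_integral_integral:
  "is_lebesgue_integral S \<SS> \<mu> {f. integrable M f} (integral\<^sup>L M)"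
proof -
  let ?D = "{f :: 'a \<Rightarrow> real. integrable M f}"
  have ind: "(indicator A \<in> ?D \<longleftrightarrow> \<mu> A < \<infinity>) \<and> (indicator A \<in> ?D \<longrightarrow> ennreal (integral\<^sup>L M (indicator A)) = \<mu> A)"
    if "A \<in> \<SS>" for A
  proof (intro conjI impI)
    show "indicator A \<in> ?D \<longleftrightarrow> \<mu> A < \<infinity>"
      using integrable_indicator_ring[OF that] by simp
    assume "indicator A \<in> ?D"
    then have "\<mu> A < \<infinity>" using integrable_indicator_ring[OF that] by simp
    moreover have "integral\<^sup>L M (indicator A) = measure M A"
      using that sets_into_space[of A] by (simp add: Int_absorb2)
    ultimately show "ennreal (integral\<^sup>L M (indicator A)) = \<mu> A"
      using that by (simp add: measure_def ennreal_enn2real)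
  qed
  have min1: "integrable M (\<lambda>x. min (f x) 1)" if "integrable M f" for f :: "'a \<Rightarrow> real"
    by (rule Bochner_Integration.integrable_bound[OF that]) (use that in auto)
  show ?thesis
    unfolding is_lebesgue_integral_def function_space_def linear_functional_def
  proof (intro conjI ballI allI impI; (elim conjE)?)
    fix F :: "nat \<Rightarrow> 'a \<Rightarrow> real" and f
    assume *: "\<forall>n. F n \<in> ?D"
      "\<forall>x\<in>S. incseq (\<lambda>n. F n x) \<and> (\<lambda>n. F n x) \<longlonglongrightarrow> f x"
      "bdd_above (range (\<lambda>n. integral\<^sup>L M (F n)))"
    show "f \<in> ?D"
      using integrable_monotone_convergence_space(1)[of F f] * by auto
    show "(\<lambda>n. integral\<^sup>L M (F n)) \<longlonglongrightarrow> integral\<^sup>L M f"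
      using integrable_monotone_convergence_space(2)[of F f] * by auto
  qed (use ind in \<open>auto simp: integrable_ring_measurable min1 intro!: integral_nonneg_AE\<close>)
qed

text \<open>The decomposition into positive and negative parts reduces the claim to nonnegative functions,
  for which the partial sums and limits in the usual induction stay below the given function.\<close>

lemma integrable_induct_mono_limits [consumes 1, case_names set add mult mono_lim]:
  fixes f :: "'a \<Rightarrow> real"
  assumes f: "integrable M f"
    and set: "\<And>A. A \<in> \<SS> \<Longrightarrow> \<mu> A < \<infinity> \<Longrightarrow> P (indicator A)"
    and add: "\<And>f g. integrable M f \<Longrightarrow> P f \<Longrightarrow> integrable M g \<Longrightarrow> P g \<Longrightarrow> P (\<lambda>x. f x + g x)"
    and mult: "\<And>f c. integrable M f \<Longrightarrow> P f \<Longrightarrow> P (\<lambda>x. c * f x)"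
    and mono_lim: "\<And>F f. (\<And>n :: nat. integrable M (F n)) \<Longrightarrow> (\<And>n. P (F n)) \<Longrightarrow>
      (\<And>x. x \<in> S \<Longrightarrow> incseq (\<lambda>n. F n x)) \<Longrightarrow> (\<And>x. x \<in> S \<Longrightarrow> (\<lambda>n. F n x) \<longlonglongrightarrow> f x) \<Longrightarrow>
      integrable M f \<Longrightarrow> P f"
  shows "P f"
proof -
  have nonneg: "P g" if "g \<in> borel_measurable M" "\<And>x. 0 \<le> g x" "integrable M g" for g
    using that
  proof (induction rule: borel_measurable_induct_real)
    case (set A)
    then have "emeasure M A < \<infinity>" using sets.sets_into_space[of A M]
      by (simp add: integrable_indicator_iff Int_absorb2)
    then have "A \<in> \<SS>" "\<mu> A < \<infinity>" using finite_emeasure_M_in_ring[OF set(1)] by auto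
    then show ?case by (rule assms(2))
  next
    case (mult u c)
    show ?case
    proof (cases "c = 0")
      case True
      have "P (\<lambda>x. 0 * indicator {} x)"
        by (intro assms(4) assms(2)) (use measure empty in \<open>auto simp: ring_measure_def positive_def\<close>)
      then show ?thesis using True by simp
    next
      case False
      then have "integrable M u" using mult.prems by simp
      then show ?thesis using mult.IH by (intro assms(4)) auto
    qed
  next
    case (add u v)
    have "integrable M u" "integrable M v"
      by (rule Bochner_Integration.integrable_bound[OF add.prems]; use add in force)+
    then show ?case using add by (intro assms(3)) auto
  next
    case (seq U)
    have le: "U n x \<le> g x" if "x \<in> S" for n x
      using that seq by (intro incseq_le[of "\<lambda>n. U n x"]) (auto simp: incseq_def le_fun_def)
    have "integrable M (U n)" for n
      by (rule Bochner_Integration.integrable_bound[OF seq.prems])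
        (use seq le in \<open>auto intro!: AE_I2 simp: abs_of_nonneg order_trans[OF seq(2) le]\<close>)
    then show ?case
      using seq by (intro assms(5)[of U g]) (auto simp: incseq_def le_fun_def)
  qed
  have "P (\<lambda>x. max 0 (f x) + (- 1) * max 0 (- f x))"
    by (intro assms(3) assms(4) nonneg) (use f in auto)
  moreover have "(\<lambda>x. max 0 (f x) + (- 1) * max 0 (- f x)) = f" by (auto simp: max_def)
  ultimately show ?thesis by simp
qed

text \<open>For \<open>f \<ge> 0\<close> and \<open>c > 0\<close> the indicator of \<open>{f > c}\<close> is the increasing limit of \<open>min 1 (n * (f - min f c))\<close>, all of which
  are bounded by \<open>f / c\<close>. So level sets have finite measure, every truncation of \<open>f\<close> is integrable,
  and monotone convergence yields the integrability of \<open>f\<close>. Conversely, indicators of sets of finite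
  measure generate all integrable functions by linearity and monotone limits.\<close>

lemma lebesgue_integral_unique:
  assumes "is_lebesgue_integral S \<SS> \<mu> D I"
  shows "D = {f. integrable M f}" and "\<And>f. f \<in> D \<Longrightarrow> I f = integral\<^sup>L M f"
proof -
  note D = assms[unfolded is_lebesgue_integral_def function_space_def linear_functional_def]
  have plus: "(\<lambda>x. f x + g x) \<in> D" "I (\<lambda>x. f x + g x) = I f + I g" if "f \<in> D" "g \<in> D" for f g
    using D that by auto
  have scale: "(\<lambda>x. c * f x) \<in> D" "I (\<lambda>x. c * f x) = c * I f" if "f \<in> D" for f c
    using D that by auto
  have zero: "(\<lambda>x. 0) \<in> D" "I (\<lambda>x. 0) = 0"
    using D scale(2)[of "\<lambda>x. 0" 0] by auto
  have diff: "(\<lambda>x. f x - g x) \<in> D" "I (\<lambda>x. f x - g x) = I f - I g" if "f \<in> D" "g \<in> D" for f g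
    using plus[OF that(1) scale(1)[OF that(2), of "-1"]] scale(2)[OF that(2), of "-1"] by auto
  have meas: "ring_measurable S \<SS> f" if "f \<in> D" for f using D that by auto
  have nonneg: "0 \<le> I f" if "f \<in> D" "\<And>x. x \<in> S \<Longrightarrow> 0 \<le> f x" for f
    using D that by auto
  have mono: "I f \<le> I g" if "f \<in> D" "g \<in> D" "\<And>x. x \<in> S \<Longrightarrow> f x \<le> g x" for f g
    using nonneg[OF diff(1)[OF that(2,1)]] diff(2)[OF that(2,1)] that(3) by auto
  have ind: "indicator A \<in> D \<longleftrightarrow> \<mu> A < \<infinity>" "indicator A \<in> D \<Longrightarrow> ennreal (I (indicator A)) = \<mu> A"
    if "A \<in> \<SS>" for A
    using D that by auto
  have lim: "f \<in> D" "(\<lambda>n. I (F n)) \<longlonglongrightarrow> I f"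
    if "\<And>n. F n \<in> D" "\<And>x. x \<in> S \<Longrightarrow> incseq (\<lambda>n. F n x)" "\<And>x. x \<in> S \<Longrightarrow> (\<lambda>n. F n x) \<longlonglongrightarrow> f x"
      "bdd_above (range (\<lambda>n. I (F n)))" for F f
    using D[THEN conjunct2, THEN conjunct2, THEN conjunct2, THEN conjunct2, THEN conjunct2,
        THEN conjunct1, rule_format, of F f] that by simp_all
  have abs: "(\<lambda>x. \<bar>f x\<bar>) \<in> D" if "f \<in> D" for f using D that by auto
  have min1: "(\<lambda>x. min (f x) 1) \<in> D" if "f \<in> D" for f using D that by auto

  have integrable_D: "f \<in> D \<and> I f = integral\<^sup>L M f" if "integrable M f" for f
    using that
  proof (induction rule: integrable_induct_mono_limits)
    case (set A)
    then have A: "indicator A \<in> D" "ennreal (I (indicator A)) = \<mu> A" using ind[of A] by auto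
    moreover have "0 \<le> I (indicator A)" using nonneg[OF A(1)] by auto
    moreover have "integral\<^sup>L M (indicator A) = measure M A"
      using set sets_into_space[of A] by (simp add: Int_absorb2)
    ultimately show ?case using set(1) by (simp add: measure_def) (metis enn2real_ennreal)
  next
    case (add f g)
    then show ?case using plus[of f g] by simp
  next
    case (mult f c)
    then show ?case using scale[of f c] by simp
  next
    case (mono_lim F f)
    then have F: "F n \<in> D" "I (F n) = integral\<^sup>L M (F n)" for n by auto
    have bdd: "bdd_above (range (\<lambda>n. integral\<^sup>L M (F n)))"
      using mono_lim by (intro bdd_aboveI2[of _ _ "integral\<^sup>L M f"] integral_mono incseq_le[of "\<lambda>n. F n _"]) auto
    from lim[of F f] integrable_monotone_convergence_space(2)[of F f] F bdd mono_lim
    show ?case by (auto intro: LIMSEQ_unique)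
  qed

  have D_integrable: "integrable M f" if "f \<in> D" for f
  proof -
    define g where "g = (\<lambda>x. \<bar>f x\<bar>)"
    have g: "g \<in> D" "\<And>x. 0 \<le> g x" using abs[OF that] by (auto simp: g_def)
    have g_meas [measurable]: "g \<in> borel_measurable M" and g_supp: "{x \<in> S. g x \<noteq> 0} \<in> \<SS>"
      using meas[OF g(1)] by (auto simp: ring_measurable_iff)
    have level: "emeasure M {x \<in> S. c < g x} < \<infinity>" if "0 < c" for c
    proof -
      let ?A = "{x \<in> S. c < g x}"
      have "{x \<in> space M. c < g x} \<in> sets M" by measurable
      then have A: "?A \<in> \<SS>"
        by (intro sets_M_subset_ring[OF _ g_supp]) (use that in auto)
      \<comment> \<open>This is \<open>g - min g c\<close>; the rescaling is needed since only \<open>min _ 1\<close> is known to preserve \<open>D\<close>.\<close>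
      define G where "G = (\<lambda>x. g x - c * min (1 / c * g x) 1)"
      have G_D: "G \<in> D" unfolding G_def by (intro diff scale min1 g)
      have G: "G x = (if c < g x then g x - c else 0)" for x
        using that by (auto simp: G_def min_def field_simps)
      define F where "F n = (\<lambda>x. min (real n * G x) 1)" for n
      have F_D: "F n \<in> D" for n unfolding F_def by (intro min1 scale G_D)
      have "I (F n) \<le> I (\<lambda>x. 1 / c * g x)" for n
      proof (rule mono[OF F_D scale(1)[OF g(1)]])
        show "F n x \<le> 1 / c * g x" for x
        proof (cases "c < g x")
          case True
          then have "F n x \<le> 1" "1 \<le> 1 / c * g x" using that by (auto simp: F_def field_simps)
          then show ?thesis by linarith
        next
          case False
          then show ?thesis using that g(2)[of x] by (simp add: F_def G)
        qed
      qed
      then have bdd: "bdd_above (range (\<lambda>n. I (F n)))" by (intro bdd_aboveI2)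
      have "indicator ?A \<in> D"
      proof (rule lim(1)[OF F_D _ _ bdd])
        fix x assume "x \<in> S"
        show "incseq (\<lambda>n. F n x)"
          unfolding incseq_def F_def by (intro allI impI min.mono mult_right_mono order_refl) (auto simp: G)
        show "(\<lambda>n. F n x) \<longlonglongrightarrow> indicator ?A x"
        proof (cases "c < g x")
          case True
          then obtain n0 where n0: "1 < real n0 * (g x - c)" using reals_Archimedean3[of "g x - c"] by auto
          have "F n x = 1" if "n0 \<le> n" for n
          proof -
            have "real n0 * (g x - c) \<le> real n * (g x - c)" using True that by (intro mult_right_mono) auto
            with n0 have "1 \<le> real n * (g x - c)" by linarith
            with True show ?thesis by (simp add: F_def G min_absorb2)
          qed
          then have "eventually (\<lambda>n. F n x = 1) sequentially" by (auto simp: eventually_sequentially)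
          then show ?thesis using True \<open>x \<in> S\<close> by (simp add: tendsto_eventually)
        qed (simp add: F_def G)
      qed
      then show ?thesis using ind(1)[OF A] A by simp
    qed
    have trunc: "integrable M (\<lambda>x. truncation n (g x))" for n
    proof (rule integrable_truncation)
      have "{x \<in> space M. ennreal (1 / real (Suc n)) < ennreal (g x)} = {x \<in> S. 1 / Suc n < g x}"
        by (auto simp: ennreal_less_iff)
      then show "emeasure M {x \<in> space M. ennreal (1 / real (Suc n)) < ennreal (g x)} < \<infinity>"
        using level[of "1 / Suc n"] by simp
    qed simp
    have "(\<integral>\<^sup>+x. truncation n (g x) \<partial>M) \<le> ennreal (I g)" for n
    proof -
      have t: "(\<lambda>x. truncation n (g x)) \<in> D" "I (\<lambda>x. truncation n (g x)) = (\<integral>x. truncation n (g x) \<partial>M)"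
        using integrable_D[OF trunc[of n]] by auto
      have "I (\<lambda>x. truncation n (g x)) \<le> I g"
        by (rule mono[OF t(1) g(1)])
          (use truncation_le[of n "ennreal (g _)"] g(2) in \<open>simp add: ennreal_le_iff\<close>)
      moreover have "(\<integral>\<^sup>+x. truncation n (g x) \<partial>M) = ennreal (\<integral>x. truncation n (g x) \<partial>M)"
        by (intro nn_integral_eq_integral trunc) auto
      ultimately show ?thesis using t by (simp add: ennreal_leI)
    qed
    then have "(\<integral>\<^sup>+x. g x \<partial>M) \<le> ennreal (I g)"
      by (intro LIMSEQ_le_const2[OF nn_integral_truncation_tendsto]) auto
    then have "(\<integral>\<^sup>+x. g x \<partial>M) < \<infinity>" using le_less_trans ennreal_less_top by fastforce
    moreover have "f \<in> borel_measurable M" using meas[OF that] by (simp add: ring_measurable_iff)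
    ultimately show ?thesis by (auto simp: integrable_iff_bounded g_def)
  qed

  show "D = {f. integrable M f}" using D_integrable integrable_D by auto
  show "I f = integral\<^sup>L M f" if "f \<in> D" for f using D_integrable[OF that] integrable_D by auto
qed

lemma lebesgue_space_eq: "lebesgue_space S \<SS> \<mu> = {f. integrable M f}"
  unfolding lebesgue_space_def
  using is_lebesgue_integral_integral lebesgue_integral_unique(1) by (intro the_equality) blast+

lemma lebesgue_functional_eq:
  assumes "integrable M f"
  shows "lebesgue_functional S \<SS> \<mu> f = integral\<^sup>L M f"
  unfolding lebesgue_functional_def lebesgue_space_eq
  using is_lebesgue_integral_integral lebesgue_integral_unique(2)[of "{f. integrable M f}"] assms
  by (intro the_equality) blast+

section \<open>The extended Lebesgue integral\<close>

lemma nn_integral_LIMSEQ_space: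
  assumes "\<And>n. F n \<in> borel_measurable M" "\<And>x. x \<in> S \<Longrightarrow> incseq (\<lambda>n. F n x)"
    and "\<And>x. x \<in> S \<Longrightarrow> (\<lambda>n. F n x) \<longlonglongrightarrow> f x"
  shows "(\<lambda>n. \<integral>\<^sup>+x. F n x \<partial>M) \<longlonglongrightarrow> (\<integral>\<^sup>+x. f x \<partial>M)"
proof -
  have "incseq (\<lambda>n. \<integral>\<^sup>+x. F n x \<partial>M)"
    using assms(2) by (auto simp: incseq_def intro!: nn_integral_mono)
  then have "(\<lambda>n. \<integral>\<^sup>+x. F n x \<partial>M) \<longlonglongrightarrow> (SUP n. \<integral>\<^sup>+x. F n x \<partial>M)" by (rule LIMSEQ_SUP)
  also have "(SUP n. \<integral>\<^sup>+x. F n x \<partial>M) = (\<integral>\<^sup>+x. (SUP n. F n x) \<partial>M)"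
    using assms(1,2) by (intro nn_integral_monotone_convergence_SUP_AE[symmetric] AE_I2) (auto simp: incseq_def)
  also have "\<dots> = (\<integral>\<^sup>+x. f x \<partial>M)"
    using assms(2,3) LIMSEQ_SUP LIMSEQ_unique by (intro nn_integral_cong) fastforce
  finally show ?thesis .
qed

lemma nonneg_measurable_iff:
  "f \<in> nonneg_measurable S \<SS> \<longleftrightarrow> f \<in> borel_measurable M \<and> {x \<in> S. f x \<noteq> 0} \<in> \<SS>"
  by (simp add: nonneg_measurable_def ring_measurable_iff)

lemma nonneg_measurable_truncation:
  assumes "f \<in> nonneg_measurable S \<SS>"
  shows "(\<lambda>x. ennreal (truncation n (f x))) \<in> nonneg_measurable S \<SS>"
  unfolding nonneg_measurable_def mem_Collect_eq
  by (rule ring_measurable_if_support_subset[of _ "{x \<in> S. f x \<noteq> 0}"])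
    (use assms in \<open>auto simp: nonneg_measurable_iff\<close>)

lemma is_extended_integral_nn_integral: "is_extended_integral S \<SS> \<mu> (nn_integral M)"
  unfolding is_extended_integral_def
proof (intro conjI ballI allI impI; (elim conjE)?)
  fix f g :: "'a \<Rightarrow> ennreal" assume "\<forall>x\<in>S. f x \<le> g x"
  then show "(\<integral>\<^sup>+x. f x \<partial>M) \<le> (\<integral>\<^sup>+x. g x \<partial>M)" by (intro nn_integral_mono) auto
next
  fix f and c :: real assume "f \<in> nonneg_measurable S \<SS>"
  then show "(\<integral>\<^sup>+x. ennreal c * f x \<partial>M) = ennreal c * (\<integral>\<^sup>+x. f x \<partial>M)"
    by (simp add: nonneg_measurable_iff nn_integral_cmult)
next
  fix f assume "f \<in> lebesgue_space S \<SS> \<mu>" "\<forall>x\<in>S. 0 \<le> f x"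
  then show "(\<integral>\<^sup>+x. ennreal (f x) \<partial>M) = ennreal (lebesgue_functional S \<SS> \<mu> f)"
    by (auto simp: lebesgue_space_eq lebesgue_functional_eq intro!: nn_integral_eq_integral AE_I2)
next
  fix F and f :: "'a \<Rightarrow> ennreal"
  assume "\<forall>n. F n \<in> nonneg_measurable S \<SS>" "\<forall>x\<in>S. incseq (\<lambda>n. F n x) \<and> (\<lambda>n. F n x) \<longlonglongrightarrow> f x"
  then show "(\<lambda>n. \<integral>\<^sup>+x. F n x \<partial>M) \<longlonglongrightarrow> (\<integral>\<^sup>+x. f x \<partial>M)"
    by (intro nn_integral_LIMSEQ_space) (auto simp: nonneg_measurable_iff)
qed simp

text \<open>If some level set of \<open>f\<close> has infinite measure, then homogeneity and monotonicity force the value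
  \<open>\<infinity>\<close>; otherwise the truncations of \<open>f\<close> lie in the Lebesgue space, where the value is prescribed.\<close>

lemma extended_integral_unique:
  assumes J: "is_extended_integral S \<SS> \<mu> J" and f: "f \<in> nonneg_measurable S \<SS>"
  shows "J f = (\<integral>\<^sup>+x. f x \<partial>M)"
proof -
  have f_meas [measurable]: "f \<in> borel_measurable M" and supp: "{x \<in> S. f x \<noteq> 0} \<in> \<SS>"
    using f by (auto simp: nonneg_measurable_iff)
  define A where "A n = {x \<in> S. ennreal (1 / Suc n) < f x}" for n
  have A: "A n \<in> \<SS>" for n
  proof -
    have "{x \<in> space M. ennreal (1 / Suc n) < f x} \<in> sets M" by measurable
    then show ?thesis
      unfolding A_def by (intro sets_M_subset_ring[OF _ supp]) auto
  qed
  show ?thesis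
  proof (cases "\<exists>n. \<mu> (A n) = \<infinity>")
    case True
    then obtain n where n: "\<mu> (A n) = \<infinity>" ..
    have "K f = \<infinity>" if K: "is_extended_integral S \<SS> \<mu> K" for K
    proof -
      let ?g = "\<lambda>x. ennreal (1 / Suc n) * indicator (A n) x"
      have ind: "indicator (A n) \<in> nonneg_measurable S \<SS>"
        unfolding nonneg_measurable_def mem_Collect_eq
        by (rule ring_measurable_if_support_subset[OF _ A[of n]])
          (use A[of n] in \<open>auto intro!: borel_measurable_indicator\<close>)
      have g: "?g \<in> nonneg_measurable S \<SS>"
        unfolding nonneg_measurable_def mem_Collect_eq
        by (rule ring_measurable_if_support_subset[OF _ A[of n]])
          (use A[of n] in \<open>auto intro!: borel_measurable_times_ennreal borel_measurable_indicator\<close>)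
      have "K ?g = ennreal (1 / Suc n) * K (indicator (A n))"
        using K ind unfolding is_extended_integral_def by auto
      also have "K (indicator (A n)) = \<infinity>"
        using K A n unfolding is_extended_integral_def by auto
      finally have "K ?g = \<infinity>" by (simp add: ennreal_mult_top)
      moreover have "?g x \<le> f x" if "x \<in> S" for x
        using that by (auto simp: A_def split: split_indicator)
      then have "K ?g \<le> K f"
        using K f g unfolding is_extended_integral_def by auto
      ultimately show ?thesis by (simp add: top_unique)
    qed
    then show ?thesis using J is_extended_integral_nn_integral by metis
  next
    case False
    then have "emeasure M (A n) < \<infinity>" for n using A by (simp add: less_top)
    then have int: "integrable M (\<lambda>x. truncation n (f x))" for n
      by (intro integrable_truncation) (auto simp: A_def)
    have lim: "(\<lambda>n. ennreal (lebesgue_functional S \<SS> \<mu> (\<lambda>x. truncation n (f x)))) \<longlonglongrightarrow> K f"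
      if K: "is_extended_integral S \<SS> \<mu> K" for K
    proof -
      have "(\<lambda>n. K (\<lambda>x. ennreal (truncation n (f x)))) \<longlonglongrightarrow> K f"
        using K[unfolded is_extended_integral_def, THEN conjunct2, THEN conjunct2, THEN conjunct2,
            THEN conjunct2, rule_format, of "\<lambda>n x. ennreal (truncation n (f x))" f] f
        by (simp add: incseq_def truncation_mono tendsto_truncation nonneg_measurable_truncation
            ennreal_leI)
      moreover have "K (\<lambda>x. ennreal (truncation n (f x))) =
          ennreal (lebesgue_functional S \<SS> \<mu> (\<lambda>x. truncation n (f x)))" for n
        using K int unfolding is_extended_integral_def lebesgue_space_eq by auto
      ultimately show ?thesis by simp
    qed
    show ?thesis using lim[OF J] lim[OF is_extended_integral_nn_integral] by (rule LIMSEQ_unique)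
  qed
qed

lemma extended_integral_eq:
  assumes "f \<in> nonneg_measurable S \<SS>"
  shows "extended_integral S \<SS> \<mu> f = (\<integral>\<^sup>+x. f x \<partial>M)"
  unfolding extended_integral_def
  using is_extended_integral_nn_integral extended_integral_unique[OF _ assms]
  by (intro the_equality) blast+

end

section \<open>The \<open>\<sigma>\<close>-finite component\<close>

context ring_measure_space
begin

lemma finite_sets_subset_sigma_finite_sets: "finite_sets \<SS> \<mu> \<subseteq> sigma_finite_sets \<SS> \<mu>"
proof
  fix A assume "A \<in> finite_sets \<SS> \<mu>"
  then show "A \<in> sigma_finite_sets \<SS> \<mu>"
    unfolding sigma_finite_sets_def by (auto intro!: exI[of _ "\<lambda>_. A"])
qed

lemma sigma_finite_setsE:
  assumes "A \<in> sigma_finite_sets \<SS> \<mu>"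
  obtains F where "\<And>i :: nat. F i \<in> finite_sets \<SS> \<mu>" "A = (\<Union>i. F i)"
proof -
  from assms obtain F :: "nat \<Rightarrow> 'a set" where "A = (\<Union>i. F i)" "range F \<subseteq> finite_sets \<SS> \<mu>"
    unfolding sigma_finite_sets_def mem_Collect_eq by (elim exE conjE)
  then show thesis by (intro that[of F]) auto
qed

lemma sigma_finite_setsI:
  "(\<And>i :: nat. F i \<in> finite_sets \<SS> \<mu>) \<Longrightarrow> (\<Union>i. F i) \<in> sigma_finite_sets \<SS> \<mu>"
  unfolding sigma_finite_sets_def by (intro CollectI exI[of _ F]) auto

lemma sigma_finite_sets_UN:
  assumes "\<And>i :: nat. A i \<in> sigma_finite_sets \<SS> \<mu>"
  shows "(\<Union>i. A i) \<in> sigma_finite_sets \<SS> \<mu>"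
proof -
  have "\<exists>F. (\<forall>j :: nat. F j \<in> finite_sets \<SS> \<mu>) \<and> A i = (\<Union>j. F j)" for i
    using sigma_finite_setsE[OF assms[of i]] by metis
  then have "\<forall>i. \<exists>F. (\<forall>j :: nat. F j \<in> finite_sets \<SS> \<mu>) \<and> A i = (\<Union>j. F j)" by (rule allI)
  from choice[OF this] obtain F
    where "\<forall>i. (\<forall>j :: nat. F i j \<in> finite_sets \<SS> \<mu>) \<and> A i = (\<Union>j. F i j)" by (elim exE)
  then have F: "\<And>i j. F i j \<in> finite_sets \<SS> \<mu>" "\<And>i. A i = (\<Union>j. F i j)" by simp_all
  have "(\<Union>i. A i) = (\<Union>n. case prod_decode n of (i, j) \<Rightarrow> F i j)"
    by (auto simp: F(2) intro!: exI[of _ "prod_encode (_, _)"])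
  also have "\<dots> \<in> sigma_finite_sets \<SS> \<mu>"
    by (rule sigma_finite_setsI) (simp add: F(1) split: prod.split)
  finally show ?thesis .
qed

lemma finite_sets_Int:
  assumes "A \<in> finite_sets \<SS> \<mu>" "B \<in> sets M"
  shows "B \<inter> A \<in> finite_sets \<SS> \<mu>"
proof -
  have A: "A \<in> \<SS>" "\<mu> A < \<infinity>" using assms by (auto simp: finite_sets_def)
  then have BA: "B \<inter> A \<in> \<SS>" using assms(2) by (intro sets_M_Int_ring)
  then have "\<mu> (B \<inter> A) \<le> \<mu> A" using A by (intro measure_mono) auto
  then show ?thesis using A BA by (auto simp: finite_sets_def)
qed

lemma sigma_finite_sets_Int:
  assumes "A \<in> sigma_finite_sets \<SS> \<mu>" "B \<in> sets M"
  shows "B \<inter> A \<in> sigma_finite_sets \<SS> \<mu>"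
proof -
  obtain F where F: "\<And>i :: nat. F i \<in> finite_sets \<SS> \<mu>" "A = (\<Union>i. F i)"
    using sigma_finite_setsE[OF assms(1)] by metis
  have "B \<inter> A = (\<Union>i. B \<inter> F i)" using F by auto
  also have "\<dots> \<in> sigma_finite_sets \<SS> \<mu>" using F assms(2) by (intro sigma_finite_setsI finite_sets_Int)
  finally show ?thesis .
qed

lemma sigma_ring_sigma_finite_sets: "sigma_ring S (sigma_finite_sets \<SS> \<mu>)"
proof
  show "sigma_finite_sets \<SS> \<mu> \<subseteq> Pow S"
    using sigma_finite_sets_subset space_closed by auto
  have "{} \<in> finite_sets \<SS> \<mu>"
    using measure empty by (simp add: ring_measure_def positive_def finite_sets_def)
  then show "{} \<in> sigma_finite_sets \<SS> \<mu>" using finite_sets_subset_sigma_finite_sets by auto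
  show "(\<Union>i. A i) \<in> sigma_finite_sets \<SS> \<mu>" if "range A \<subseteq> sigma_finite_sets \<SS> \<mu>" for A :: "nat \<Rightarrow> 'a set"
    using that by (intro sigma_finite_sets_UN) auto
  show "A - B \<in> sigma_finite_sets \<SS> \<mu>"
    if "A \<in> sigma_finite_sets \<SS> \<mu>" "B \<in> sigma_finite_sets \<SS> \<mu>" for A B
  proof -
    have "A \<in> \<SS>" "B \<in> \<SS>" using that sigma_finite_sets_subset by auto
    then have "A - B \<in> sets M" by (intro ring_subset_sets_M Diff)
    from sigma_finite_sets_Int[OF that(1) this] show ?thesis by (simp add: Int_absorb2)
  qed
qed

text \<open>The complement of \<open>A\<close>, possibly far from \<open>\<sigma>\<close>-finite, becomes a null set.\<close>

lemma sigma_finite_measure_density_indicator: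
  assumes "A \<in> sigma_finite_sets \<SS> \<mu>"
  shows "sigma_finite_measure (density M (indicator A))"
proof
  obtain F where F: "\<And>i :: nat. F i \<in> finite_sets \<SS> \<mu>" "A = (\<Union>i. F i)"
    using sigma_finite_setsE[OF assms] by metis
  have A: "A \<in> \<SS>" using assms sigma_finite_sets_subset by auto
  have "S - A \<in> sets M" using A by (auto simp: sets_M)
  then have "emeasure (density M (indicator A)) (S - A) = 0"
    using A by (subst emeasure_restricted) auto
  moreover have "emeasure (density M (indicator A)) (F i) \<noteq> \<infinity>" for i
  proof -
    have "F i \<in> \<SS>" "\<mu> (F i) < \<infinity>" "A \<inter> F i = F i" using F by (auto simp: finite_sets_def)
    then show ?thesis using A by (subst emeasure_restricted) auto
  qed
  moreover have "insert (S - A) (range F) \<subseteq> sets M"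
    using \<open>S - A \<in> sets M\<close> F by (auto simp: finite_sets_def)
  moreover have "\<Union> (insert (S - A) (range F)) = S"
    using A F(2) sets_into_space[of A] by auto
  ultimately show "\<exists>C. countable C \<and> C \<subseteq> sets (density M (indicator A)) \<and>
      \<Union> C = space (density M (indicator A)) \<and> (\<forall>a\<in>C. emeasure (density M (indicator A)) a \<noteq> \<infinity>)"
    by (intro exI[of _ "insert (S - A) (range F)"]) auto
qed

end

section \<open>Existence and uniqueness of the product measure\<close>

locale ring_measure_pair = left: ring_measure_space S \<SS> \<mu> + right: ring_measure_space T \<TT> \<nu>
  for S :: "'a set" and \<SS> \<mu> and T :: "'b set" and \<TT> \<nu>
begin

sublocale sigma_ring_pair S \<SS> T \<TT> ..

abbreviation "M \<equiv> ring_extension S \<SS> \<mu>"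
abbreviation "N \<equiv> ring_extension T \<TT> \<nu>"
abbreviation "\<SS>\<^sub>\<sigma> \<equiv> sigma_finite_sets \<SS> \<mu>"
abbreviation "\<TT>\<^sub>\<sigma> \<equiv> sigma_finite_sets \<TT> \<nu>"
abbreviation "\<RR> \<equiv> \<SS> \<otimes>\<^sub>R \<TT>"
abbreviation "\<RR>\<^sub>\<sigma> \<equiv> \<SS>\<^sub>\<sigma> \<otimes>\<^sub>R \<TT>\<^sub>\<sigma>"
abbreviation "\<mu>\<nu> \<equiv> product_measure \<SS> \<mu> \<TT> \<nu>"

sublocale sigma_finite: sigma_ring_pair S "\<SS>\<^sub>\<sigma>" T "\<TT>\<^sub>\<sigma>"
  by (intro sigma_ring_pair.intro left.sigma_ring_sigma_finite_sets right.sigma_ring_sigma_finite_sets)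

text \<open>All members of \<open>\<RR>\<^sub>\<sigma>\<close> that occur in one argument lie in a common rectangle
  \<open>A \<times> B\<close> with \<open>\<sigma>\<close>-finite sides, and there the product of the restricted \<open>\<sigma>\<close>-finite measures is
  available. Cutting off by a density keeps the underlying \<open>\<sigma>\<close>-algebra independent of the rectangle.\<close>

abbreviation local_product :: "'a set \<Rightarrow> 'b set \<Rightarrow> ('a \<times> 'b) measure" where
  "local_product A B \<equiv> density M (indicator A) \<Otimes>\<^sub>M density N (indicator B)"

text \<open>Halmos's formula for the product measure. It does not mention any rectangle and agrees with each
  local product on the subsets of its rectangle.\<close>

definition section_measure :: "('a \<times> 'b) set \<Rightarrow> ennreal" where
  "section_measure E = (\<integral>\<^sup>+s. emeasure N (Pair s -` E) \<partial>M)"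

lemma sigma_finite_ring_prod_subset: "\<RR>\<^sub>\<sigma> \<subseteq> \<RR>"
  by (intro ring_prod_mono left.sigma_finite_sets_subset right.sigma_finite_sets_subset)

lemma sets_local_product: "sets (local_product A B) = sets (M \<Otimes>\<^sub>M N)"
  by (intro sets_pair_measure_cong) auto

lemma ring_prod_subset_local_product: "E \<in> \<RR> \<Longrightarrow> E \<in> sets (M \<Otimes>\<^sub>M N)"
  by (rule ring_prod_subset_pair_measure[of \<SS> _ \<TT>]) auto

lemma pair_sigma_finite_density:
  assumes "A \<in> \<SS>\<^sub>\<sigma>" "B \<in> \<TT>\<^sub>\<sigma>"
  shows "pair_sigma_finite (density M (indicator A)) (density N (indicator B))"
  by (intro pair_sigma_finite.intro left.sigma_finite_measure_density_indicator
      right.sigma_finite_measure_density_indicator assms)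

lemma emeasure_local_product:
  assumes A: "A \<in> \<SS>\<^sub>\<sigma>" and B: "B \<in> \<TT>\<^sub>\<sigma>" and E: "E \<in> sets (M \<Otimes>\<^sub>M N)"
  shows "emeasure (local_product A B) E = section_measure (E \<inter> A \<times> B)"
proof -
  interpret pair_sigma_finite "density M (indicator A)" "density N (indicator B)"
    by (rule pair_sigma_finite_density) fact+
  have A': "A \<in> sets M" and B': "B \<in> sets N"
    using A B left.sigma_finite_sets_subset right.sigma_finite_sets_subset by auto
  have E': "E \<in> sets (local_product A B)" using E by (simp only: sets_local_product)
  have "emeasure (local_product A B) E =
      (\<integral>\<^sup>+s. emeasure (density N (indicator B)) (Pair s -` E) \<partial>density M (indicator A))"
    by (rule M2.emeasure_pair_measure_alt[OF E'])
  also have "\<dots> = (\<integral>\<^sup>+s. indicator A s * emeasure (density N (indicator B)) (Pair s -` E) \<partial>M)"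
    using measurable_emeasure_Pair1[OF E'] A' by (intro nn_integral_density) (auto intro!: borel_measurable_indicator)
  also have "\<dots> = section_measure (E \<inter> A \<times> B)"
    unfolding section_measure_def
  proof (rule nn_integral_cong)
    fix s
    have "emeasure (density N (indicator B)) (Pair s -` E) = emeasure N (B \<inter> Pair s -` E)"
      using B' sets_Pair1[OF E, of s] by (rule emeasure_restricted)
    moreover have "Pair s -` (E \<inter> A \<times> B) = (if s \<in> A then B \<inter> Pair s -` E else {})" by auto
    ultimately show "indicator A s * emeasure (density N (indicator B)) (Pair s -` E) =
        emeasure N (Pair s -` (E \<inter> A \<times> B))" by simp
  qed
  finally show ?thesis .
qed

lemma section_measure_times:
  assumes "A \<in> \<SS>" "B \<in> \<TT>"
  shows "section_measure (A \<times> B) = \<mu> A * \<nu> B"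
proof -
  have "section_measure (A \<times> B) = (\<integral>\<^sup>+s. \<nu> B * indicator A s \<partial>M)"
    unfolding section_measure_def
    by (intro nn_integral_cong) (use assms in \<open>auto split: split_indicator simp: vimage_def\<close>)
  also have "\<dots> = \<mu> A * \<nu> B" using assms by (simp add: nn_integral_cmult_indicator mult.commute)
  finally show ?thesis .
qed

lemma section_measure_mono:
  assumes "E \<subseteq> F" "F \<in> \<RR>"
  shows "section_measure E \<le> section_measure F"
  unfolding section_measure_def
  by (intro nn_integral_mono emeasure_mono) (use assms ring_prod_section(1) in auto)

text \<open>A sequence together with its union lies in one rectangle, where \<open>section_measure\<close> is the local
  product measure.\<close>

lemma ring_measure_section_measure: "ring_measure \<RR>\<^sub>\<sigma> section_measure"
  unfolding ring_measure_def
proof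
  show "positive \<RR>\<^sub>\<sigma> section_measure"
    by (simp add: positive_def section_measure_def)
  show "countably_additive \<RR>\<^sub>\<sigma> section_measure"
  proof (rule countably_additiveI)
    fix E :: "nat \<Rightarrow> ('a \<times> 'b) set"
    assume E: "range E \<subseteq> \<RR>\<^sub>\<sigma>" "disjoint_family E" "(\<Union>i. E i) \<in> \<RR>\<^sub>\<sigma>"
    obtain A B where AB: "A \<in> \<SS>\<^sub>\<sigma>" "B \<in> \<TT>\<^sub>\<sigma>" "(\<Union>i. E i) \<subseteq> A \<times> B"
      using E(3) by (rule sigma_finite.ring_prod_subset_times)
    have eq: "section_measure F = emeasure (local_product A B) F"
      if "F \<in> \<RR>\<^sub>\<sigma>" "F \<subseteq> A \<times> B" for F
    proof -
      have "F \<in> sets (M \<Otimes>\<^sub>M N)"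
        using that sigma_finite_ring_prod_subset ring_prod_subset_local_product by auto
      then show ?thesis using emeasure_local_product[OF AB(1,2)] that by (simp add: Int_absorb2)
    qed
    have "range E \<subseteq> sets (local_product A B)"
      using E sigma_finite_ring_prod_subset ring_prod_subset_local_product
      by (subst sets_local_product) auto
    moreover have "E i \<subseteq> A \<times> B" for i using AB(3) by blast
    ultimately show "(\<Sum>i. section_measure (E i)) = section_measure (\<Union>i. E i)"
      using suminf_emeasure[of E "local_product A B"] eq E AB(3) by (simp add: range_subsetD)
  qed
qed

lemma sigma_finite_times:
  assumes "A \<in> \<SS>\<^sub>\<sigma>" "B \<in> \<TT>\<^sub>\<sigma>"
  obtains X Y where "\<And>n :: nat. X n \<in> finite_sets \<SS> \<mu>" "\<And>n. Y n \<in> finite_sets \<TT> \<nu>"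
    "A \<times> B = (\<Union>n. X n \<times> Y n)"
proof -
  obtain F where F: "\<And>i :: nat. F i \<in> finite_sets \<SS> \<mu>" "A = (\<Union>i. F i)"
    using left.sigma_finite_setsE[OF assms(1)] by metis
  obtain G where G: "\<And>i :: nat. G i \<in> finite_sets \<TT> \<nu>" "B = (\<Union>i. G i)"
    using right.sigma_finite_setsE[OF assms(2)] by metis
  show thesis
  proof (rule that)
    show "A \<times> B = (\<Union>n. F (fst (prod_decode n)) \<times> G (snd (prod_decode n)))"
      by (auto simp: F(2) G(2) intro!: exI[of _ "prod_encode (_, _)"])
  qed (use F G in auto)
qed

text \<open>The rectangles with sides of finite measure inside a fixed rectangle \<open>A \<times> B\<close> with
  \<open>\<sigma>\<close>-finite sides form an intersection-stable generator that covers \<open>A \<times> B\<close> by countably many of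
  its members.\<close>

definition finite_rectangles :: "'a set \<Rightarrow> 'b set \<Rightarrow> ('a \<times> 'b) set set" where
  "finite_rectangles A B =
    {C \<times> D |C D. C \<in> finite_sets \<SS> \<mu> \<and> D \<in> finite_sets \<TT> \<nu> \<and> C \<times> D \<subseteq> A \<times> B}"

lemma finite_rectangles_subset_Pow: "finite_rectangles A B \<subseteq> Pow (A \<times> B)"
  by (auto simp: finite_rectangles_def)

lemma Int_stable_finite_rectangles: "Int_stable (finite_rectangles A B)"
proof (rule Int_stableI)
  fix a b assume "a \<in> finite_rectangles A B" "b \<in> finite_rectangles A B"
  then obtain C D C' D' where CD: "C \<in> finite_sets \<SS> \<mu>" "D \<in> finite_sets \<TT> \<nu>" "a = C \<times> D"
      "C' \<in> finite_sets \<SS> \<mu>" "D' \<in> finite_sets \<TT> \<nu>" "b = C' \<times> D'" "a \<subseteq> A \<times> B"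
    unfolding finite_rectangles_def by blast
  then have "C' \<in> sets M" "D' \<in> sets N" by (auto simp: finite_sets_def)
  with CD have "C' \<inter> C \<in> finite_sets \<SS> \<mu>" "D' \<inter> D \<in> finite_sets \<TT> \<nu>"
    by (auto intro!: left.finite_sets_Int right.finite_sets_Int)
  moreover have "a \<inter> b = (C' \<inter> C) \<times> (D' \<inter> D)" using CD by auto
  ultimately show "a \<inter> b \<in> finite_rectangles A B" unfolding finite_rectangles_def using CD(7) by blast
qed

lemma sigma_sets_finite_rectangles_subset_ring_prod:
  assumes "A \<in> \<SS>\<^sub>\<sigma>" "B \<in> \<TT>\<^sub>\<sigma>"
  shows "sigma_sets (A \<times> B) (finite_rectangles A B) \<subseteq> \<RR>\<^sub>\<sigma>"
proof
  fix F assume "F \<in> sigma_sets (A \<times> B) (finite_rectangles A B)"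
  then show "F \<in> \<RR>\<^sub>\<sigma>"
  proof induction
    case (Basic a)
    then show ?case
      using left.finite_sets_subset_sigma_finite_sets right.finite_sets_subset_sigma_finite_sets
      by (auto simp: finite_rectangles_def intro!: times_in_ring_prod)
  next
    case (Compl a)
    then show ?case by (intro ring_prod.Diff times_in_ring_prod assms)
  qed (auto intro: ring_prod.empty ring_prod_countable_UN)
qed

lemma ring_prod_Int_in_sigma_sets_finite_rectangles:
  assumes "A \<in> \<SS>\<^sub>\<sigma>" "B \<in> \<TT>\<^sub>\<sigma>" "F \<in> \<RR>\<^sub>\<sigma>"
  shows "F \<inter> A \<times> B \<in> sigma_sets (A \<times> B) (finite_rectangles A B)"
proof -
  obtain X Y where XY: "\<And>n :: nat. X n \<in> finite_sets \<SS> \<mu>" "\<And>n. Y n \<in> finite_sets \<TT> \<nu>"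
    "A \<times> B = (\<Union>n. X n \<times> Y n)"
    using sigma_finite_times[OF assms(1,2)] by metis
  interpret G: sigma_algebra "A \<times> B" "sigma_sets (A \<times> B) (finite_rectangles A B)"
    by (rule sigma_algebra_sigma_sets[OF finite_rectangles_subset_Pow])
  show ?thesis using assms(3)
  proof (induction rule: ring_prod_induct)
    case (times C D)
    then have CD: "C \<in> sets M" "D \<in> sets N"
      using left.sigma_finite_sets_subset right.sigma_finite_sets_subset by auto
    have "C \<times> D \<inter> A \<times> B = (\<Union>n. (C \<inter> X n) \<times> (D \<inter> Y n))" unfolding XY(3) by auto
    moreover have "(C \<inter> X n) \<times> (D \<inter> Y n) \<in> finite_rectangles A B" for n
    proof -
      have "C \<inter> X n \<in> finite_sets \<SS> \<mu>" "D \<inter> Y n \<in> finite_sets \<TT> \<nu>"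
        using XY CD by (auto intro!: left.finite_sets_Int right.finite_sets_Int)
      moreover have "(C \<inter> X n) \<times> (D \<inter> Y n) \<subseteq> A \<times> B" unfolding XY(3) by auto
      ultimately show ?thesis unfolding finite_rectangles_def by blast
    qed
    ultimately show ?case by (auto intro!: sigma_sets.Union)
  next
    case (Diff C D)
    have "(C - D) \<inter> A \<times> B = (C \<inter> A \<times> B) - (D \<inter> A \<times> B)" by auto
    then show ?case using Diff by (simp only: G.Diff)
  next
    case (union C)
    have "(\<Union>i. C i) \<inter> A \<times> B = (\<Union>i. C i \<inter> A \<times> B)" by auto
    then show ?case using union by (simp only: sigma_sets.Union)
  qed (simp add: sigma_sets.Empty)
qed

lemma rectangle_measure_unique:
  assumes \<pi>: "ring_measure \<RR>\<^sub>\<sigma> \<pi>"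
    and rect: "\<And>A B. A \<in> \<SS>\<^sub>\<sigma> \<Longrightarrow> B \<in> \<TT>\<^sub>\<sigma> \<Longrightarrow> \<pi> (A \<times> B) = \<mu> A * \<nu> B"
    and E: "E \<in> \<RR>\<^sub>\<sigma>"
  shows "\<pi> E = section_measure E"
proof -
  obtain A B where AB: "A \<in> \<SS>\<^sub>\<sigma>" "B \<in> \<TT>\<^sub>\<sigma>" "E \<subseteq> A \<times> B"
    using E by (rule sigma_finite.ring_prod_subset_times)
  obtain X Y where XY: "\<And>n :: nat. X n \<in> finite_sets \<SS> \<mu>" "\<And>n. Y n \<in> finite_sets \<TT> \<nu>"
    "A \<times> B = (\<Union>n. X n \<times> Y n)"
    using sigma_finite_times[OF AB(1,2)] by metis
  define G where "G = finite_rectangles A B"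
  have G_sub: "G \<subseteq> Pow (A \<times> B)" unfolding G_def by (rule finite_rectangles_subset_Pow)
  have XY_G: "X n \<times> Y n \<in> G" for n using XY by (auto simp: G_def finite_rectangles_def)
  have G_ring: "sigma_sets (A \<times> B) G \<subseteq> \<RR>\<^sub>\<sigma>"
    unfolding G_def using AB(1,2) by (rule sigma_sets_finite_rectangles_subset_ring_prod)
  have E_G: "E \<in> sigma_sets (A \<times> B) G"
    using ring_prod_Int_in_sigma_sets_finite_rectangles[OF AB(1,2) E] AB(3)
    by (simp add: G_def Int_absorb2)
  have sets: "sets (measure_of (A \<times> B) G \<rho>) = sigma_sets (A \<times> B) G" for \<rho>
    using G_sub by (rule sets_measure_of)
  have emb: "emeasure (measure_of (A \<times> B) G \<rho>) F = \<rho> F"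
    if \<rho>: "ring_measure \<RR>\<^sub>\<sigma> \<rho>" and F: "F \<in> sigma_sets (A \<times> B) G" for \<rho> F
  proof (rule emeasure_measure_of[OF refl G_sub])
    show "positive (sets (measure_of (A \<times> B) G \<rho>)) \<rho>"
      using \<rho> by (simp add: ring_measure_def positive_def)
    show "countably_additive (sets (measure_of (A \<times> B) G \<rho>)) \<rho>"
      unfolding sets
    proof (rule countably_additiveI)
      fix F :: "nat \<Rightarrow> ('a \<times> 'b) set"
      assume F: "range F \<subseteq> sigma_sets (A \<times> B) G" "disjoint_family F" "(\<Union>i. F i) \<in> sigma_sets (A \<times> B) G"
      then have "range F \<subseteq> \<RR>\<^sub>\<sigma>" "(\<Union>i. F i) \<in> \<RR>\<^sub>\<sigma>" using G_ring by auto
      then show "(\<Sum>i. \<rho> (F i)) = \<rho> (\<Union>i. F i)"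
        using \<rho> F(2) unfolding ring_measure_def countably_additive_def by simp
    qed
    show "F \<in> sets (measure_of (A \<times> B) G \<rho>)" unfolding sets by (rule F)
  qed
  have rect_val: "\<pi> F = \<mu> C * \<nu> D \<and> section_measure F = \<mu> C * \<nu> D"
    if "C \<in> finite_sets \<SS> \<mu>" "D \<in> finite_sets \<TT> \<nu>" "F = C \<times> D" for F C D
  proof -
    have "C \<in> \<SS>" "D \<in> \<TT>" "C \<in> \<SS>\<^sub>\<sigma>" "D \<in> \<TT>\<^sub>\<sigma>"
      using that left.finite_sets_subset_sigma_finite_sets right.finite_sets_subset_sigma_finite_sets
      by (auto simp: finite_sets_def)
    then show ?thesis using rect section_measure_times that by auto
  qed
  have "measure_of (A \<times> B) G \<pi> = measure_of (A \<times> B) G section_measure"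
  proof (rule measure_eqI_generator_eq[where E=G and \<Omega>="A \<times> B" and A="\<lambda>n. X n \<times> Y n"])
    show "Int_stable G" unfolding G_def by (rule Int_stable_finite_rectangles)
    show "emeasure (measure_of (A \<times> B) G \<pi>) F = emeasure (measure_of (A \<times> B) G section_measure) F"
      if "F \<in> G" for F
      using that rect_val emb[OF \<pi>, of F] emb[OF ring_measure_section_measure, of F]
      by (auto simp: G_def finite_rectangles_def)
    show "emeasure (measure_of (A \<times> B) G \<pi>) (X n \<times> Y n) \<noteq> \<infinity>" for n
      using rect_val[OF XY(1,2) refl] XY(1,2)[of n] XY_G emb[OF \<pi>, of "X n \<times> Y n"]
      by (auto simp: finite_sets_def ennreal_mult_eq_top_iff)
  qed (use G_sub sets XY XY_G in auto)
  then show ?thesis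
    using emb[OF \<pi> E_G] emb[OF ring_measure_section_measure E_G] by simp
qed

lemma classical_product_eq:
  "classical_product \<SS>\<^sub>\<sigma> \<mu> \<TT>\<^sub>\<sigma> \<nu> = (\<lambda>E. if E \<in> \<RR>\<^sub>\<sigma> then section_measure E else 0)"
  unfolding classical_product_def
proof (rule the_equality; (elim conjE)?)
  fix \<pi>
  assume \<pi>: "ring_measure \<RR>\<^sub>\<sigma> \<pi>" "\<forall>A\<in>\<SS>\<^sub>\<sigma>. \<forall>B\<in>\<TT>\<^sub>\<sigma>. \<pi> (A \<times> B) = \<mu> A * \<nu> B"
    "\<forall>E. E \<notin> \<RR>\<^sub>\<sigma> \<longrightarrow> \<pi> E = 0"
  show "\<pi> = (\<lambda>E. if E \<in> \<RR>\<^sub>\<sigma> then section_measure E else 0)"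
    using rectangle_measure_unique[OF \<pi>(1)] \<pi>(2,3) by (intro ext) auto
next
  have "ring_measure \<RR>\<^sub>\<sigma> (\<lambda>E. if E \<in> \<RR>\<^sub>\<sigma> then section_measure E else 0)"
    using ring_measure_section_measure
    by (auto simp: ring_measure_def positive_def countably_additive_def range_subsetD)
  moreover have "section_measure (A \<times> B) = \<mu> A * \<nu> B" if "A \<in> \<SS>\<^sub>\<sigma>" "B \<in> \<TT>\<^sub>\<sigma>" for A B
    using that left.sigma_finite_sets_subset right.sigma_finite_sets_subset
    by (intro section_measure_times) auto
  ultimately show "ring_measure \<RR>\<^sub>\<sigma> (\<lambda>E. if E \<in> \<RR>\<^sub>\<sigma> then section_measure E else 0) \<and>
    (\<forall>A\<in>\<SS>\<^sub>\<sigma>. \<forall>B\<in>\<TT>\<^sub>\<sigma>. (if A \<times> B \<in> \<RR>\<^sub>\<sigma> then section_measure (A \<times> B) else 0) = \<mu> A * \<nu> B) \<and>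
    (\<forall>E. E \<notin> \<RR>\<^sub>\<sigma> \<longrightarrow> (if E \<in> \<RR>\<^sub>\<sigma> then section_measure E else 0) = 0)"
    by (simp add: times_in_ring_prod)
qed

lemma ring_prod_Int_sigma_finite_times:
  assumes "E \<in> \<RR>" "A \<in> \<SS>\<^sub>\<sigma>" "B \<in> \<TT>\<^sub>\<sigma>"
  shows "E \<inter> A \<times> B \<in> \<RR>\<^sub>\<sigma>"
  using assms left.sigma_finite_sets_Int right.sigma_finite_sets_Int
  by (intro ring_prod_Int_times_in_ideal[of E \<SS> \<TT>]) auto

lemma sigma_finite_ring_prod_ideal:
  assumes "E \<in> \<RR>" "F \<in> \<RR>\<^sub>\<sigma>" "E \<subseteq> F"
  shows "E \<in> \<RR>\<^sub>\<sigma>"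
proof -
  obtain A B where "A \<in> \<SS>\<^sub>\<sigma>" "B \<in> \<TT>\<^sub>\<sigma>" "F \<subseteq> A \<times> B"
    using assms(2) by (rule sigma_finite.ring_prod_subset_times)
  then show ?thesis
    using ring_prod_Int_sigma_finite_times[of E A B] assms by (simp add: Int_absorb2)
qed

text \<open>A measure with the prescribed \<open>\<sigma>\<close>-finite component is \<open>\<infinity>\<close> off \<open>\<RR>\<^sub>\<sigma>\<close>, since a set with a finite
  value belongs to that component. Conversely the extension by \<open>\<infinity>\<close> is countably additive because
  \<open>\<RR>\<^sub>\<sigma>\<close> is an ideal of \<open>\<RR>\<close>, and it has the right component because a member of \<open>\<RR>\<^sub>\<sigma>\<close> is
  covered by countably many rectangles with sides of finite measure.\<close>

lemma product_measure_eq: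
  "\<mu>\<nu> = (\<lambda>E. if E \<in> \<RR>\<^sub>\<sigma> then section_measure E
     else if E \<in> \<RR> then \<infinity> else 0)" (is "_ = ?\<pi>")
  and ring_measure_product_measure: "ring_measure \<RR> \<mu>\<nu>"
  and sigma_finite_sets_product_measure:
    "sigma_finite_sets \<RR> \<mu>\<nu> = \<RR>\<^sub>\<sigma>"
proof -
  have ca: "countably_additive \<RR> ?\<pi>"
  proof (rule countably_additiveI)
    fix E :: "nat \<Rightarrow> ('a \<times> 'b) set"
    assume E: "range E \<subseteq> \<RR>" "disjoint_family E" "(\<Union>i. E i) \<in> \<RR>"
    show "(\<Sum>i. ?\<pi> (E i)) = ?\<pi> (\<Union>i. E i)"
    proof (cases "range E \<subseteq> \<RR>\<^sub>\<sigma>")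
      case True
      then have "(\<Union>i. E i) \<in> \<RR>\<^sub>\<sigma>" by (intro ring_prod_countable_UN) auto
      moreover from this have "(\<Sum>i. section_measure (E i)) = section_measure (\<Union>i. E i)"
        using ring_measure_section_measure True E(2)
        unfolding ring_measure_def countably_additive_def by simp
      ultimately show ?thesis using True by (simp add: range_subsetD)
    next
      case False
      then obtain i where i: "E i \<notin> \<RR>\<^sub>\<sigma>" by auto
      have Ei: "E i \<in> \<RR>" using E by auto
      have "(\<Union>i. E i) \<notin> \<RR>\<^sub>\<sigma>"
        using sigma_finite_ring_prod_ideal[OF Ei] i by blast
      moreover have "(\<Sum>j\<in>{i}. ?\<pi> (E j)) \<le> (\<Sum>j. ?\<pi> (E j))"
        by (intro sum_le_suminf) auto
      then have "(\<Sum>j. ?\<pi> (E j)) = \<infinity>" using i Ei by (simp add: top_unique)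
      ultimately show ?thesis using E(3) by simp
    qed
  qed
  have "?\<pi> {} = 0"
    using ring_measure_section_measure by (simp add: ring_measure_def positive_def ring_prod.empty)
  with ca have measure: "ring_measure \<RR> ?\<pi>" by (simp add: ring_measure_def positive_def)
  have sf: "sigma_finite_sets \<RR> ?\<pi> = \<RR>\<^sub>\<sigma>"
  proof
    have "finite_sets \<RR> ?\<pi> \<subseteq> \<RR>\<^sub>\<sigma>"
      by (auto simp: finite_sets_def split: if_splits)
    then show "sigma_finite_sets \<RR> ?\<pi> \<subseteq> \<RR>\<^sub>\<sigma>"
      unfolding sigma_finite_sets_def by (blast intro: ring_prod_countable_UN)
    show "\<RR>\<^sub>\<sigma> \<subseteq> sigma_finite_sets \<RR> ?\<pi>"
    proof
      fix E assume E: "E \<in> \<RR>\<^sub>\<sigma>"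
      then obtain A B where AB: "A \<in> \<SS>\<^sub>\<sigma>" "B \<in> \<TT>\<^sub>\<sigma>" "E \<subseteq> A \<times> B"
        by (rule sigma_finite.ring_prod_subset_times)
      obtain X Y where XY: "\<And>n :: nat. X n \<in> finite_sets \<SS> \<mu>" "\<And>n. Y n \<in> finite_sets \<TT> \<nu>"
        "A \<times> B = (\<Union>n. X n \<times> Y n)"
        using sigma_finite_times[OF AB(1,2)] by metis
      have "E \<inter> X n \<times> Y n \<in> finite_sets \<RR> ?\<pi>" for n
      proof -
        have XY': "X n \<in> \<SS>" "Y n \<in> \<TT>" "\<mu> (X n) < \<infinity>" "\<nu> (Y n) < \<infinity>" "X n \<in> \<SS>\<^sub>\<sigma>" "Y n \<in> \<TT>\<^sub>\<sigma>"
          using XY(1,2)[of n] left.finite_sets_subset_sigma_finite_sets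
            right.finite_sets_subset_sigma_finite_sets by (auto simp: finite_sets_def)
        then have 1: "E \<inter> X n \<times> Y n \<in> \<RR>\<^sub>\<sigma>"
          using E sigma_finite_ring_prod_subset by (intro ring_prod_Int_sigma_finite_times) auto
        have "section_measure (E \<inter> X n \<times> Y n) \<le> section_measure (X n \<times> Y n)"
          using XY' by (intro section_measure_mono times_in_ring_prod) auto
        also have "\<dots> < \<infinity>" using XY' by (simp add: section_measure_times ennreal_mult_less_top)
        finally show ?thesis using 1 sigma_finite_ring_prod_subset by (auto simp: finite_sets_def)
      qed
      moreover have "E = (\<Union>n. E \<inter> X n \<times> Y n)" using AB(3) unfolding XY(3) by blast
      ultimately show "E \<in> sigma_finite_sets \<RR> ?\<pi>"
        unfolding sigma_finite_sets_def by blast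
    qed
  qed
  show eq: "\<mu>\<nu> = ?\<pi>"
    unfolding product_measure_def
  proof (rule the_equality; (elim conjE)?)
    fix \<pi>
    assume \<pi>: "ring_measure \<RR> \<pi>" "sigma_finite_sets \<RR> \<pi> = \<RR>\<^sub>\<sigma>"
      "\<forall>E\<in>\<RR>\<^sub>\<sigma>. \<pi> E = classical_product \<SS>\<^sub>\<sigma> \<mu> \<TT>\<^sub>\<sigma> \<nu> E"
      "\<forall>E. E \<notin> \<RR> \<longrightarrow> \<pi> E = 0"
    have "\<pi> E = \<infinity>" if "E \<in> \<RR>" "E \<notin> \<RR>\<^sub>\<sigma>" for E
    proof (rule ccontr)
      assume "\<pi> E \<noteq> \<infinity>"
      then have "range (\<lambda>_ :: nat. E) \<subseteq> finite_sets \<RR> \<pi>"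
        using that by (simp add: finite_sets_def less_top)
      then have "(\<Union>i :: nat. E) \<in> sigma_finite_sets \<RR> \<pi>"
        unfolding sigma_finite_sets_def by blast
      with that(2) show False unfolding \<pi>(2) by simp
    qed
    then show "\<pi> = ?\<pi>" using \<pi>(3,4) by (intro ext) (simp add: classical_product_eq)
  next
    show "ring_measure \<RR> ?\<pi> \<and> sigma_finite_sets \<RR> ?\<pi> = \<RR>\<^sub>\<sigma> \<and>
      (\<forall>E\<in>\<RR>\<^sub>\<sigma>. ?\<pi> E = classical_product \<SS>\<^sub>\<sigma> \<mu> \<TT>\<^sub>\<sigma> \<nu> E) \<and>
      (\<forall>E. E \<notin> \<RR> \<longrightarrow> ?\<pi> E = 0)"
    proof (intro conjI)
      show "\<forall>E. E \<notin> \<RR> \<longrightarrow> ?\<pi> E = 0"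
        using sigma_finite_ring_prod_subset by auto
    qed (use measure sf in \<open>simp_all add: classical_product_eq\<close>)
  qed
  show "ring_measure \<RR> \<mu>\<nu>" unfolding eq by (rule measure)
  show "sigma_finite_sets \<RR> \<mu>\<nu> = \<RR>\<^sub>\<sigma>" unfolding eq by (rule sf)
qed

sublocale product: ring_measure_space "S \<times> T" "\<RR>" "\<mu>\<nu>"
proof (intro ring_measure_space.intro ring_measure_space_axioms.intro)
  show "S \<times> T \<noteq> {}" using left.nonempty right.nonempty by auto
qed (rule sigma_ring_ring_prod, rule ring_measure_product_measure)

abbreviation "MN \<equiv> ring_extension (S \<times> T) \<RR> \<mu>\<nu>"

end

section \<open>Tonelli's theorem\<close>

context ring_measure_pair
begin

lemma measurable_MN_pair:
  assumes "f \<in> borel_measurable MN"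
  shows "f \<in> borel_measurable (M \<Otimes>\<^sub>M N)"
proof -
  have "(\<lambda>x. x) \<in> M \<Otimes>\<^sub>M N \<rightarrow>\<^sub>M MN"
  proof (rule measurableI)
    fix E assume "E \<in> sets MN"
    then consider "E \<in> \<RR>" | D where "D \<in> \<RR>" "E = S \<times> T - D"
      unfolding product.sets_M by blast
    then have "E \<inter> space (M \<Otimes>\<^sub>M N) \<in> sets (M \<Otimes>\<^sub>M N)"
    proof cases
      case 1
      then show ?thesis using ring_prod_subset_local_product[OF 1] by (simp only: sets.Int_space_eq2)
    next
      case 2
      then have "E \<inter> space (M \<Otimes>\<^sub>M N) = space (M \<Otimes>\<^sub>M N) - D"
        by (auto simp: space_pair_measure)
      then show ?thesis using ring_prod_subset_local_product[OF 2(1)] by (simp only: sets.compl_sets)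
    qed
    then show "(\<lambda>x. x) -` E \<inter> space (M \<Otimes>\<^sub>M N) \<in> sets (M \<Otimes>\<^sub>M N)" by simp
  qed (simp add: space_pair_measure)
  from measurable_compose[OF this assms] show ?thesis .
qed

text \<open>On functions that vanish off a rectangle with \<open>\<sigma>\<close>-finite sides, the product measure and the
  local product have the same integral; the local product only has more measurable sets.\<close>

lemma nn_integral_MN_local_product:
  assumes A: "A \<in> \<SS>\<^sub>\<sigma>" and B: "B \<in> \<TT>\<^sub>\<sigma>" and f: "f \<in> borel_measurable MN"
    and zero: "\<forall>x\<in>S \<times> T - A \<times> B. f x = (0 :: ennreal)"
  shows "(\<integral>\<^sup>+x. f x \<partial>MN) = (\<integral>\<^sup>+x. f x \<partial>local_product A B)"
proof -
  have AB: "A \<times> B \<in> \<RR>\<^sub>\<sigma>" using A B by (rule times_in_ring_prod)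
  then have AB': "A \<times> B \<in> \<RR>" using sigma_finite_ring_prod_subset by auto
  have sub: "E \<in> sets (local_product A B)" if "E \<in> sets MN" for E
  proof -
    have "(indicator E :: _ \<Rightarrow> real) \<in> borel_measurable (M \<Otimes>\<^sub>M N)"
      using measurable_MN_pair[OF borel_measurable_indicator[OF that]] .
    moreover have "E \<subseteq> space (M \<Otimes>\<^sub>M N)"
      using sets.sets_into_space[OF that] by (simp add: space_pair_measure)
    ultimately show ?thesis unfolding sets_local_product by (simp add: borel_measurable_indicator_iff Int_absorb2)
  qed
  have id: "(\<lambda>x. x) \<in> local_product A B \<rightarrow>\<^sub>M MN"
  proof (rule measurableI)
    fix E assume E: "E \<in> sets MN"
    then have "E \<subseteq> space (local_product A B)"
      using sets.sets_into_space[OF E] by (simp add: space_pair_measure)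
    then show "(\<lambda>x. x) -` E \<inter> space (local_product A B) \<in> sets (local_product A B)"
      using sub[OF E] by (simp add: Int_absorb2)
  qed (simp add: space_pair_measure)
  have "density MN (indicator (A \<times> B)) = distr (local_product A B) MN (\<lambda>x. x)"
  proof (rule measure_eqI)
    fix E assume "E \<in> sets (density MN (indicator (A \<times> B)))"
    then have E: "E \<in> sets MN" by simp
    have "E \<inter> A \<times> B \<in> \<RR>" using E AB' by (rule product.sets_M_Int_ring)
    then have EAB: "E \<inter> A \<times> B \<in> \<RR>\<^sub>\<sigma>" using AB by (rule sigma_finite_ring_prod_ideal) auto
    have "emeasure (density MN (indicator (A \<times> B))) E = emeasure MN (A \<times> B \<inter> E)"
      using AB' E by (intro emeasure_restricted) auto
    also have "\<dots> = \<mu>\<nu> (E \<inter> A \<times> B)"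
      using product.emeasure_M_ring[OF \<open>E \<inter> A \<times> B \<in> \<RR>\<close>] by (simp only: Int_commute)
    also have "\<dots> = section_measure (E \<inter> A \<times> B)"
      using EAB by (simp add: product_measure_eq)
    also have "\<dots> = emeasure (local_product A B) E"
      using sub[OF E] by (intro emeasure_local_product[symmetric] A B) (simp only: sets_local_product)
    also have "\<dots> = emeasure (distr (local_product A B) MN (\<lambda>x. x)) E"
    proof -
      have "E \<subseteq> space (local_product A B)"
        using sets.sets_into_space[OF E] by (simp add: space_pair_measure)
      then show ?thesis using E id by (simp add: emeasure_distr Int_absorb2)
    qed
    finally show "emeasure (density MN (indicator (A \<times> B))) E = emeasure (distr (local_product A B) MN (\<lambda>x. x)) E" .
  qed simp
  have "(\<integral>\<^sup>+x. f x \<partial>MN) = (\<integral>\<^sup>+x. indicator (A \<times> B) x * f x \<partial>MN)"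
    by (intro nn_integral_cong) (use zero in \<open>auto split: split_indicator\<close>)
  also have "\<dots> = (\<integral>\<^sup>+x. f x \<partial>density MN (indicator (A \<times> B)))"
    using AB' f by (intro nn_integral_density[symmetric]) (auto intro!: borel_measurable_indicator)
  also have "\<dots> = (\<integral>\<^sup>+x. f x \<partial>distr (local_product A B) MN (\<lambda>x. x))" by (simp only: \<open>density MN _ = _\<close>)
  also have "\<dots> = (\<integral>\<^sup>+x. f x \<partial>local_product A B)" using id f by (subst nn_integral_distr) simp_all
  finally show ?thesis .
qed

text \<open>Since \<open>f\<close> vanishes off \<open>A \<times> B\<close>, the densities can be dropped from the iterated integrals with respect
  to the factors of the local product.\<close>

lemma tonelli:
  fixes f :: "'a \<times> 'b \<Rightarrow> ennreal"
  assumes A: "A \<in> \<SS>\<^sub>\<sigma>" and B: "B \<in> \<TT>\<^sub>\<sigma>" and f: "f \<in> borel_measurable MN"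
    and zero: "\<forall>x\<in>S \<times> T - A \<times> B. f x = 0"
  shows "(\<lambda>s. \<integral>\<^sup>+t. f (s, t) \<partial>N) \<in> borel_measurable M"
    and "(\<lambda>t. \<integral>\<^sup>+s. f (s, t) \<partial>M) \<in> borel_measurable N"
    and "(\<integral>\<^sup>+x. f x \<partial>MN) = (\<integral>\<^sup>+s. \<integral>\<^sup>+t. f (s, t) \<partial>N \<partial>M)"
    and "(\<integral>\<^sup>+x. f x \<partial>MN) = (\<integral>\<^sup>+t. \<integral>\<^sup>+s. f (s, t) \<partial>M \<partial>N)"
proof -
  interpret pair_sigma_finite "density M (indicator A)" "density N (indicator B)"
    using A B by (rule pair_sigma_finite_density)
  have [measurable]: "A \<in> sets M" "B \<in> sets N"
    using A B left.sigma_finite_sets_subset right.sigma_finite_sets_subset by auto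
  have f_pair [measurable]: "f \<in> borel_measurable (M \<Otimes>\<^sub>M N)" by (rule measurable_MN_pair) (rule f)
  have f_local: "f \<in> borel_measurable (local_product A B)"
    using f_pair unfolding measurable_cong_sets[OF sets_local_product refl] .
  have N: "(\<integral>\<^sup>+t. f (s, t) \<partial>density N (indicator B)) = (\<integral>\<^sup>+t. f (s, t) \<partial>N)" if "s \<in> S" for s
  proof -
    have "(\<lambda>t. f (s, t)) \<in> borel_measurable N" using that by (intro measurable_Pair2[OF f_pair]) simp
    then have "(\<integral>\<^sup>+t. f (s, t) \<partial>density N (indicator B)) = (\<integral>\<^sup>+t. indicator B t * f (s, t) \<partial>N)"
      by (intro nn_integral_density) auto
    also have "\<dots> = (\<integral>\<^sup>+t. f (s, t) \<partial>N)"
      by (intro nn_integral_cong) (use that zero in \<open>auto split: split_indicator\<close>)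
    finally show ?thesis .
  qed
  have M: "(\<integral>\<^sup>+s. f (s, t) \<partial>density M (indicator A)) = (\<integral>\<^sup>+s. f (s, t) \<partial>M)" if "t \<in> T" for t
  proof -
    have "(\<lambda>s. f (s, t)) \<in> borel_measurable M" using that by (intro measurable_Pair1[OF f_pair]) simp
    then have "(\<integral>\<^sup>+s. f (s, t) \<partial>density M (indicator A)) = (\<integral>\<^sup>+s. indicator A s * f (s, t) \<partial>M)"
      by (intro nn_integral_density) auto
    also have "\<dots> = (\<integral>\<^sup>+s. f (s, t) \<partial>M)"
      by (intro nn_integral_cong) (use that zero in \<open>auto split: split_indicator\<close>)
    finally show ?thesis .
  qed
  have "(\<lambda>s. \<integral>\<^sup>+t. f (s, t) \<partial>density N (indicator B)) \<in> borel_measurable (density M (indicator A))"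
    by (rule M2.borel_measurable_nn_integral_fst[OF f_local])
  then have "(\<lambda>s. \<integral>\<^sup>+t. f (s, t) \<partial>density N (indicator B)) \<in> borel_measurable M" by simp
  then show meas_M: "(\<lambda>s. \<integral>\<^sup>+t. f (s, t) \<partial>N) \<in> borel_measurable M"
    by (rule measurable_cong[THEN iffD1, rotated]) (simp add: N)
  have "(\<lambda>t. \<integral>\<^sup>+s. f (s, t) \<partial>density M (indicator A)) \<in> borel_measurable (density N (indicator B))"
    using M1.borel_measurable_nn_integral_fst[OF measurable_pair_swap[OF f_local]] by simp
  then have "(\<lambda>t. \<integral>\<^sup>+s. f (s, t) \<partial>density M (indicator A)) \<in> borel_measurable N" by simp
  then show meas_N: "(\<lambda>t. \<integral>\<^sup>+s. f (s, t) \<partial>M) \<in> borel_measurable N"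
    by (rule measurable_cong[THEN iffD1, rotated]) (simp add: M)
  have MN: "(\<integral>\<^sup>+x. f x \<partial>MN) = (\<integral>\<^sup>+x. f x \<partial>local_product A B)"
    by (rule nn_integral_MN_local_product[OF A B f zero])
  have "(\<integral>\<^sup>+x. f x \<partial>MN) = (\<integral>\<^sup>+s. \<integral>\<^sup>+t. f (s, t) \<partial>density N (indicator B) \<partial>density M (indicator A))"
    unfolding MN by (rule M2.nn_integral_fst[OF f_local, symmetric])
  also have "\<dots> = (\<integral>\<^sup>+s. \<integral>\<^sup>+t. f (s, t) \<partial>N \<partial>density M (indicator A))"
    by (intro nn_integral_cong) (simp add: N)
  also have "\<dots> = (\<integral>\<^sup>+s. indicator A s * (\<integral>\<^sup>+t. f (s, t) \<partial>N) \<partial>M)"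
    using meas_M by (intro nn_integral_density) auto
  also have "\<dots> = (\<integral>\<^sup>+s. \<integral>\<^sup>+t. f (s, t) \<partial>N \<partial>M)"
  proof (rule nn_integral_cong)
    fix s assume "s \<in> space M"
    then have "s \<notin> A \<Longrightarrow> (\<integral>\<^sup>+t. f (s, t) \<partial>N) = (\<integral>\<^sup>+t. 0 \<partial>N)"
      by (intro nn_integral_cong) (use zero in auto)
    then show "indicator A s * (\<integral>\<^sup>+t. f (s, t) \<partial>N) = (\<integral>\<^sup>+t. f (s, t) \<partial>N)"
      by (auto split: split_indicator)
  qed
  finally show "(\<integral>\<^sup>+x. f x \<partial>MN) = (\<integral>\<^sup>+s. \<integral>\<^sup>+t. f (s, t) \<partial>N \<partial>M)" .
  have "(\<integral>\<^sup>+x. f x \<partial>MN) = (\<integral>\<^sup>+t. \<integral>\<^sup>+s. f (s, t) \<partial>density M (indicator A) \<partial>density N (indicator B))"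
    unfolding MN by (rule nn_integral_snd[OF f_local, symmetric])
  also have "\<dots> = (\<integral>\<^sup>+t. \<integral>\<^sup>+s. f (s, t) \<partial>M \<partial>density N (indicator B))"
    by (intro nn_integral_cong) (simp add: M)
  also have "\<dots> = (\<integral>\<^sup>+t. indicator B t * (\<integral>\<^sup>+s. f (s, t) \<partial>M) \<partial>N)"
    using meas_N by (intro nn_integral_density) auto
  also have "\<dots> = (\<integral>\<^sup>+t. \<integral>\<^sup>+s. f (s, t) \<partial>M \<partial>N)"
  proof (rule nn_integral_cong)
    fix t assume "t \<in> space N"
    then have "t \<notin> B \<Longrightarrow> (\<integral>\<^sup>+s. f (s, t) \<partial>M) = (\<integral>\<^sup>+s. 0 \<partial>M)"
      by (intro nn_integral_cong) (use zero in auto)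
    then show "indicator B t * (\<integral>\<^sup>+s. f (s, t) \<partial>M) = (\<integral>\<^sup>+s. f (s, t) \<partial>M)"
      by (auto split: split_indicator)
  qed
  finally show "(\<integral>\<^sup>+x. f x \<partial>MN) = (\<integral>\<^sup>+t. \<integral>\<^sup>+s. f (s, t) \<partial>M \<partial>N)" .
qed

lemma ring_measurable_sections:
  fixes f :: "'a \<times> 'b \<Rightarrow> 'c :: {topological_space, zero}"
  assumes "ring_measurable (S \<times> T) \<RR> f"
  shows "s \<in> S \<Longrightarrow> ring_measurable T \<TT> (\<lambda>t. f (s, t))"
    and "t \<in> T \<Longrightarrow> ring_measurable S \<SS> (\<lambda>s. f (s, t))"
proof -
  have f: "f \<in> borel_measurable (M \<Otimes>\<^sub>M N)" "{x \<in> S \<times> T. f x \<noteq> 0} \<in> \<RR>"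
    using assms by (auto simp: product.ring_measurable_iff measurable_MN_pair)
  show "ring_measurable T \<TT> (\<lambda>t. f (s, t))" if s: "s \<in> S"
  proof -
    have "(\<lambda>t. f (s, t)) \<in> borel_measurable N" using s by (intro measurable_Pair2[OF f(1)]) simp
    moreover have "{t \<in> T. f (s, t) \<noteq> 0} = Pair s -` {x \<in> S \<times> T. f x \<noteq> 0}" using s by auto
    ultimately show ?thesis using ring_prod_section(1)[OF f(2), of s] by (simp add: right.ring_measurable_iff)
  qed
  show "ring_measurable S \<SS> (\<lambda>s. f (s, t))" if t: "t \<in> T"
  proof -
    have "(\<lambda>s. f (s, t)) \<in> borel_measurable M" using t by (intro measurable_Pair1[OF f(1)]) simp
    moreover have "{s \<in> S. f (s, t) \<noteq> 0} = (\<lambda>s. (s, t)) -` {x \<in> S \<times> T. f x \<noteq> 0}" using t by auto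
    ultimately show ?thesis using ring_prod_section(2)[OF f(2), of t] by (simp add: left.ring_measurable_iff)
  qed
qed

text \<open>The preimage of a set without \<open>0\<close> lies in the support and so belongs to the ideal \<open>\<RR>\<^sub>\<sigma>\<close>; the
  preimage of a set that contains \<open>0\<close> is the complement of such a preimage.\<close>

lemma ring_measurable_sigma_finite_iff:
  fixes f :: "'a \<times> 'b \<Rightarrow> 'c :: {t1_space, zero}"
  assumes f: "ring_measurable (S \<times> T) \<RR> f"
  shows "ring_measurable (S \<times> T) \<RR>\<^sub>\<sigma> f \<longleftrightarrow> {x \<in> S \<times> T. f x \<noteq> 0} \<in> \<RR>\<^sub>\<sigma>"
proof
  assume supp: "{x \<in> S \<times> T. f x \<noteq> 0} \<in> \<RR>\<^sub>\<sigma>"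
  let ?R = "\<RR>\<^sub>\<sigma>"
  interpret R: sigma_ring "S \<times> T" ?R by (rule sigma_finite.sigma_ring_ring_prod)
  have R_Pow: "?R \<union> {S \<times> T} \<subseteq> Pow (S \<times> T)" using R.space_closed by auto
  have off_zero: "f -` U \<inter> S \<times> T \<in> ?R" if U: "U \<in> sets borel" "0 \<notin> U" for U
  proof -
    have "f -` U \<inter> space MN \<in> sets MN"
      using f U(1) by (intro measurable_sets) (auto simp: product.ring_measurable_iff)
    moreover have "f -` U \<inter> space MN \<subseteq> {x \<in> S \<times> T. f x \<noteq> 0}" using U(2) by auto
    moreover have "{x \<in> S \<times> T. f x \<noteq> 0} \<in> \<RR>" using supp sigma_finite_ring_prod_subset by auto
    ultimately have "f -` U \<inter> space MN \<in> \<RR>\<^sub>\<sigma>"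
      using product.sets_M_subset_ring sigma_finite_ring_prod_ideal[OF _ supp] by meson
    then show ?thesis by simp
  qed
  have "f \<in> borel_measurable (sigma (S \<times> T) (?R \<union> {S \<times> T}))"
  proof (rule measurableI)
    fix U :: "'c set" assume U: "U \<in> sets borel"
    have "f -` U \<inter> S \<times> T \<in> ?R \<union> {S \<times> T - A |A. A \<in> ?R}"
    proof (cases "0 \<in> U")
      case True
      have "f -` (- U) \<inter> S \<times> T \<in> ?R" using U True by (intro off_zero) auto
      moreover have "f -` U \<inter> S \<times> T = S \<times> T - (f -` (- U) \<inter> S \<times> T)" by auto
      ultimately show ?thesis by blast
    qed (use off_zero U in auto)
    then show "f -` U \<inter> space (sigma (S \<times> T) (?R \<union> {S \<times> T})) \<in> sets (sigma (S \<times> T) (?R \<union> {S \<times> T}))"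
      unfolding sets_measure_of[OF R_Pow] space_measure_of[OF R_Pow] R.sigma_sets_eq_ring_or_co_ring .
  qed simp
  with supp show "ring_measurable (S \<times> T) ?R f" by (simp add: ring_measurable_def)
qed (simp add: ring_measurable_def)

lemma tonelli_extended_integral:
  assumes f: "f \<in> nonneg_measurable (S \<times> T) \<RR>"
    and supp: "{x \<in> S \<times> T. f x \<noteq> 0} \<in> \<RR>\<^sub>\<sigma>"
  shows "(\<lambda>s. extended_integral T \<TT> \<nu> (\<lambda>t. f (s, t))) \<in> nonneg_measurable S \<SS>"
    and "(\<lambda>t. extended_integral S \<SS> \<mu> (\<lambda>s. f (s, t))) \<in> nonneg_measurable T \<TT>"
    and "extended_integral (S \<times> T) \<RR> \<mu>\<nu> f =
      extended_integral S \<SS> \<mu> (\<lambda>s. extended_integral T \<TT> \<nu> (\<lambda>t. f (s, t)))"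
    and "extended_integral (S \<times> T) \<RR> \<mu>\<nu> f =
      extended_integral T \<TT> \<nu> (\<lambda>t. extended_integral S \<SS> \<mu> (\<lambda>s. f (s, t)))"
proof -
  obtain A B where AB: "A \<in> \<SS>\<^sub>\<sigma>" "B \<in> \<TT>\<^sub>\<sigma>" "{x \<in> S \<times> T. f x \<noteq> 0} \<subseteq> A \<times> B"
    using supp by (rule sigma_finite.ring_prod_subset_times)
  have f_MN: "f \<in> borel_measurable MN" using f by (simp add: product.nonneg_measurable_iff)
  have zero: "\<forall>x\<in>S \<times> T - A \<times> B. f x = 0" using AB(3) by auto
  note T = tonelli[OF AB(1,2) f_MN zero]
  have ring: "A \<in> \<SS>" "B \<in> \<TT>"
    using AB left.sigma_finite_sets_subset right.sigma_finite_sets_subset by auto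
  have eN: "extended_integral T \<TT> \<nu> (\<lambda>t. f (s, t)) = (\<integral>\<^sup>+t. f (s, t) \<partial>N)" if "s \<in> S" for s
    using ring_measurable_sections(1) f that
    by (intro right.extended_integral_eq) (simp add: nonneg_measurable_def)
  have eM: "extended_integral S \<SS> \<mu> (\<lambda>s. f (s, t)) = (\<integral>\<^sup>+s. f (s, t) \<partial>M)" if "t \<in> T" for t
    using ring_measurable_sections(2) f that
    by (intro left.extended_integral_eq) (simp add: nonneg_measurable_def)
  show 1: "(\<lambda>s. extended_integral T \<TT> \<nu> (\<lambda>t. f (s, t))) \<in> nonneg_measurable S \<SS>"
    unfolding nonneg_measurable_def mem_Collect_eq
  proof (rule left.ring_measurable_if_support_subset[OF _ ring(1)])
    show "(\<lambda>s. extended_integral T \<TT> \<nu> (\<lambda>t. f (s, t))) \<in> borel_measurable M"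
      by (rule measurable_cong[THEN iffD1, OF _ T(1)]) (simp only: left.space_M eN)
    fix s assume s: "s \<in> S" "s \<notin> A"
    have "(\<integral>\<^sup>+t. f (s, t) \<partial>N) = (\<integral>\<^sup>+t. 0 \<partial>N)"
      by (intro nn_integral_cong) (use s zero in auto)
    then show "extended_integral T \<TT> \<nu> (\<lambda>t. f (s, t)) = 0" using s by (simp add: eN)
  qed
  show 2: "(\<lambda>t. extended_integral S \<SS> \<mu> (\<lambda>s. f (s, t))) \<in> nonneg_measurable T \<TT>"
    unfolding nonneg_measurable_def mem_Collect_eq
  proof (rule right.ring_measurable_if_support_subset[OF _ ring(2)])
    show "(\<lambda>t. extended_integral S \<SS> \<mu> (\<lambda>s. f (s, t))) \<in> borel_measurable N"
      by (rule measurable_cong[THEN iffD1, OF _ T(2)]) (simp only: right.space_M eM)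
    fix t assume t: "t \<in> T" "t \<notin> B"
    have "(\<integral>\<^sup>+s. f (s, t) \<partial>M) = (\<integral>\<^sup>+s. 0 \<partial>M)"
      by (intro nn_integral_cong) (use t zero in auto)
    then show "extended_integral S \<SS> \<mu> (\<lambda>s. f (s, t)) = 0" using t by (simp add: eM)
  qed
  have "extended_integral S \<SS> \<mu> (\<lambda>s. extended_integral T \<TT> \<nu> (\<lambda>t. f (s, t))) = (\<integral>\<^sup>+s. \<integral>\<^sup>+t. f (s, t) \<partial>N \<partial>M)"
    unfolding left.extended_integral_eq[OF 1] by (intro nn_integral_cong) (simp add: eN)
  then show "extended_integral (S \<times> T) \<RR> \<mu>\<nu> f =
      extended_integral S \<SS> \<mu> (\<lambda>s. extended_integral T \<TT> \<nu> (\<lambda>t. f (s, t)))"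
    using T(3) product.extended_integral_eq[OF f] by simp
  have "extended_integral T \<TT> \<nu> (\<lambda>t. extended_integral S \<SS> \<mu> (\<lambda>s. f (s, t))) = (\<integral>\<^sup>+t. \<integral>\<^sup>+s. f (s, t) \<partial>M \<partial>N)"
    unfolding right.extended_integral_eq[OF 2] by (intro nn_integral_cong) (simp add: eM)
  then show "extended_integral (S \<times> T) \<RR> \<mu>\<nu> f =
      extended_integral T \<TT> \<nu> (\<lambda>t. extended_integral S \<SS> \<mu> (\<lambda>s. f (s, t)))"
    using T(4) product.extended_integral_eq[OF f] by simp
qed

end

section \<open>Fubini's theorem\<close>

lemma e2ennreal_max_0: "e2ennreal (max 0 x) = e2ennreal x"
  by (simp add: e2ennreal_def)

lemma e2ennreal_abs: "e2ennreal \<bar>x\<bar> = e2ennreal x + e2ennreal (- x)"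
  by (cases "0 \<le> x") (auto simp: e2ennreal_neg)

context ring_measure_space
begin

lemma nonneg_measurable_parts:
  fixes f :: "'a \<Rightarrow> ereal"
  assumes "ring_measurable S \<SS> f"
  shows "(\<lambda>x. e2ennreal (f x)) \<in> nonneg_measurable S \<SS>"
    and "(\<lambda>x. e2ennreal (- f x)) \<in> nonneg_measurable S \<SS>"
    and "(\<lambda>x. e2ennreal \<bar>f x\<bar>) \<in> nonneg_measurable S \<SS>"
proof -
  have [measurable]: "f \<in> borel_measurable M" and supp: "{x \<in> S. f x \<noteq> 0} \<in> \<SS>"
    using assms by (auto simp: ring_measurable_iff)
  have *: "g \<in> borel_measurable M \<Longrightarrow> (\<And>x. f x = 0 \<Longrightarrow> g x = 0) \<Longrightarrow> g \<in> nonneg_measurable S \<SS>" for g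
    unfolding nonneg_measurable_def mem_Collect_eq
    by (rule ring_measurable_if_support_subset[OF _ supp]) auto
  show "(\<lambda>x. e2ennreal (f x)) \<in> nonneg_measurable S \<SS>" by (rule *) (auto simp: e2ennreal_neg)
  show "(\<lambda>x. e2ennreal (- f x)) \<in> nonneg_measurable S \<SS>" by (rule *) (auto simp: e2ennreal_neg)
  show "(\<lambda>x. e2ennreal \<bar>f x\<bar>) \<in> nonneg_measurable S \<SS>" by (rule *) (auto simp: e2ennreal_neg)
qed

lemma ring_integrable_iff:
  "ring_integrable S \<SS> \<mu> f \<longleftrightarrow> ring_measurable S \<SS> f \<and>
    (\<integral>\<^sup>+x. e2ennreal (f x) \<partial>M) < \<infinity> \<and> (\<integral>\<^sup>+x. e2ennreal (- f x) \<partial>M) < \<infinity>"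
proof (cases "ring_measurable S \<SS> f")
  case True
  then have "(\<integral>\<^sup>+x. e2ennreal \<bar>f x\<bar> \<partial>M) = (\<integral>\<^sup>+x. e2ennreal (f x) \<partial>M) + (\<integral>\<^sup>+x. e2ennreal (- f x) \<partial>M)"
    using nonneg_measurable_parts[OF True]
    unfolding e2ennreal_abs by (intro nn_integral_add) (auto simp: nonneg_measurable_iff)
  then show ?thesis
    using True extended_integral_eq[OF nonneg_measurable_parts(3)[OF True]]
    by (simp add: ring_integrable_def)
qed (simp add: ring_integrable_def)

lemma ring_integral_eq:
  assumes "ring_measurable S \<SS> f"
  shows "ring_integral S \<SS> \<mu> f = enn2real (\<integral>\<^sup>+x. e2ennreal (f x) \<partial>M) - enn2real (\<integral>\<^sup>+x. e2ennreal (- f x) \<partial>M)"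
  using nonneg_measurable_parts[OF assms]
  by (simp add: ring_integral_def e2ennreal_max_0 extended_integral_eq)

lemma ring_integral_real:
  assumes u: "integrable M u" and g: "\<And>x. x \<in> S \<Longrightarrow> g x = ereal (u x)"
  shows "ring_integrable S \<SS> \<mu> g" and "ring_integral S \<SS> \<mu> g = integral\<^sup>L M u"
proof -
  have "(\<lambda>x. ereal (u x)) \<in> borel_measurable M" using u by auto
  then have "g \<in> borel_measurable M"
    by (rule measurable_cong[THEN iffD1, rotated]) (simp add: g)
  moreover have "{x \<in> S. g x \<noteq> 0} = {x \<in> S. u x \<noteq> 0}" using g by auto
  ultimately have meas: "ring_measurable S \<SS> g"
    using integrable_ring_measurable[OF u] by (simp add: ring_measurable_iff)
  have parts: "(\<integral>\<^sup>+x. e2ennreal (g x) \<partial>M) = (\<integral>\<^sup>+x. ennreal (u x) \<partial>M)"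
    "(\<integral>\<^sup>+x. e2ennreal (- g x) \<partial>M) = (\<integral>\<^sup>+x. ennreal (- u x) \<partial>M)"
    by (intro nn_integral_cong; simp add: g)+
  then show "ring_integrable S \<SS> \<mu> g"
    unfolding ring_integrable_iff using u meas by (simp add: real_integrable_def less_top)
  show "ring_integral S \<SS> \<mu> g = integral\<^sup>L M u"
    unfolding ring_integral_eq[OF meas] parts using u by (simp add: real_lebesgue_integral_def)
qed

end

context ring_measure_pair
begin

text \<open>The positive and the negative parts of the sections have integrals \<open>h\<close> and \<open>k\<close> that are finite
  off a null set, so that outside any exceptional set the integral of the section is the difference
  of two finite integrable functions.\<close>

lemma has_ae_integral_sections:
  fixes f :: "'a \<Rightarrow> 'b \<Rightarrow> ereal"
  defines "h \<equiv> \<lambda>s. \<integral>\<^sup>+t. e2ennreal (f s t) \<partial>N" and "k \<equiv> \<lambda>s. \<integral>\<^sup>+t. e2ennreal (- f s t) \<partial>N"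
  assumes sections: "\<And>s. s \<in> S \<Longrightarrow> ring_measurable T \<TT> (f s)"
    and [measurable]: "h \<in> borel_measurable M" "k \<in> borel_measurable M"
    and fin: "(\<integral>\<^sup>+s. h s \<partial>M) < \<infinity>" "(\<integral>\<^sup>+s. k s \<partial>M) < \<infinity>"
  shows "has_ae_integral S \<SS> \<mu> (\<lambda>s. ring_integrable T \<TT> \<nu> (f s)) (\<lambda>s. ereal (ring_integral T \<TT> \<nu> (f s)))
    (enn2real (\<integral>\<^sup>+s. h s \<partial>M) - enn2real (\<integral>\<^sup>+s. k s \<partial>M))"
proof -
  have Q: "ring_integrable T \<TT> \<nu> (f s) \<longleftrightarrow> h s < \<infinity> \<and> k s < \<infinity>" if "s \<in> S" for s
    using sections[OF that] by (simp add: right.ring_integrable_iff h_def k_def)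
  have val: "ring_integral T \<TT> \<nu> (f s) = enn2real (h s) - enn2real (k s)" if "s \<in> S" for s
    using right.ring_integral_eq[OF sections[OF that]] by (simp add: h_def k_def)
  have "ring_almost_every S \<SS> \<mu> (\<lambda>s. ring_integrable T \<TT> \<nu> (f s))"
  proof -
    define Z where "Z = (h -` {\<infinity>} \<inter> space M) \<union> (k -` {\<infinity>} \<inter> space M)"
    have null: "h -` {\<infinity>} \<inter> space M \<in> null_sets M" "k -` {\<infinity>} \<inter> space M \<in> null_sets M"
      using fin by (intro null_setsI nn_integral_PInf measurable_sets[of _ _ borel]; simp)+
    then have Z: "Z \<in> null_sets M" unfolding Z_def by (rule null_sets.Un)
    then have "Z \<in> \<SS>" by (intro left.finite_emeasure_M_in_ring) auto
    with Z have "\<mu> Z = 0" using left.emeasure_M_ring[of Z] by (simp add: null_sets_def)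
    moreover have "ring_integrable T \<TT> \<nu> (f s)" if "s \<in> S - Z" for s
      using that Q by (auto simp: Z_def less_top)
    ultimately show ?thesis
      using \<open>Z \<in> \<SS>\<close> unfolding ring_almost_every_def exceptional_null_set_def by blast
  qed
  moreover have "ring_integrable S \<SS> \<mu> (\<lambda>s. if s \<in> Z then 0 else ereal (ring_integral T \<TT> \<nu> (f s))) \<and>
      ring_integral S \<SS> \<mu> (\<lambda>s. if s \<in> Z then 0 else ereal (ring_integral T \<TT> \<nu> (f s))) =
      enn2real (\<integral>\<^sup>+s. h s \<partial>M) - enn2real (\<integral>\<^sup>+s. k s \<partial>M)"
    if Z: "exceptional_null_set S \<SS> \<mu> (\<lambda>s. ring_integrable T \<TT> \<nu> (f s)) Z" for Z
  proof -
    have ZS: "Z \<in> \<SS>" "\<mu> Z = 0" using Z by (auto simp: exceptional_null_set_def)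
    then have [measurable]: "Z \<in> sets M" by auto
    have "Z \<in> null_sets M" using ZS by (intro null_setsI) auto
    then have AE: "AE s in M. s \<notin> Z" by (rule AE_not_in)
    have finite_off: "h s < \<infinity> \<and> k s < \<infinity>" if "s \<in> S" "s \<notin> Z" for s
      using Z that Q by (auto simp: exceptional_null_set_def)
    have part: "integrable M (\<lambda>s. if s \<in> Z then 0 else enn2real (g s)) \<and>
        (\<integral>s. (if s \<in> Z then 0 else enn2real (g s)) \<partial>M) = enn2real (\<integral>\<^sup>+s. g s \<partial>M)"
      if [measurable]: "g \<in> borel_measurable M" and g: "(\<integral>\<^sup>+s. g s \<partial>M) < \<infinity>"
        "\<And>s. s \<in> S \<Longrightarrow> s \<notin> Z \<Longrightarrow> g s < \<infinity>" for g :: "'a \<Rightarrow> ennreal"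
    proof -
      have meas: "(\<lambda>s. if s \<in> Z then 0 else enn2real (g s)) \<in> borel_measurable M" by measurable
      have eq: "(\<integral>\<^sup>+s. ennreal (if s \<in> Z then 0 else enn2real (g s)) \<partial>M) = (\<integral>\<^sup>+s. g s \<partial>M)"
      proof (rule nn_integral_cong_AE)
        show "AE s in M. ennreal (if s \<in> Z then 0 else enn2real (g s)) = g s"
          using AE AE_space by eventually_elim (use g(2) in \<open>auto simp: ennreal_enn2real\<close>)
      qed
      have "integrable M (\<lambda>s. if s \<in> Z then 0 else enn2real (g s))"
        using meas by (rule integrableI_nonneg) (use eq g(1) in auto)
      moreover have "(\<integral>s. (if s \<in> Z then 0 else enn2real (g s)) \<partial>M) = enn2real (\<integral>\<^sup>+s. g s \<partial>M)"
        using meas by (subst integral_eq_nn_integral) (simp_all add: eq)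
      ultimately show ?thesis ..
    qed
    let ?u = "\<lambda>s. (if s \<in> Z then 0 else enn2real (h s)) - (if s \<in> Z then 0 else enn2real (k s))"
    have hk: "integrable M (\<lambda>s. if s \<in> Z then 0 else enn2real (h s))"
      "(\<integral>s. (if s \<in> Z then 0 else enn2real (h s)) \<partial>M) = enn2real (\<integral>\<^sup>+s. h s \<partial>M)"
      "integrable M (\<lambda>s. if s \<in> Z then 0 else enn2real (k s))"
      "(\<integral>s. (if s \<in> Z then 0 else enn2real (k s)) \<partial>M) = enn2real (\<integral>\<^sup>+s. k s \<partial>M)"
      using part[of h] part[of k] fin finite_off by auto
    have u: "integrable M ?u"
      using hk(1,3) by (rule Bochner_Integration.integrable_diff)
    have "integral\<^sup>L M ?u = enn2real (\<integral>\<^sup>+s. h s \<partial>M) - enn2real (\<integral>\<^sup>+s. k s \<partial>M)"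
      unfolding Bochner_Integration.integral_diff[OF hk(1,3)] hk(2,4) ..
    moreover have "(if s \<in> Z then 0 else ereal (ring_integral T \<TT> \<nu> (f s))) = ereal (?u s)" if "s \<in> S" for s
      using val[OF that] by simp
    ultimately show ?thesis
      using left.ring_integral_real[OF u, of "\<lambda>s. if s \<in> Z then 0 else ereal (ring_integral T \<TT> \<nu> (f s))"]
      by simp
  qed
  ultimately show ?thesis unfolding has_ae_integral_def by blast
qed

text \<open>Integrability puts the support into a rectangle with \<open>\<sigma>\<close>-finite sides, so that the positive and the
  negative part are both subject to Tonelli's theorem.\<close>

lemma fubini:
  fixes f :: "'a \<times> 'b \<Rightarrow> ereal"
  assumes f: "ring_integrable (S \<times> T) \<RR> \<mu>\<nu> f"
  shows "has_ae_integral S \<SS> \<mu> (\<lambda>s. ring_integrable T \<TT> \<nu> (\<lambda>t. f (s, t)))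
      (\<lambda>s. ereal (ring_integral T \<TT> \<nu> (\<lambda>t. f (s, t))))
      (ring_integral (S \<times> T) \<RR> \<mu>\<nu> f)"
    and "has_ae_integral T \<TT> \<nu> (\<lambda>t. ring_integrable S \<SS> \<mu> (\<lambda>s. f (s, t)))
      (\<lambda>t. ereal (ring_integral S \<SS> \<mu> (\<lambda>s. f (s, t))))
      (ring_integral (S \<times> T) \<RR> \<mu>\<nu> f)"
proof -
  interpret swap: ring_measure_pair T \<TT> \<nu> S \<SS> \<mu> ..
  have f_meas: "ring_measurable (S \<times> T) \<RR> f"
    and fin: "(\<integral>\<^sup>+x. e2ennreal (f x) \<partial>MN) < \<infinity>" "(\<integral>\<^sup>+x. e2ennreal (- f x) \<partial>MN) < \<infinity>"
    using f by (auto simp: product.ring_integrable_iff)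
  have parts: "(\<lambda>x. e2ennreal (f x)) \<in> borel_measurable MN" "(\<lambda>x. e2ennreal (- f x)) \<in> borel_measurable MN"
    "(\<lambda>x. e2ennreal \<bar>f x\<bar>) \<in> borel_measurable MN"
    using product.nonneg_measurable_parts[OF f_meas] by (auto simp: product.nonneg_measurable_iff)
  have "(\<integral>\<^sup>+x. e2ennreal \<bar>f x\<bar> \<partial>MN) < \<infinity>"
    using fin parts unfolding e2ennreal_abs by (subst nn_integral_add) auto
  from product.nn_integral_finite_support[OF parts(3) this]
  have "{x \<in> S \<times> T. e2ennreal \<bar>f x\<bar> \<noteq> 0} \<in> \<RR>\<^sub>\<sigma>"
    by (simp only: sigma_finite_sets_product_measure)
  then obtain A B where AB: "A \<in> \<SS>\<^sub>\<sigma>" "B \<in> \<TT>\<^sub>\<sigma>" "{x \<in> S \<times> T. e2ennreal \<bar>f x\<bar> \<noteq> 0} \<subseteq> A \<times> B"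
    by (rule sigma_finite.ring_prod_subset_times)
  have zero: "\<forall>x\<in>S \<times> T - A \<times> B. e2ennreal (f x) = 0" "\<forall>x\<in>S \<times> T - A \<times> B. e2ennreal (- f x) = 0"
    using AB(3) by (auto simp: e2ennreal_abs)
  note pos = tonelli[OF AB(1,2) parts(1) zero(1)] and neg = tonelli[OF AB(1,2) parts(2) zero(2)]
  have val: "ring_integral (S \<times> T) \<RR> \<mu>\<nu> f =
      enn2real (\<integral>\<^sup>+x. e2ennreal (f x) \<partial>MN) - enn2real (\<integral>\<^sup>+x. e2ennreal (- f x) \<partial>MN)"
    by (rule product.ring_integral_eq[OF f_meas])
  show "has_ae_integral S \<SS> \<mu> (\<lambda>s. ring_integrable T \<TT> \<nu> (\<lambda>t. f (s, t)))
      (\<lambda>s. ereal (ring_integral T \<TT> \<nu> (\<lambda>t. f (s, t))))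
      (ring_integral (S \<times> T) \<RR> \<mu>\<nu> f)"
    unfolding val pos(3) neg(3)
    using pos(1) neg(1) fin[unfolded pos(3) neg(3)]
    by (intro has_ae_integral_sections[of "\<lambda>s t. f (s, t)"] ring_measurable_sections[OF f_meas])
  show "has_ae_integral T \<TT> \<nu> (\<lambda>t. ring_integrable S \<SS> \<mu> (\<lambda>s. f (s, t)))
      (\<lambda>t. ereal (ring_integral S \<SS> \<mu> (\<lambda>s. f (s, t))))
      (ring_integral (S \<times> T) \<RR> \<mu>\<nu> f)"
    unfolding val pos(4) neg(4)
    using pos(2) neg(2) fin[unfolded pos(4) neg(4)]
    by (intro swap.has_ae_integral_sections[of "\<lambda>t s. f (s, t)"] ring_measurable_sections[OF f_meas])
qed

end

section \<open>Elementary functions\<close>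

lemma function_span_zero: "(\<lambda>x. 0) \<in> function_span B"
  unfolding function_span_def by (intro CollectI exI[of _ 0]) simp

lemma function_span_add_scaled:
  assumes f: "f \<in> function_span B" and b: "b \<in> B"
  shows "(\<lambda>x. f x + c * b x) \<in> function_span B"
proof -
  obtain n k g where f: "f = (\<lambda>x. \<Sum>i<n. k i * g i x)" and g: "\<forall>i<n::nat. g i \<in> B"
    using f unfolding function_span_def by blast
  have "(\<lambda>x. f x + c * b x) = (\<lambda>x. \<Sum>i<Suc n. (k(n := c)) i * (g(n := b)) i x)"
    unfolding f by (simp add: fun_eq_iff)
  moreover have "\<forall>i<Suc n. (g(n := b)) i \<in> B" using g b by (auto simp: less_Suc_eq)
  ultimately show ?thesis unfolding function_span_def by blast
qed

text \<open>Adding one multiple of a generator at a time avoids all manipulation of the indexed sums in the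
  definition of the span.\<close>

lemma function_span_induct [consumes 1, case_names zero add_scaled]:
  assumes "f \<in> function_span B" "P (\<lambda>x. 0)"
    and step: "\<And>f c b. f \<in> function_span B \<Longrightarrow> P f \<Longrightarrow> b \<in> B \<Longrightarrow> P (\<lambda>x. f x + c * b x)"
  shows "P f"
proof -
  obtain n k g where f: "f = (\<lambda>x. \<Sum>i<n. k i * g i x)" and g: "\<forall>i<n::nat. g i \<in> B"
    using assms(1) unfolding function_span_def by blast
  have "P (\<lambda>x. \<Sum>i<m. k i * g i x) \<and> (\<lambda>x. \<Sum>i<m. k i * g i x) \<in> function_span B" if "m \<le> n" for m
    using that
  proof (induction m)
    case 0
    then show ?case using assms(2) function_span_zero by simp
  next
    case (Suc m)
    then show ?case
      using step[of "\<lambda>x. \<Sum>i<m. k i * g i x" "g m" "k m"] g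
        function_span_add_scaled[of "\<lambda>x. \<Sum>i<m. k i * g i x" B "g m" "k m"] by simp
  qed
  from this[of n] show ?thesis using f by simp
qed

lemma function_span_base: "b \<in> B \<Longrightarrow> b \<in> function_span B"
  using function_span_add_scaled[OF function_span_zero, of b B 1] by simp

lemma function_span_add:
  assumes "f \<in> function_span B" "g \<in> function_span B"
  shows "(\<lambda>x. f x + g x) \<in> function_span B"
  using assms(2)
proof (induction rule: function_span_induct)
  case zero
  then show ?case using assms(1) by simp
next
  case (add_scaled g c b)
  then show ?case using function_span_add_scaled[of "\<lambda>x. f x + g x" B b c] by (simp add: add.assoc)
qed

lemma function_span_scale:
  assumes "f \<in> function_span B"
  shows "(\<lambda>x. a * f x) \<in> function_span B"
  using assms
proof (induction rule: function_span_induct)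
  case zero
  then show ?case using function_span_zero by simp
next
  case (add_scaled g c b)
  then show ?case
    using function_span_add_scaled[of "\<lambda>x. a * g x" B b "a * c"] by (simp add: algebra_simps)
qed

lemma function_span_sum:
  assumes "finite I" "\<And>i. i \<in> I \<Longrightarrow> f i \<in> function_span B"
  shows "(\<lambda>x. \<Sum>i\<in>I. f i x) \<in> function_span B"
  using assms by (induction I) (auto intro: function_span_zero function_span_add)

lemma linear_functional_unique:
  assumes I: "linear_functional (function_span B) I" and J: "linear_functional (function_span B) J"
    and eq: "\<And>b. b \<in> B \<Longrightarrow> I b = J b" and "f \<in> function_span B"
  shows "I f = J f"
  using assms(4)
proof (induction rule: function_span_induct)
  case zero
  have 0: "K (\<lambda>x. 0) = 0" if K: "linear_functional (function_span B) K" for K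
  proof -
    have "\<forall>f\<in>function_span B. \<forall>c. K (\<lambda>x. c * f x) = c * K f"
      using K unfolding linear_functional_def by simp
    from this[rule_format, OF function_span_zero, of 0] show ?thesis by simp
  qed
  show ?case using 0[OF I] 0[OF J] by simp
next
  case (add_scaled f c b)
  have lin: "K (\<lambda>x. f x + c * b x) = K f + c * K b" if K: "linear_functional (function_span B) K" for K
  proof -
    have "\<forall>f\<in>function_span B. \<forall>g\<in>function_span B. K (\<lambda>x. f x + g x) = K f + K g"
      "\<forall>f\<in>function_span B. \<forall>c. K (\<lambda>x. c * f x) = c * K f"
      using K unfolding linear_functional_def by simp_all
    then show ?thesis
      using add_scaled.hyps(1) function_span_base[OF add_scaled.hyps(2)]
        function_span_scale[OF function_span_base[OF add_scaled.hyps(2)], of c] by simp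
  qed
  show ?case using lin[OF I] lin[OF J] add_scaled.IH eq[OF add_scaled.hyps(2)] by simp
qed

context ring_measure_space
begin

lemma integral_finite_set:
  assumes "A \<in> finite_sets \<SS> \<mu>"
  shows "integrable M (indicator A :: 'a \<Rightarrow> real)" "integral\<^sup>L M (indicator A) = enn2real (\<mu> A)"
proof -
  have A: "A \<in> \<SS>" "\<mu> A < \<infinity>" using assms by (auto simp: finite_sets_def)
  then show "integrable M (indicator A :: 'a \<Rightarrow> real)" by (simp add: integrable_indicator_ring)
  show "integral\<^sup>L M (indicator A) = enn2real (\<mu> A)"
    using A sets_into_space[of A] by (simp add: Int_absorb2 measure_def)
qed

lemma integrable_elementary: "f \<in> elementary \<SS> \<mu> \<Longrightarrow> integrable M f"
  unfolding elementary_def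
proof (induction rule: function_span_induct)
  case (add_scaled f c b)
  then show ?case using integral_finite_set(1) by auto
qed simp

lemma elementary_functional_eq:
  assumes "f \<in> elementary \<SS> \<mu>"
  shows "elementary_functional \<SS> \<mu> f = integral\<^sup>L M f"
proof -
  have lin: "linear_functional (elementary \<SS> \<mu>) (integral\<^sup>L M)"
    unfolding linear_functional_def by (simp add: integrable_elementary)
  have "I f = integral\<^sup>L M f"
    if "linear_functional (elementary \<SS> \<mu>) I" "\<forall>A\<in>finite_sets \<SS> \<mu>. I (indicator A) = enn2real (\<mu> A)" for I
    by (rule linear_functional_unique[OF that(1)[unfolded elementary_def] lin[unfolded elementary_def] _
          assms[unfolded elementary_def]])
      (use that(2) integral_finite_set(2) in auto)
  then show ?thesis
    unfolding elementary_functional_def using lin integral_finite_set(2)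
    by (intro the_equality) blast+
qed

end

context ring_measure_pair
begin

abbreviation "L \<equiv> elementary_prod \<SS> \<mu> \<TT> \<nu>"

lemma finite_times:
  assumes "A \<in> finite_sets \<SS> \<mu>" "B \<in> finite_sets \<TT> \<nu>"
  shows "A \<times> B \<in> finite_sets \<RR> \<mu>\<nu>"
    and "\<mu>\<nu> (A \<times> B) = \<mu> A * \<nu> B"
proof -
  have AB: "A \<in> \<SS>" "B \<in> \<TT>" "A \<in> \<SS>\<^sub>\<sigma>" "B \<in> \<TT>\<^sub>\<sigma>" "\<mu> A < \<infinity>" "\<nu> B < \<infinity>"
    using assms left.finite_sets_subset_sigma_finite_sets right.finite_sets_subset_sigma_finite_sets
    by (auto simp: finite_sets_def)
  show eq: "\<mu>\<nu> (A \<times> B) = \<mu> A * \<nu> B"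
    using AB by (simp add: product_measure_eq section_measure_times times_in_ring_prod)
  show "A \<times> B \<in> finite_sets \<RR> \<mu>\<nu>"
    using AB by (simp add: finite_sets_def eq times_in_ring_prod ennreal_mult_less_top)
qed

text \<open>Sections are taken at all points of the type, also outside \<open>S\<close>, so the induction has to carry along
  that every section is elementary and that the inner integrals are elementary in the other variable.\<close>

lemma elementary_prod_functional_eq:
  assumes "f \<in> L"
  shows "integrable MN f" and "elementary_prod_functional \<SS> \<mu> \<TT> \<nu> f = integral\<^sup>L MN f"
proof -
  have "(\<forall>s. (\<lambda>t. f (s, t)) \<in> elementary \<TT> \<nu>) \<and> (\<lambda>s. \<integral>t. f (s, t) \<partial>N) \<in> elementary \<SS> \<mu> \<and>
      integrable MN f \<and> (\<integral>s. \<integral>t. f (s, t) \<partial>N \<partial>M) = integral\<^sup>L MN f"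
    using assms unfolding elementary_prod_def
  proof (induction rule: function_span_induct)
    case zero
    then show ?case by (simp add: elementary_def function_span_zero)
  next
    case (add_scaled f c b)
    then obtain A B where b: "b = indicator (A \<times> B)" and AB: "A \<in> finite_sets \<SS> \<mu>" "B \<in> finite_sets \<TT> \<nu>"
      by blast
    have b_eq: "b (s, t) = indicator A s * indicator B t" for s t
      by (simp add: b indicator_times)
    have sec: "(\<lambda>t. f (s, t) + c * b (s, t)) \<in> elementary \<TT> \<nu>" for s
    proof -
      have "(\<lambda>t. f (s, t) + (c * indicator A s) * indicator B t) \<in> elementary \<TT> \<nu>"
        using add_scaled.IH AB(2) unfolding elementary_def by (intro function_span_add_scaled) auto
      then show ?thesis by (simp add: b_eq mult.assoc)
    qed
    have inner: "(\<integral>t. f (s, t) + c * b (s, t) \<partial>N) =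
        (\<integral>t. f (s, t) \<partial>N) + (c * enn2real (\<nu> B)) * indicator A s" for s
    proof -
      have "(\<integral>t. f (s, t) + c * b (s, t) \<partial>N) = (\<integral>t. f (s, t) + (c * indicator A s) * indicator B t \<partial>N)"
        by (simp add: b_eq mult.assoc)
      also have "\<dots> = (\<integral>t. f (s, t) \<partial>N) + (\<integral>t. (c * indicator A s) * indicator B t \<partial>N)"
        using add_scaled.IH right.integral_finite_set(1)[OF AB(2)]
        by (intro Bochner_Integration.integral_add) (auto simp: right.integrable_elementary)
      also have "(\<integral>t. (c * indicator A s) * indicator B t \<partial>N) = (c * indicator A s) * enn2real (\<nu> B)"
        by (subst integral_mult_right_zero) (simp only: right.integral_finite_set(2)[OF AB(2)])
      finally show ?thesis by (simp add: mult.commute mult.left_commute)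
    qed
    have el: "(\<lambda>s. (\<integral>t. f (s, t) \<partial>N) + (c * enn2real (\<nu> B)) * indicator A s) \<in> elementary \<SS> \<mu>"
      using add_scaled.IH AB(1) unfolding elementary_def by (intro function_span_add_scaled) auto
    note fin = finite_times[OF AB]
    note int_b = product.integral_finite_set[OF fin(1), folded b]
    have "(\<integral>s. (\<integral>t. f (s, t) \<partial>N) + (c * enn2real (\<nu> B)) * indicator A s \<partial>M) =
        (\<integral>s. \<integral>t. f (s, t) \<partial>N \<partial>M) + (\<integral>s. (c * enn2real (\<nu> B)) * indicator A s \<partial>M)"
      using add_scaled.IH left.integral_finite_set(1)[OF AB(1)]
      by (intro Bochner_Integration.integral_add) (auto simp: left.integrable_elementary)
    also have "(\<integral>s. (c * enn2real (\<nu> B)) * indicator A s \<partial>M) = (c * enn2real (\<nu> B)) * enn2real (\<mu> A)"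
      by (subst integral_mult_right_zero) (simp only: left.integral_finite_set(2)[OF AB(1)])
    also have "\<dots> = c * integral\<^sup>L MN b"
      by (simp only: int_b(2) fin(2) enn2real_mult mult.assoc mult.commute mult.left_commute)
    also have "(\<integral>s. \<integral>t. f (s, t) \<partial>N \<partial>M) + c * integral\<^sup>L MN b = (\<integral>x. f x + c * b x \<partial>MN)"
      using add_scaled.IH int_b(1) by simp
    finally show ?case using sec inner el add_scaled.IH int_b(1) by simp
  qed
  then show "integrable MN f" "elementary_prod_functional \<SS> \<mu> \<TT> \<nu> f = integral\<^sup>L MN f"
    unfolding elementary_prod_functional_def
    by (auto simp: right.elementary_functional_eq left.elementary_functional_eq)
qed

end

context ring_measure_space
begin

lemma finite_sets_INT_diff_UN:
  assumes "finite K" "I \<subseteq> K" "I \<noteq> {}" "\<And>i. i \<in> K \<Longrightarrow> A i \<in> finite_sets \<SS> \<mu>"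
  shows "(\<Inter>i\<in>I. A i) - (\<Union>i\<in>K - I. A i) \<in> finite_sets \<SS> \<mu>"
proof -
  obtain i where i: "i \<in> I" using assms(3) by blast
  have A: "A j \<in> \<SS>" if "j \<in> K" for j using assms(4)[OF that] by (simp add: finite_sets_def)
  have "(\<Inter>i\<in>I. A i) \<in> \<SS>"
    using assms A by (intro ring.finite_INT) (auto intro: finite_subset)
  moreover have "(\<Union>i\<in>K - I. A i) \<in> \<SS>"
    using assms A by (intro ring.finite_UN) auto
  ultimately have "((\<Inter>i\<in>I. A i) - (\<Union>i\<in>K - I. A i)) \<inter> A i \<in> finite_sets \<SS> \<mu>"
    using assms(2,4) i by (intro finite_sets_Int ring_subset_sets_M Diff) auto
  moreover have "((\<Inter>i\<in>I. A i) - (\<Union>i\<in>K - I. A i)) \<inter> A i = (\<Inter>i\<in>I. A i) - (\<Union>i\<in>K - I. A i)"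
    using i by auto
  ultimately show ?thesis by simp
qed

end

context ring_measure_pair
begin

text \<open>A combination of rectangles \<open>A i \<times> B i\<close> is constant on the products of the atoms generated by the
  \<open>A i\<close> with those generated by the \<open>B i\<close>, namely equal to the sum of the coefficients whose index
  belongs to both atoms. So the positive part only changes the coefficients of these products. Atoms
  outside all \<open>A i\<close> may have infinite measure, but there the function vanishes.\<close>

lemma elementary_prod_max_0:
  assumes "f \<in> L"
  shows "(\<lambda>x. max 0 (f x)) \<in> L"
proof -
  define G where "G = {indicator (A \<times> B) :: 'a \<times> 'b \<Rightarrow> real |A B. A \<in> finite_sets \<SS> \<mu> \<and> B \<in> finite_sets \<TT> \<nu>}"
  have L: "L = function_span G" by (simp add: elementary_prod_def G_def)
  obtain n :: nat and c g where f: "f = (\<lambda>x. \<Sum>i<n. c i * g i x)" and g: "\<forall>i<n. g i \<in> G"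
    using assms unfolding L function_span_def by blast
  have "\<exists>A B. g i = indicator (A \<times> B) \<and> A \<in> finite_sets \<SS> \<mu> \<and> B \<in> finite_sets \<TT> \<nu>" if "i < n" for i
    using g that unfolding G_def by blast
  then obtain A B where AB: "\<And>i. i < n \<Longrightarrow> g i = indicator (A i \<times> B i)"
      "\<And>i. i < n \<Longrightarrow> A i \<in> finite_sets \<SS> \<mu>" "\<And>i. i < n \<Longrightarrow> B i \<in> finite_sets \<TT> \<nu>"
    by metis
  define K where "K = Pow {..<n} - {{}}"
  define a where "a I = (\<Inter>i\<in>I. A i) - (\<Union>i\<in>{..<n} - I. A i)" for I
  define b where "b I = (\<Inter>i\<in>I. B i) - (\<Union>i\<in>{..<n} - I. B i)" for I
  define \<phi> where "\<phi> p = max 0 (\<Sum>i\<in>fst p \<inter> snd p. c i)" for p :: "nat set \<times> nat set"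
  have G: "indicator (a I \<times> b J) \<in> G" if "I \<in> K" "J \<in> K" for I J
  proof -
    have "a I \<in> finite_sets \<SS> \<mu>" unfolding a_def
      by (rule left.finite_sets_INT_diff_UN) (use that AB in \<open>auto simp: K_def\<close>)
    moreover have "b J \<in> finite_sets \<TT> \<nu>" unfolding b_def
      by (rule right.finite_sets_INT_diff_UN) (use that AB in \<open>auto simp: K_def\<close>)
    ultimately show ?thesis unfolding G_def by blast
  qed
  have eq: "max 0 (f (s, t)) = (\<Sum>p\<in>K \<times> K. \<phi> p * indicator (a (fst p) \<times> b (snd p)) (s, t))" for s t
  proof -
    define I where "I = {i\<in>{..<n}. s \<in> A i}"
    define J where "J = {i\<in>{..<n}. t \<in> B i}"
    have "f (s, t) = (\<Sum>i<n. if i \<in> I \<inter> J then c i else 0)"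
      unfolding f by (intro sum.cong) (auto simp: AB I_def J_def indicator_def)
    also have "\<dots> = (\<Sum>i\<in>I \<inter> J. c i)"
      by (subst sum.inter_restrict[symmetric]) (auto intro!: sum.cong simp: I_def)
    finally have f_eq: "max 0 (f (s, t)) = \<phi> (I, J)" by (simp add: \<phi>_def)
    have "indicator (a (fst p) \<times> b (snd p)) (s, t) = (if p = (I, J) then 1 else (0::real))" if "p \<in> K \<times> K" for p
    proof -
      have "s \<in> a I' \<longleftrightarrow> I' = I" if "I' \<in> K" for I'
        using that by (auto simp: a_def I_def K_def)
      moreover have "t \<in> b J' \<longleftrightarrow> J' = J" if "J' \<in> K" for J'
        using that by (auto simp: b_def J_def K_def)
      ultimately show ?thesis using that by (cases p) (auto simp: indicator_def)
    qed
    then have "(\<Sum>p\<in>K \<times> K. \<phi> p * indicator (a (fst p) \<times> b (snd p)) (s, t)) =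
        (\<Sum>p\<in>K \<times> K. if p = (I, J) then \<phi> p else 0)"
      by (intro sum.cong) auto
    also have "\<dots> = (if (I, J) \<in> K \<times> K then \<phi> (I, J) else 0)"
      by (intro sum.delta) (simp add: K_def)
    also have "\<dots> = \<phi> (I, J)"
    proof (cases "I = {} \<or> J = {}")
      case True
      then have "I \<inter> J = {}" by auto
      then show ?thesis by (simp add: \<phi>_def)
    qed (auto simp: K_def I_def J_def)
    finally show ?thesis using f_eq by simp
  qed
  have "(\<lambda>x. \<Sum>p\<in>K \<times> K. \<phi> p * indicator (a (fst p) \<times> b (snd p)) x) \<in> L"
    unfolding L by (intro function_span_sum function_span_scale function_span_base) (auto simp: K_def intro!: G)
  moreover have "(\<lambda>x. max 0 (f x)) = (\<lambda>x. \<Sum>p\<in>K \<times> K. \<phi> p * indicator (a (fst p) \<times> b (snd p)) x)"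
  proof
    fix x
    show "max 0 (f x) = (\<Sum>p\<in>K \<times> K. \<phi> p * indicator (a (fst p) \<times> b (snd p)) x)"
      using eq[of "fst x" "snd x"] by (simp only: prod.collapse)
  qed
  ultimately show ?thesis by simp
qed

end

section \<open>The Daniell--Stone integral\<close>

context ring_measure_space
begin

text \<open>The functions \<open>min (G x) (F n x)\<close> increase to \<open>G\<close>, and their integrals are at most those of
  \<open>F n\<close>. All comparisons between limits of increasing sequences reduce to this.\<close>

lemma integral_le_of_le_limit:
  fixes F :: "nat \<Rightarrow> 'a \<Rightarrow> real"
  assumes F: "\<And>n. integrable M (F n)" "\<And>x. x \<in> S \<Longrightarrow> incseq (\<lambda>n. F n x)"
    and G: "integrable M G" and GF: "\<And>x c. x \<in> S \<Longrightarrow> c < G x \<Longrightarrow> \<exists>n. c < F n x"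
    and C: "\<And>n. integral\<^sup>L M (F n) \<le> C"
  shows "integral\<^sup>L M G \<le> C"
proof -
  let ?H = "\<lambda>n x. min (G x) (F n x)"
  have int: "integrable M (?H n)" for n using G F(1) by (rule integrable_min)
  have "incseq (\<lambda>n. ?H n x)" if "x \<in> S" for x
    unfolding incseq_def by (intro allI impI min.mono order_refl incseqD[OF F(2)[OF that]])
  moreover have "(\<lambda>n. ?H n x) \<longlonglongrightarrow> G x" if x: "x \<in> S" for x
  proof (rule order_tendstoI)
    fix c assume "c < G x"
    then obtain n where n: "c < F n x" using GF[OF x] by blast
    have "c < ?H m x" if "n \<le> m" for m
      using n \<open>c < G x\<close> incseqD[OF F(2)[OF x] that] by auto
    then show "\<forall>\<^sub>F n in sequentially. c < ?H n x" by (auto simp: eventually_sequentially)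
  qed (auto simp: min_less_iff_disj)
  moreover have "integral\<^sup>L M (?H n) \<le> integral\<^sup>L M G" for n
    by (intro integral_mono int G) simp
  then have "bdd_above (range (\<lambda>n. integral\<^sup>L M (?H n)))" by (intro bdd_aboveI2)
  ultimately have lim: "(\<lambda>n. integral\<^sup>L M (?H n)) \<longlonglongrightarrow> integral\<^sup>L M G"
    using int by (intro integrable_monotone_convergence_space(2)[of ?H])
  have "integral\<^sup>L M (?H n) \<le> C" for n
  proof -
    have "integral\<^sup>L M (?H n) \<le> integral\<^sup>L M (F n)" by (intro integral_mono int F(1)) simp
    also have "\<dots> \<le> C" by (rule C)
    finally show ?thesis .
  qed
  then show ?thesis using LIMSEQ_le_const2[OF lim] by blast
qed

text \<open>The limit of \<open>F n - F 0\<close> has a finite integral by monotone convergence, and \<open>g\<close> is bounded by this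
  limit plus \<open>\<bar>F 0\<bar>\<close>.\<close>

lemma nn_integral_finite_of_le_limit:
  fixes F :: "nat \<Rightarrow> 'a \<Rightarrow> real" and g :: "'a \<Rightarrow> real"
  assumes F: "\<And>n. integrable M (F n)" "\<And>x. x \<in> S \<Longrightarrow> incseq (\<lambda>n. F n x)"
    and g: "g \<in> borel_measurable M" and h: "\<And>x. x \<in> S \<Longrightarrow> (\<lambda>n. ereal (F n x)) \<longlonglongrightarrow> h x"
    and gh: "\<And>x. x \<in> S \<Longrightarrow> ereal (g x) \<le> h x" and C: "\<And>n. integral\<^sup>L M (F n) \<le> C"
  shows "(\<integral>\<^sup>+x. ennreal (g x) \<partial>M) < \<infinity>"
proof -
  let ?D = "\<lambda>n x. F n x - F 0 x"
  have D: "integrable M (?D n)" for n using F(1) by auto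
  have D_nonneg: "0 \<le> ?D n x" if "x \<in> S" for n x using incseqD[OF F(2)[OF that], of 0 n] by simp
  have le: "ennreal (g x) \<le> (SUP n. ennreal (?D n x)) + ennreal \<bar>F 0 x\<bar>" if x: "x \<in> S" for x
  proof (cases "SUP n. ennreal (?D n x)")
    case (real r)
    have "?D n x \<le> r" for n
    proof -
      have "ennreal (?D n x) \<le> ennreal r" unfolding real(2)[symmetric] by (rule SUP_upper) simp
      then show ?thesis using real(1) D_nonneg[OF x] by (simp add: ennreal_le_iff)
    qed
    then have "ereal (F n x) \<le> ereal (r + F 0 x)" for n by (simp add: algebra_simps)
    then have "h x \<le> ereal (r + F 0 x)" by (intro LIMSEQ_le_const2[OF h[OF x]]) auto
    then have "g x \<le> r + \<bar>F 0 x\<bar>" using gh[OF x] order_trans[of "ereal (g x)"] by fastforce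
    then show ?thesis using real by (simp flip: ennreal_plus add: ennreal_leI)
  next
    case top
    show ?thesis unfolding top by simp
  qed
  have "(\<integral>\<^sup>+x. ennreal (g x) \<partial>M) \<le> (\<integral>\<^sup>+x. (SUP n. ennreal (?D n x)) + ennreal \<bar>F 0 x\<bar> \<partial>M)"
    using le by (intro nn_integral_mono) simp
  also have "\<dots> = (\<integral>\<^sup>+x. (SUP n. ennreal (?D n x)) \<partial>M) + (\<integral>\<^sup>+x. ennreal \<bar>F 0 x\<bar> \<partial>M)"
    using F(1) by (intro nn_integral_add) auto
  also have "(\<integral>\<^sup>+x. (SUP n. ennreal (?D n x)) \<partial>M) = (SUP n. \<integral>\<^sup>+x. ennreal (?D n x) \<partial>M)"
  proof (rule nn_integral_monotone_convergence_SUP_AE)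
    show "AE x in M. ennreal (?D i x) \<le> ennreal (?D (Suc i) x)" for i
      using incseq_SucD[OF F(2)] by (auto intro!: AE_I2 ennreal_leI)
  qed (use F(1) in auto)
  also have "\<dots> \<le> ennreal (C - integral\<^sup>L M (F 0))"
  proof (rule SUP_least)
    fix n
    have "(\<integral>\<^sup>+x. ennreal (?D n x) \<partial>M) = ennreal (integral\<^sup>L M (?D n))"
      using D D_nonneg by (intro nn_integral_eq_integral AE_I2) auto
    also have "integral\<^sup>L M (?D n) = integral\<^sup>L M (F n) - integral\<^sup>L M (F 0)"
      by (intro Bochner_Integration.integral_diff F(1))
    also have "ennreal \<dots> \<le> ennreal (C - integral\<^sup>L M (F 0))" using C[of n] by (intro ennreal_leI) simp
    finally show "(\<integral>\<^sup>+x. ennreal (?D n x) \<partial>M) \<le> ennreal (C - integral\<^sup>L M (F 0))" .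
  qed
  also have "ennreal (C - integral\<^sup>L M (F 0)) + (\<integral>\<^sup>+x. ennreal \<bar>F 0 x\<bar> \<partial>M) < \<infinity>"
    using F(1)[of 0] by (auto simp: integrable_iff_bounded)
  finally show ?thesis by simp
qed

end

context ring_measure_pair
begin

text \<open>A limit \<open>h\<close> of an increasing sequence of elementary functions is represented by the sequence
  itself: \<open>h \<ge> f\<close> says that the sequence eventually exceeds every number below \<open>f x\<close>, and the integral
  of \<open>h\<close> is the supremum of the integrals of the sequence.\<close>

definition upper_approximable :: "('a \<times> 'b \<Rightarrow> real) \<Rightarrow> bool" where
  "upper_approximable f \<longleftrightarrow> (\<forall>\<epsilon>>0. \<exists>F. (\<forall>n::nat. F n \<in> L) \<and> (\<forall>x\<in>S \<times> T. incseq (\<lambda>n. F n x)) \<and>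
     (\<forall>n. integral\<^sup>L MN (F n) \<le> integral\<^sup>L MN f + \<epsilon>) \<and> (\<forall>x\<in>S \<times> T. \<forall>c<f x. \<exists>n. c < F n x))"

lemma upper_approximableE:
  assumes "upper_approximable f" "0 < \<epsilon>"
  obtains F where "\<And>n::nat. F n \<in> L" "\<And>x. x \<in> S \<times> T \<Longrightarrow> incseq (\<lambda>n. F n x)"
    "\<And>n. integral\<^sup>L MN (F n) \<le> integral\<^sup>L MN f + \<epsilon>"
    "\<And>x c. x \<in> S \<times> T \<Longrightarrow> c < f x \<Longrightarrow> \<exists>n. c < F n x"
proof -
  from assms obtain F where "(\<forall>n::nat. F n \<in> L) \<and> (\<forall>x\<in>S \<times> T. incseq (\<lambda>n. F n x)) \<and>
     (\<forall>n. integral\<^sup>L MN (F n) \<le> integral\<^sup>L MN f + \<epsilon>) \<and> (\<forall>x\<in>S \<times> T. \<forall>c<f x. \<exists>n. c < F n x)"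
    unfolding upper_approximable_def by meson
  then show thesis by (intro that[of F]) blast+
qed

lemma upper_approximableI:
  assumes "\<And>\<epsilon>. 0 < \<epsilon> \<Longrightarrow> \<exists>F. (\<forall>n::nat. F n \<in> L) \<and> (\<forall>x\<in>S \<times> T. incseq (\<lambda>n. F n x)) \<and>
     (\<forall>n. integral\<^sup>L MN (F n) \<le> integral\<^sup>L MN f + \<epsilon>) \<and> (\<forall>x\<in>S \<times> T. \<forall>c<f x. \<exists>n. c < F n x)"
  shows "upper_approximable f"
  unfolding upper_approximable_def using assms by blast

lemma L_add: "f \<in> L \<Longrightarrow> g \<in> L \<Longrightarrow> (\<lambda>x. f x + g x) \<in> L"
  unfolding elementary_prod_def by (rule function_span_add)

lemma L_scale: "f \<in> L \<Longrightarrow> (\<lambda>x. c * f x) \<in> L"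
  unfolding elementary_prod_def by (rule function_span_scale)

lemma L_sum: "finite I \<Longrightarrow> (\<And>i. i \<in> I \<Longrightarrow> f i \<in> L) \<Longrightarrow> (\<lambda>x. \<Sum>i\<in>I. f i x) \<in> L"
  unfolding elementary_prod_def by (rule function_span_sum)

lemma upper_approximable_L: "f \<in> L \<Longrightarrow> upper_approximable f"
  by (intro upper_approximableI exI[of _ "\<lambda>_. f"]) (auto simp: incseq_def)

lemma upper_approximable_add:
  assumes f: "integrable MN f" "upper_approximable f" and g: "integrable MN g" "upper_approximable g"
  shows "upper_approximable (\<lambda>x. f x + g x)"
proof (rule upper_approximableI)
  fix \<epsilon> :: real assume "0 < \<epsilon>"
  then have \<epsilon>: "0 < \<epsilon> / 2" by simp
  obtain F where F: "\<And>n::nat. F n \<in> L" "\<And>x. x \<in> S \<times> T \<Longrightarrow> incseq (\<lambda>n. F n x)"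
    "\<And>n. integral\<^sup>L MN (F n) \<le> integral\<^sup>L MN f + \<epsilon> / 2"
    "\<And>x c. x \<in> S \<times> T \<Longrightarrow> c < f x \<Longrightarrow> \<exists>n. c < F n x"
    using upper_approximableE[OF f(2) \<epsilon>] by metis
  obtain G where G: "\<And>n::nat. G n \<in> L" "\<And>x. x \<in> S \<times> T \<Longrightarrow> incseq (\<lambda>n. G n x)"
    "\<And>n. integral\<^sup>L MN (G n) \<le> integral\<^sup>L MN g + \<epsilon> / 2"
    "\<And>x c. x \<in> S \<times> T \<Longrightarrow> c < g x \<Longrightarrow> \<exists>n. c < G n x"
    using upper_approximableE[OF g(2) \<epsilon>] by metis
  let ?H = "\<lambda>n x. F n x + G n x"
  have "incseq (\<lambda>n. ?H n x)" if "x \<in> S \<times> T" for x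
    using F(2)[OF that] G(2)[OF that] by (auto simp: incseq_def intro!: add_mono)
  moreover have "integral\<^sup>L MN (?H n) \<le> (\<integral>x. f x + g x \<partial>MN) + \<epsilon>" for n
    using F(3)[of n] G(3)[of n] f(1) g(1) elementary_prod_functional_eq(1)[OF F(1)]
      elementary_prod_functional_eq(1)[OF G(1)] by simp
  moreover have "\<exists>n. c < ?H n x" if x: "x \<in> S \<times> T" and c: "c < f x + g x" for x c
  proof -
    define d where "d = (f x + g x - c) / 2"
    have "0 < d" using c by (simp add: d_def)
    then obtain m n where mn: "f x - d < F m x" "g x - d < G n x"
      using F(4)[OF x, of "f x - d"] G(4)[OF x, of "g x - d"] by auto
    have "F m x \<le> F (max m n) x" "G n x \<le> G (max m n) x"
      using incseqD[OF F(2)[OF x]] incseqD[OF G(2)[OF x]] by auto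
    with mn have "c < ?H (max m n) x" by (simp add: d_def field_simps)
    then show ?thesis by blast
  qed
  ultimately show "\<exists>H. (\<forall>n::nat. H n \<in> L) \<and> (\<forall>x\<in>S \<times> T. incseq (\<lambda>n. H n x)) \<and>
     (\<forall>n. integral\<^sup>L MN (H n) \<le> (\<integral>x. f x + g x \<partial>MN) + \<epsilon>) \<and> (\<forall>x\<in>S \<times> T. \<forall>c<f x + g x. \<exists>n. c < H n x)"
    using L_add[OF F(1) G(1)] by (intro exI[of _ ?H]) blast
qed

lemma upper_approximable_scale:
  assumes f: "upper_approximable f" and a: "0 \<le> a"
  shows "upper_approximable (\<lambda>x. a * f x)"
proof (cases "a = 0")
  case True
  have "(\<lambda>x. 0) \<in> L" unfolding elementary_prod_def by (rule function_span_zero)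
  then show ?thesis using True by (simp add: upper_approximable_L)
next
  case False
  with a have a: "0 < a" by simp
  show ?thesis
  proof (rule upper_approximableI)
    fix \<epsilon> :: real assume "0 < \<epsilon>"
    then have \<epsilon>: "0 < \<epsilon> / a" using a by simp
    obtain F where F: "\<And>n::nat. F n \<in> L" "\<And>x. x \<in> S \<times> T \<Longrightarrow> incseq (\<lambda>n. F n x)"
      "\<And>n. integral\<^sup>L MN (F n) \<le> integral\<^sup>L MN f + \<epsilon> / a"
      "\<And>x c. x \<in> S \<times> T \<Longrightarrow> c < f x \<Longrightarrow> \<exists>n. c < F n x"
      using upper_approximableE[OF f \<epsilon>] by metis
    let ?H = "\<lambda>n x. a * F n x"
    have "incseq (\<lambda>n. ?H n x)" if "x \<in> S \<times> T" for x
      using F(2)[OF that] a by (auto simp: incseq_def)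
    moreover have "integral\<^sup>L MN (?H n) \<le> (\<integral>x. a * f x \<partial>MN) + \<epsilon>" for n
    proof -
      have "a * integral\<^sup>L MN (F n) \<le> a * (integral\<^sup>L MN f + \<epsilon> / a)"
        using F(3)[of n] a by (intro mult_left_mono) auto
      then show ?thesis using a by (simp add: distrib_left)
    qed
    moreover have "\<exists>n. c < ?H n x" if x: "x \<in> S \<times> T" and c: "c < a * f x" for x c
    proof -
      have "c / a < f x" using c a by (simp add: field_simps)
      then obtain n where "c / a < F n x" using F(4)[OF x] by blast
      then have "c < ?H n x" using a by (simp add: field_simps)
      then show ?thesis by blast
    qed
    ultimately show "\<exists>H. (\<forall>n::nat. H n \<in> L) \<and> (\<forall>x\<in>S \<times> T. incseq (\<lambda>n. H n x)) \<and>
       (\<forall>n. integral\<^sup>L MN (H n) \<le> (\<integral>x. a * f x \<partial>MN) + \<epsilon>) \<and> (\<forall>x\<in>S \<times> T. \<forall>c<a * f x. \<exists>n. c < H n x)"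
      using L_scale[OF F(1)] by (intro exI[of _ ?H]) blast
  qed
qed

text \<open>The positive parts have the same limit as the approximating sequence, because that limit is
  already nonnegative; so their integrals obey the same bound.\<close>

lemma upper_approximable_nonnegE:
  assumes f: "integrable MN f" "upper_approximable f" "\<And>x. x \<in> S \<times> T \<Longrightarrow> 0 \<le> f x" and \<epsilon>: "0 < \<epsilon>"
  obtains F where "\<And>n::nat. F n \<in> L" "\<And>n x. 0 \<le> F n x" "\<And>x. x \<in> S \<times> T \<Longrightarrow> incseq (\<lambda>n. F n x)"
    "\<And>n. integral\<^sup>L MN (F n) \<le> integral\<^sup>L MN f + \<epsilon>"
    "\<And>x c. x \<in> S \<times> T \<Longrightarrow> c < f x \<Longrightarrow> \<exists>n. c < F n x"
proof -
  obtain F where F: "\<And>n::nat. F n \<in> L" "\<And>x. x \<in> S \<times> T \<Longrightarrow> incseq (\<lambda>n. F n x)"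
    "\<And>n. integral\<^sup>L MN (F n) \<le> integral\<^sup>L MN f + \<epsilon>"
    "\<And>x c. x \<in> S \<times> T \<Longrightarrow> c < f x \<Longrightarrow> \<exists>n. c < F n x"
    using upper_approximableE[OF f(2) \<epsilon>] by metis
  let ?H = "\<lambda>n x. max 0 (F n x)"
  have H: "?H n \<in> L" for n using F(1) by (rule elementary_prod_max_0)
  show thesis
  proof (rule that)
    show "incseq (\<lambda>n. ?H n x)" if "x \<in> S \<times> T" for x
      unfolding incseq_def by (intro allI impI max.mono order_refl incseqD[OF F(2)[OF that]])
    show "integral\<^sup>L MN (?H n) \<le> integral\<^sup>L MN f + \<epsilon>" for n
    proof (rule product.integral_le_of_le_limit[of F])
      show "\<exists>m. c < F m x" if x: "x \<in> S \<times> T" and c: "c < ?H n x" for x c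
        using c F(4)[OF x] f(3)[OF x] by (force simp: less_max_iff_disj)
    qed (use F H elementary_prod_functional_eq(1) in auto)
    show "\<exists>n. c < ?H n x" if "x \<in> S \<times> T" "c < f x" for x c
      using F(4)[OF that] by (auto simp: less_max_iff_disj)
  qed (use H in auto)
qed

text \<open>The \<open>n\<close>-th term is approximated up to \<open>\<epsilon> / 2 ^ (n + 1)\<close>. The \<open>k\<close>-th function of the combined sequence
  adds the \<open>k\<close>-th approximations of the first \<open>k\<close> terms; it increases with \<open>k\<close> because all
  approximations are nonnegative.\<close>

lemma upper_approximable_sums:
  fixes g :: "nat \<Rightarrow> 'a \<times> 'b \<Rightarrow> real"
  assumes g: "\<And>n. integrable MN (g n)" "\<And>n. upper_approximable (g n)" "\<And>n x. x \<in> S \<times> T \<Longrightarrow> 0 \<le> g n x"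
    and f: "integrable MN f" and sums: "\<And>x. x \<in> S \<times> T \<Longrightarrow> (\<lambda>n. g n x) sums f x"
  shows "upper_approximable f"
proof (rule upper_approximableI)
  fix \<epsilon> :: real assume \<epsilon>: "0 < \<epsilon>"
  have "\<exists>G. (\<forall>k::nat. G k \<in> L) \<and> (\<forall>k x. 0 \<le> G k x) \<and> (\<forall>x\<in>S \<times> T. incseq (\<lambda>k. G k x)) \<and>
      (\<forall>k. integral\<^sup>L MN (G k) \<le> integral\<^sup>L MN (g n) + \<epsilon> * (1 / 2) ^ Suc n) \<and>
      (\<forall>x\<in>S \<times> T. \<forall>c<g n x. \<exists>k. c < G k x)" for n
  proof -
    have "0 < \<epsilon> * (1 / 2) ^ Suc n" using \<epsilon> by simp
    from upper_approximable_nonnegE[OF g(1,2,3) this] show ?thesis by metis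
  qed
  then have "\<forall>n. \<exists>G. (\<forall>k::nat. G k \<in> L) \<and> (\<forall>k x. 0 \<le> G k x) \<and> (\<forall>x\<in>S \<times> T. incseq (\<lambda>k. G k x)) \<and>
      (\<forall>k. integral\<^sup>L MN (G k) \<le> integral\<^sup>L MN (g n) + \<epsilon> * (1 / 2) ^ Suc n) \<and>
      (\<forall>x\<in>S \<times> T. \<forall>c<g n x. \<exists>k. c < G k x)" by (rule allI)
  from choice[OF this] obtain G where
    "\<forall>n. (\<forall>k::nat. G n k \<in> L) \<and> (\<forall>k x. 0 \<le> G n k x) \<and> (\<forall>x\<in>S \<times> T. incseq (\<lambda>k. G n k x)) \<and>
      (\<forall>k. integral\<^sup>L MN (G n k) \<le> integral\<^sup>L MN (g n) + \<epsilon> * (1 / 2) ^ Suc n) \<and>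
      (\<forall>x\<in>S \<times> T. \<forall>c<g n x. \<exists>k. c < G n k x)" by (elim exE)
  then have G: "\<And>n k. G n k \<in> L" "\<And>n k x. 0 \<le> G n k x" "\<And>n x. x \<in> S \<times> T \<Longrightarrow> incseq (\<lambda>k. G n k x)"
    "\<And>n k. integral\<^sup>L MN (G n k) \<le> integral\<^sup>L MN (g n) + \<epsilon> * (1 / 2) ^ Suc n"
    "\<And>n x c. x \<in> S \<times> T \<Longrightarrow> c < g n x \<Longrightarrow> \<exists>k. c < G n k x" by blast+
  define H where "H k = (\<lambda>x. \<Sum>n<k. G n k x)" for k
  have partial: "(\<Sum>n<k. g n x) \<le> f x" if "x \<in> S \<times> T" for k x
    using sum_le_suminf[of "\<lambda>n. g n x" "{..<k}"] sums[OF that] g(3)[OF that] by (simp add: sums_iff)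
  have "H k \<in> L" for k unfolding H_def by (intro L_sum G) simp
  moreover have "incseq (\<lambda>k. H k x)" if x: "x \<in> S \<times> T" for x
  proof (rule incseq_SucI)
    fix k
    have "(\<Sum>n<k. G n k x) \<le> (\<Sum>n<k. G n (Suc k) x)"
      using incseq_SucD[OF G(3)[OF x]] by (intro sum_mono) auto
    then show "H k x \<le> H (Suc k) x" using G(2)[of k "Suc k" x] by (simp add: H_def)
  qed
  moreover have "integral\<^sup>L MN (H k) \<le> integral\<^sup>L MN f + \<epsilon>" for k
  proof -
    have "integral\<^sup>L MN (H k) = (\<Sum>n<k. integral\<^sup>L MN (G n k))"
      unfolding H_def by (intro Bochner_Integration.integral_sum elementary_prod_functional_eq(1) G)
    also have "\<dots> \<le> (\<Sum>n<k. integral\<^sup>L MN (g n) + \<epsilon> * (1 / 2) ^ Suc n)" by (intro sum_mono G)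
    also have "\<dots> = (\<integral>x. (\<Sum>n<k. g n x) \<partial>MN) + \<epsilon> * (\<Sum>n<k. (1 / 2) ^ Suc n)"
      using g(1) by (simp add: sum.distrib sum_distrib_left Bochner_Integration.integral_sum)
    also have "(\<integral>x. (\<Sum>n<k. g n x) \<partial>MN) \<le> integral\<^sup>L MN f"
      using partial g(1) f by (intro integral_mono) auto
    also have "(\<Sum>n<k. (1 / 2 :: real) ^ Suc n) \<le> 1"
      using sum_le_suminf[of "\<lambda>n. (1 / 2 :: real) ^ Suc n" "{..<k}"] power_half_series
      by (simp add: sums_iff)
    finally show ?thesis using \<epsilon> by simp
  qed
  moreover have "\<exists>k. c < H k x" if x: "x \<in> S \<times> T" and c: "c < f x" for x c
  proof -
    have "(\<lambda>m. \<Sum>n<m. g n x) \<longlonglongrightarrow> f x" using sums[OF x] by (simp add: sums_def)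
    from order_tendstoD(1)[OF this c] obtain m where m: "c < (\<Sum>n<m. g n x)"
      by (auto simp: eventually_sequentially)
    \<comment> \<open>Each of the \<open>m\<close> terms may fall short by \<open>d\<close> and the sum still exceeds \<open>c\<close>; the divisor
      \<open>m + 1\<close> also covers \<open>m = 0\<close>.\<close>
    define d where "d = ((\<Sum>n<m. g n x) - c) / (real m + 1)"
    have d: "0 < d" using m by (simp add: d_def)
    then have "\<exists>k. g n x - d < G n k x" for n using G(5)[OF x, of "g n x - d" n] by simp
    then obtain K where K: "\<And>n. g n x - d < G n (K n) x" by metis
    define k where "k = Max (insert m (K ` {..<m}))"
    have k: "m \<le> k" "\<And>n. n < m \<Longrightarrow> K n \<le> k" by (auto simp: k_def)
    have "real m * d < (\<Sum>n<m. g n x) - c"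
    proof -
      have "real m * d < (real m + 1) * d" using d by simp
      then show ?thesis by (simp add: d_def)
    qed
    then have "c < (\<Sum>n<m. g n x - d)" by (simp add: sum_subtractf)
    also have "\<dots> \<le> (\<Sum>n<m. G n k x)"
    proof (rule sum_mono)
      fix n assume "n \<in> {..<m}"
      then show "g n x - d \<le> G n k x"
        using K[of n] incseqD[OF G(3)[OF x], of "K n" k n] k by simp
    qed
    also have "\<dots> \<le> H k x" unfolding H_def using k(1) G(2) by (intro sum_mono2) auto
    finally show ?thesis by blast
  qed
  ultimately show "\<exists>F. (\<forall>n::nat. F n \<in> L) \<and> (\<forall>x\<in>S \<times> T. incseq (\<lambda>n. F n x)) \<and>
     (\<forall>n. integral\<^sup>L MN (F n) \<le> integral\<^sup>L MN f + \<epsilon>) \<and> (\<forall>x\<in>S \<times> T. \<forall>c<f x. \<exists>n. c < F n x)"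
    by (intro exI[of _ H]) blast
qed

text \<open>The second condition is approximability of \<open>f\<close> from below. Only the symmetric condition is stable
  under differences, and hence under complements of sets.\<close>

definition approximable :: "('a \<times> 'b \<Rightarrow> real) \<Rightarrow> bool" where
  "approximable f \<longleftrightarrow> integrable MN f \<and> upper_approximable f \<and> upper_approximable (\<lambda>x. - f x)"

lemma approximable_L: "f \<in> L \<Longrightarrow> approximable f"
  using L_scale[of f "- 1"] by (simp add: approximable_def upper_approximable_L elementary_prod_functional_eq(1))

lemma approximable_add: "approximable f \<Longrightarrow> approximable g \<Longrightarrow> approximable (\<lambda>x. f x + g x)"
  using upper_approximable_add[of f g] upper_approximable_add[of "\<lambda>x. - f x" "\<lambda>x. - g x"]
  by (simp add: approximable_def)

lemma approximable_scale: "approximable f \<Longrightarrow> approximable (\<lambda>x. c * f x)"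
  using upper_approximable_scale[of f c] upper_approximable_scale[of f "- c"]
    upper_approximable_scale[of "\<lambda>x. - f x" c] upper_approximable_scale[of "\<lambda>x. - f x" "- c"]
  by (cases "0 \<le> c") (simp_all add: approximable_def)

lemma approximable_diff: "approximable f \<Longrightarrow> approximable g \<Longrightarrow> approximable (\<lambda>x. f x - g x)"
  using approximable_add[of f "\<lambda>x. - 1 * g x"] approximable_scale[of g "- 1"] by simp

text \<open>From above, the limit is a series with nonnegative terms that are approximable; from below, a
  late member of the sequence suffices.\<close>

lemma approximable_mono_lim:
  fixes F :: "nat \<Rightarrow> 'a \<times> 'b \<Rightarrow> real"
  assumes F: "\<And>n. approximable (F n)" and inc: "\<And>x. x \<in> S \<times> T \<Longrightarrow> incseq (\<lambda>n. F n x)"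
    and lim: "\<And>x. x \<in> S \<times> T \<Longrightarrow> (\<lambda>n. F n x) \<longlonglongrightarrow> f x" and f: "integrable MN f"
  shows "approximable f"
proof -
  have F_int: "integrable MN (F n)" for n using F by (simp add: approximable_def)
  have le: "F n x \<le> f x" if "x \<in> S \<times> T" for n x using incseq_le[OF inc lim] that by simp
  have F_diff: "approximable (\<lambda>x. F (Suc n) x - F n x)" for n using F by (intro approximable_diff)
  have "upper_approximable (\<lambda>x. f x - F 0 x)"
  proof (rule upper_approximable_sums[of "\<lambda>n x. F (Suc n) x - F n x"])
    show "(\<lambda>n. F (Suc n) x - F n x) sums (f x - F 0 x)" if "x \<in> S \<times> T" for x
      using lim[OF that] by (rule telescope_sums)
    show "0 \<le> F (Suc n) x - F n x" if "x \<in> S \<times> T" for n x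
      using incseq_SucD[OF inc[OF that]] by simp
  qed (use F_diff f F_int in \<open>auto simp: approximable_def\<close>)
  then have "upper_approximable (\<lambda>x. F 0 x + (f x - F 0 x))"
    using F f by (intro upper_approximable_add) (auto simp: approximable_def)
  then have upper: "upper_approximable f" by simp
  have "upper_approximable (\<lambda>x. - f x)"
  proof (rule upper_approximableI)
    fix \<epsilon> :: real assume \<epsilon>: "0 < \<epsilon>"
    have "bdd_above (range (\<lambda>n. integral\<^sup>L MN (F n)))"
      using le F_int f by (intro bdd_aboveI2[of _ _ "integral\<^sup>L MN f"] integral_mono) auto
    then have "(\<lambda>n. integral\<^sup>L MN (F n)) \<longlonglongrightarrow> integral\<^sup>L MN f"
      using F_int inc lim by (intro product.integrable_monotone_convergence_space(2)) auto
    from order_tendstoD(1)[OF this, of "integral\<^sup>L MN f - \<epsilon> / 2"] \<epsilon>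
    obtain n where n: "integral\<^sup>L MN f - \<epsilon> / 2 < integral\<^sup>L MN (F n)"
      by (auto simp: eventually_sequentially)
    have "upper_approximable (\<lambda>x. - F n x)" "0 < \<epsilon> / 2" using F \<epsilon> by (auto simp: approximable_def)
    then obtain H where H: "\<And>k::nat. H k \<in> L" "\<And>x. x \<in> S \<times> T \<Longrightarrow> incseq (\<lambda>k. H k x)"
      "\<And>k. integral\<^sup>L MN (H k) \<le> integral\<^sup>L MN (\<lambda>x. - F n x) + \<epsilon> / 2"
      "\<And>x c. x \<in> S \<times> T \<Longrightarrow> c < - F n x \<Longrightarrow> \<exists>k. c < H k x"
      using upper_approximableE by metis
    have "integral\<^sup>L MN (H k) \<le> (\<integral>x. - f x \<partial>MN) + \<epsilon>" for k
      using H(3)[of k] n by simp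
    moreover have "\<exists>k. c < H k x" if x: "x \<in> S \<times> T" "c < - f x" for x c
      using H(4)[OF x(1), of c] le[OF x(1), of n] x(2) by simp
    ultimately show "\<exists>H. (\<forall>n::nat. H n \<in> L) \<and> (\<forall>x\<in>S \<times> T. incseq (\<lambda>n. H n x)) \<and>
        (\<forall>n. integral\<^sup>L MN (H n) \<le> (\<integral>x. - f x \<partial>MN) + \<epsilon>) \<and> (\<forall>x\<in>S \<times> T. \<forall>c. c < - f x \<longrightarrow> (\<exists>n. c < H n x))"
      using H(1,2) by (intro exI[of _ H]) blast
  qed
  with upper f show ?thesis by (simp add: approximable_def)
qed

lemma approximable_indicator_disjoint_UN:
  assumes E: "\<And>i::nat. approximable (indicator (E i))" "disjoint_family E"
    and int: "integrable MN (indicator (\<Union>i. E i) :: 'a \<times> 'b \<Rightarrow> real)"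
  shows "approximable (indicator (\<Union>i. E i))"
proof (rule approximable_mono_lim[OF _ _ _ int])
  show "approximable (\<lambda>x. \<Sum>i<n. indicator (E i) x)" for n
  proof (induction n)
    case 0
    have "(\<lambda>x. 0) \<in> L" unfolding elementary_prod_def by (rule function_span_zero)
    then show ?case by (simp add: approximable_L)
  next
    case (Suc n)
    then show ?case using approximable_add[OF _ E(1)[of n]] by simp
  qed
  show "incseq (\<lambda>n. \<Sum>i<n. indicator (E i) x :: real)" for x
    by (intro incseq_SucI) simp
  show "(\<lambda>n. \<Sum>i<n. indicator (E i) x) \<longlonglongrightarrow> (indicator (\<Union>i. E i) x :: real)" for x
  proof (cases "\<exists>i. x \<in> E i")
    case True
    then obtain i where i: "x \<in> E i" ..
    have "indicator (E n) x = (if n = i then 1 else 0 :: real)" for n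
      using i E(2) by (auto simp: indicator_def disjoint_family_on_def)
    then have "(\<lambda>n. indicator (E n) x :: real) sums 1" using sums_single[of i "\<lambda>_. 1 :: real"] by simp
    then show ?thesis using True by (simp add: sums_def indicator_def)
  qed simp
qed

lemma approximable_indicator_rectangle:
  assumes "A \<in> finite_sets \<SS> \<mu>" "B \<in> finite_sets \<TT> \<nu>"
  shows "approximable (indicator (A \<times> B))"
  by (rule approximable_L) (unfold elementary_prod_def, rule function_span_base, use assms in blast)

text \<open>Dynkin's argument for the intersection-stable family of the rectangles inside \<open>A \<times> B\<close>.\<close>

lemma approximable_indicator_Int_rectangle:
  assumes A: "A \<in> finite_sets \<SS> \<mu>" and B: "B \<in> finite_sets \<TT> \<nu>" and E: "E \<in> \<RR>\<^sub>\<sigma>"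
  shows "approximable (indicator (E \<inter> A \<times> B))"
proof -
  have AB: "A \<in> \<SS>\<^sub>\<sigma>" "B \<in> \<TT>\<^sub>\<sigma>"
    using A B left.finite_sets_subset_sigma_finite_sets right.finite_sets_subset_sigma_finite_sets by auto
  note fin = finite_times(1)[OF A B]
  have int: "integrable MN (indicator F :: 'a \<times> 'b \<Rightarrow> real)"
    if "F \<in> sigma_sets (A \<times> B) (finite_rectangles A B)" for F
  proof -
    have "F \<in> \<RR>\<^sub>\<sigma>"
      using that sigma_sets_finite_rectangles_subset_ring_prod[OF AB] by auto
    then have F: "F \<in> sets MN" using sigma_finite_ring_prod_subset by auto
    have "F \<subseteq> A \<times> B" by (rule sigma_sets_into_sp[OF finite_rectangles_subset_Pow that])
    then have "F \<in> finite_sets \<RR> \<mu>\<nu>"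
      using product.finite_sets_Int[OF fin F] by (simp add: Int_absorb2)
    then show ?thesis by (rule product.integral_finite_set(1))
  qed
  have "E \<inter> A \<times> B \<in> sigma_sets (A \<times> B) (finite_rectangles A B)"
    using AB E by (rule ring_prod_Int_in_sigma_sets_finite_rectangles)
  with Int_stable_finite_rectangles finite_rectangles_subset_Pow show ?thesis
  proof (induction rule: sigma_sets_induct_disjoint)
    case (basic F)
    then show ?case by (auto simp: finite_rectangles_def intro!: approximable_indicator_rectangle)
  next
    case empty
    have "(\<lambda>x. 0) \<in> L" unfolding elementary_prod_def by (rule function_span_zero)
    then show ?case by (simp add: approximable_L)
  next
    case (compl F)
    have "F \<subseteq> A \<times> B" by (rule sigma_sets_into_sp[OF finite_rectangles_subset_Pow compl(1)])
    then have "(indicator (A \<times> B - F) :: 'a \<times> 'b \<Rightarrow> real) = (\<lambda>x. indicator (A \<times> B) x - indicator F x)"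
      by (auto simp: indicator_def fun_eq_iff)
    then show ?case
      using approximable_diff[OF approximable_indicator_rectangle[OF A B] compl(2)] by simp
  next
    case (union F)
    then show ?case
      by (intro approximable_indicator_disjoint_UN int sigma_sets.Union) auto
  qed
qed

text \<open>A set of finite measure is \<open>\<sigma>\<close>-finite, hence covered by countably many rectangles with sides of finite
  measure; making these disjoint splits the set into approximable pieces.\<close>

lemma approximable_indicator:
  assumes E: "E \<in> finite_sets \<RR> \<mu>\<nu>"
  shows "approximable (indicator E)"
proof -
  have E_ring: "E \<in> \<RR>\<^sub>\<sigma>"
    using E product.finite_sets_subset_sigma_finite_sets sigma_finite_sets_product_measure by auto
  then obtain A B where AB: "A \<in> \<SS>\<^sub>\<sigma>" "B \<in> \<TT>\<^sub>\<sigma>" "E \<subseteq> A \<times> B"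
    by (rule sigma_finite.ring_prod_subset_times)
  obtain X Y where XY: "\<And>n :: nat. X n \<in> finite_sets \<SS> \<mu>" "\<And>n. Y n \<in> finite_sets \<TT> \<nu>"
    "A \<times> B = (\<Union>n. X n \<times> Y n)"
    using sigma_finite_times[OF AB(1,2)] by metis
  define R where "R n = X n \<times> Y n" for n
  have R: "R n \<in> \<RR>\<^sub>\<sigma>" for n
    unfolding R_def using XY left.finite_sets_subset_sigma_finite_sets right.finite_sets_subset_sigma_finite_sets
    by (intro times_in_ring_prod) auto
  define D where "D n = E \<inter> disjointed R n" for n
  have "E - (\<Union>i\<in>{0..<n}. R i) \<in> \<RR>\<^sub>\<sigma>" for n
  proof -
    interpret sigma_ring "S \<times> T" "\<RR>\<^sub>\<sigma>" by (rule sigma_finite.sigma_ring_ring_prod)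
    show ?thesis using E_ring R by (intro Diff ring.finite_UN) auto
  qed
  then have "approximable (indicator ((E - (\<Union>i\<in>{0..<n}. R i)) \<inter> X n \<times> Y n))" for n
    by (intro approximable_indicator_Int_rectangle XY)
  moreover have "(E - (\<Union>i\<in>{0..<n}. R i)) \<inter> X n \<times> Y n = D n" for n
    by (auto simp: D_def disjointed_def R_def)
  ultimately have approx: "approximable (indicator (D n))" for n by simp
  have "(\<Union>n. D n) = E \<inter> (\<Union>n. disjointed R n)" by (auto simp: D_def)
  also have "\<dots> = E" using AB(3) unfolding UN_disjointed_eq R_def XY(3)[symmetric] by auto
  finally have E_eq: "(\<Union>n. D n) = E" .
  have "disjoint_family D"
    using disjoint_family_disjointed[of R] by (auto simp: disjoint_family_on_def D_def)
  from approximable_indicator_disjoint_UN[OF approx this] show ?thesis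
    unfolding E_eq using product.integral_finite_set(1)[OF E] by simp
qed

lemma approximable_integrable: "integrable MN f \<Longrightarrow> approximable f"
proof (induction rule: product.integrable_induct_mono_limits)
  case (set E)
  then show ?case by (intro approximable_indicator) (simp add: finite_sets_def)
next
  case (mono_lim F f)
  then show ?case by (intro approximable_mono_lim[of F f]) auto
qed (auto intro: approximable_add approximable_scale)

abbreviation "I \<equiv> elementary_prod_functional \<SS> \<mu> \<TT> \<nu>"

lemma increasing_limitD:
  assumes "increasing_limit (S \<times> T) L F h"
  shows "F n \<in> L" "integrable MN (F n)" "I (F n) = integral\<^sup>L MN (F n)"
    and "x \<in> S \<times> T \<Longrightarrow> incseq (\<lambda>n. F n x)" "x \<in> S \<times> T \<Longrightarrow> (\<lambda>n. ereal (F n x)) \<longlonglongrightarrow> h x"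
  using assms elementary_prod_functional_eq unfolding increasing_limit_def by auto

lemma integral_le_SUP_increasing_limit:
  assumes F: "increasing_limit (S \<times> T) L F h" and G: "integrable MN G"
    and Gh: "\<And>x. x \<in> S \<times> T \<Longrightarrow> ereal (G x) \<le> h x"
  shows "ereal (integral\<^sup>L MN G) \<le> (SUP n. ereal (integral\<^sup>L MN (F n)))"
proof (cases "SUP n. ereal (integral\<^sup>L MN (F n))")
  case (real C)
  have le: "integral\<^sup>L MN (F n) \<le> C" for n
    using SUP_upper[of n UNIV "\<lambda>n. ereal (integral\<^sup>L MN (F n))"] real by simp
  have less: "\<exists>n. c < F n x" if x: "x \<in> S \<times> T" and c: "c < G x" for x c
  proof -
    have "ereal c < ereal (G x)" using c by simp
    also have "\<dots> \<le> h x" by (rule Gh[OF x])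
    finally have "ereal c < h x" .
    from order_tendstoD(1)[OF increasing_limitD(5)[OF F x] this]
    show ?thesis by (auto simp: eventually_sequentially)
  qed
  have "integral\<^sup>L MN G \<le> C"
    by (rule product.integral_le_of_le_limit[of F, OF increasing_limitD(2,4)[OF F] G less le])
  then show ?thesis using real by simp
next
  case MInf
  have "ereal (integral\<^sup>L MN (F 0)) \<le> - \<infinity>" unfolding MInf[symmetric] by (rule SUP_upper) simp
  then show ?thesis by simp
qed simp

text \<open>Two sequences with the same limit dominate each other in the sense of
  \<open>integral_le_SUP_increasing_limit\<close>, so the suprema of their integrals agree.\<close>

lemma daniell_up_functional_eq:
  assumes F: "increasing_limit (S \<times> T) L F h"
  shows "daniell_up_functional (S \<times> T) L I h = (SUP n. ereal (integral\<^sup>L MN (F n)))"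
proof -
  have conv: "(\<lambda>n. ereal (I (G n))) \<longlonglongrightarrow> (SUP n. ereal (integral\<^sup>L MN (G n)))"
    if G: "increasing_limit (S \<times> T) L G h" for G
  proof -
    have "incseq (\<lambda>n. ereal (integral\<^sup>L MN (G n)))"
      using increasing_limitD(2,4)[OF G] by (auto simp: incseq_def intro!: integral_mono)
    from LIMSEQ_SUP[OF this] show ?thesis by (simp add: increasing_limitD(3)[OF G])
  qed
  have le: "(SUP n. ereal (integral\<^sup>L MN (G n))) \<le> (SUP n. ereal (integral\<^sup>L MN (H n)))"
    if G: "increasing_limit (S \<times> T) L G h" and H: "increasing_limit (S \<times> T) L H h" for G H
  proof (rule SUP_least)
    fix n
    have "ereal (G n x) \<le> h x" if "x \<in> S \<times> T" for x
      using increasing_limitD(4,5)[OF G that] by (intro incseq_le[of "\<lambda>n. ereal (G n x)"]) (auto simp: incseq_def)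
    then show "ereal (integral\<^sup>L MN (G n)) \<le> (SUP n. ereal (integral\<^sup>L MN (H n)))"
      by (intro integral_le_SUP_increasing_limit[OF H] increasing_limitD(2)[OF G])
  qed
  show ?thesis
    unfolding daniell_up_functional_def
  proof (rule the_equality)
    show "\<exists>G. increasing_limit (S \<times> T) L G h \<and> (\<lambda>n. ereal (I (G n))) \<longlonglongrightarrow> (SUP n. ereal (integral\<^sup>L MN (F n)))"
      using F conv[OF F] by blast
    fix l assume "\<exists>G. increasing_limit (S \<times> T) L G h \<and> (\<lambda>n. ereal (I (G n))) \<longlonglongrightarrow> l"
    then obtain G where G: "increasing_limit (S \<times> T) L G h" "(\<lambda>n. ereal (I (G n))) \<longlonglongrightarrow> l" by blast
    have "l = (SUP n. ereal (integral\<^sup>L MN (G n)))" using G(2) conv[OF G(1)] by (rule LIMSEQ_unique)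
    also have "\<dots> = (SUP n. ereal (integral\<^sup>L MN (F n)))" by (intro antisym le F G(1))
    finally show "l = (SUP n. ereal (integral\<^sup>L MN (F n)))" .
  qed
qed

lemma daniell_upper_eq_integral:
  assumes f: "integrable MN f"
  shows "daniell_upper (S \<times> T) L I f = ereal (integral\<^sup>L MN f)"
proof (rule antisym)
  show "ereal (integral\<^sup>L MN f) \<le> daniell_upper (S \<times> T) L I f"
    unfolding daniell_upper_def
  proof (rule INF_greatest)
    fix h assume "h \<in> {h \<in> daniell_up (S \<times> T) L. \<forall>x\<in>S \<times> T. ereal (f x) \<le> h x}"
    then obtain F where F: "increasing_limit (S \<times> T) L F h" and le: "\<forall>x\<in>S \<times> T. ereal (f x) \<le> h x"
      unfolding daniell_up_def by blast
    show "ereal (integral\<^sup>L MN f) \<le> daniell_up_functional (S \<times> T) L I h"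
      unfolding daniell_up_functional_eq[OF F] using le
      by (intro integral_le_SUP_increasing_limit[OF F f]) blast
  qed
  have upper: "upper_approximable f" using approximable_integrable[OF f] by (simp add: approximable_def)
  show "daniell_upper (S \<times> T) L I f \<le> ereal (integral\<^sup>L MN f)"
  proof (rule ereal_le_epsilon2)
    fix \<epsilon> :: real assume "0 < \<epsilon>"
    then obtain F where F: "\<And>n::nat. F n \<in> L" "\<And>x. x \<in> S \<times> T \<Longrightarrow> incseq (\<lambda>n. F n x)"
      "\<And>n. integral\<^sup>L MN (F n) \<le> integral\<^sup>L MN f + \<epsilon>"
      "\<And>x c. x \<in> S \<times> T \<Longrightarrow> c < f x \<Longrightarrow> \<exists>n. c < F n x"
      using upper_approximableE[OF upper] by metis
    define h where "h x = (SUP n. ereal (F n x))" for x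
    have lim: "increasing_limit (S \<times> T) L F h"
      unfolding increasing_limit_def h_def using F(1,2) by (auto simp: incseq_def intro!: LIMSEQ_SUP)
    have "ereal (f x) \<le> h x" if x: "x \<in> S \<times> T" for x
    proof (rule ccontr)
      assume "\<not> ereal (f x) \<le> h x"
      then have less: "h x < ereal (f x)" by simp
      have ge: "ereal (F n x) \<le> h x" for n unfolding h_def by (rule SUP_upper) simp
      then obtain c where c: "h x = ereal c" using less by (cases "h x") auto
      then obtain n where "c < F n x" using less F(4)[OF x, of c] by auto
      then show False using ge[of n] c by simp
    qed
    then have "daniell_upper (S \<times> T) L I f \<le> daniell_up_functional (S \<times> T) L I h"
      unfolding daniell_upper_def using lim by (intro INF_lower) (auto simp: daniell_up_def)
    also have "\<dots> \<le> ereal (integral\<^sup>L MN f) + ereal \<epsilon>"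
      unfolding daniell_up_functional_eq[OF lim] using F(3) by (auto intro!: SUP_least)
    finally show "daniell_upper (S \<times> T) L I f \<le> ereal (integral\<^sup>L MN f) + ereal \<epsilon>" .
  qed
qed

lemma nn_integral_finite_of_daniell_upper:
  assumes f: "f \<in> borel_measurable MN" and fin: "daniell_upper (S \<times> T) L I f < \<infinity>"
  shows "(\<integral>\<^sup>+x. ennreal (f x) \<partial>MN) < \<infinity>"
proof -
  obtain h where h: "h \<in> daniell_up (S \<times> T) L" "\<forall>x\<in>S \<times> T. ereal (f x) \<le> h x"
    "daniell_up_functional (S \<times> T) L I h < \<infinity>"
    using fin unfolding daniell_upper_def INF_less_iff by blast
  then obtain F where F: "increasing_limit (S \<times> T) L F h" unfolding daniell_up_def by blast
  have ge: "ereal (integral\<^sup>L MN (F n)) \<le> daniell_up_functional (S \<times> T) L I h" for n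
    unfolding daniell_up_functional_eq[OF F] by (rule SUP_upper) simp
  then obtain C where C: "daniell_up_functional (S \<times> T) L I h = ereal C"
    using h(3) by (cases "daniell_up_functional (S \<times> T) L I h") auto
  show ?thesis
    by (rule product.nn_integral_finite_of_le_limit[of F f h C])
      (use increasing_limitD[OF F] f h(2) ge C in auto)
qed

lemma daniell_integrable_iff:
  assumes f: "f \<in> borel_measurable MN"
  shows "daniell_integrable (S \<times> T) L I f \<longleftrightarrow> integrable MN f"
proof
  assume "integrable MN f"
  then show "daniell_integrable (S \<times> T) L I f"
    using daniell_upper_eq_integral[of f] daniell_upper_eq_integral[of "\<lambda>x. - f x"]
    by (simp add: daniell_integrable_def daniell_lower_def)
next
  assume "daniell_integrable (S \<times> T) L I f"
  then have "daniell_upper (S \<times> T) L I f < \<infinity>" "daniell_upper (S \<times> T) L I (\<lambda>x. - f x) < \<infinity>"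
    unfolding daniell_integrable_def daniell_lower_def
    by (cases "daniell_upper (S \<times> T) L I f"; cases "daniell_upper (S \<times> T) L I (\<lambda>x. - f x)"; simp)+
  then show "integrable MN f"
    using f nn_integral_finite_of_daniell_upper[of f] nn_integral_finite_of_daniell_upper[of "\<lambda>x. - f x"]
    by (simp add: real_integrable_def less_top)
qed

lemma daniell_integral_eq: "integrable MN f \<Longrightarrow> daniell_integral (S \<times> T) L I f = integral\<^sup>L MN f"
  by (simp add: daniell_integral_def daniell_upper_eq_integral)

end

theorem theorem2p12:
  fixes S :: "'a set" and \<SS> :: "'a set set" and \<mu> :: "'a set \<Rightarrow> ennreal"
    and T :: "'b set" and \<TT> :: "'b set set" and \<nu> :: "'b set \<Rightarrow> ennreal"
  assumes "ring_measure_space S \<SS> \<mu>"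
    and "ring_measure_space T \<TT> \<nu>"
  shows
    "(\<forall>f :: 'a \<times> 'b \<Rightarrow> real. ring_measurable (S \<times> T) (\<SS> \<otimes>\<^sub>R \<TT>) f \<longrightarrow>
        (f \<in> lebesgue_space (S \<times> T) (\<SS> \<otimes>\<^sub>R \<TT>) (product_measure \<SS> \<mu> \<TT> \<nu>) \<longleftrightarrow>
         daniell_integrable (S \<times> T) (elementary_prod \<SS> \<mu> \<TT> \<nu>) (elementary_prod_functional \<SS> \<mu> \<TT> \<nu>) f) \<and>
        (f \<in> lebesgue_space (S \<times> T) (\<SS> \<otimes>\<^sub>R \<TT>) (product_measure \<SS> \<mu> \<TT> \<nu>) \<longrightarrow>
         lebesgue_functional (S \<times> T) (\<SS> \<otimes>\<^sub>R \<TT>) (product_measure \<SS> \<mu> \<TT> \<nu>) f =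
         daniell_integral (S \<times> T) (elementary_prod \<SS> \<mu> \<TT> \<nu>) (elementary_prod_functional \<SS> \<mu> \<TT> \<nu>) f))
     \<and>
     (\<forall>f :: 'a \<times> 'b \<Rightarrow> ereal.
        ring_integrable (S \<times> T) (\<SS> \<otimes>\<^sub>R \<TT>) (product_measure \<SS> \<mu> \<TT> \<nu>) f \<longrightarrow>
        has_ae_integral S \<SS> \<mu>
          (\<lambda>s. ring_integrable T \<TT> \<nu> (\<lambda>t. f (s, t)))
          (\<lambda>s. ereal (ring_integral T \<TT> \<nu> (\<lambda>t. f (s, t))))
          (ring_integral (S \<times> T) (\<SS> \<otimes>\<^sub>R \<TT>) (product_measure \<SS> \<mu> \<TT> \<nu>) f) \<and>
        has_ae_integral T \<TT> \<nu>
          (\<lambda>t. ring_integrable S \<SS> \<mu> (\<lambda>s. f (s, t)))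
          (\<lambda>t. ereal (ring_integral S \<SS> \<mu> (\<lambda>s. f (s, t))))
          (ring_integral (S \<times> T) (\<SS> \<otimes>\<^sub>R \<TT>) (product_measure \<SS> \<mu> \<TT> \<nu>) f))
     \<and>
     (\<forall>f \<in> nonneg_measurable (S \<times> T) (\<SS> \<otimes>\<^sub>R \<TT>).
        (ring_measurable (S \<times> T) (sigma_finite_sets \<SS> \<mu> \<otimes>\<^sub>R sigma_finite_sets \<TT> \<nu>) f \<longleftrightarrow>
         {x \<in> S \<times> T. f x \<noteq> 0} \<in> sigma_finite_sets (\<SS> \<otimes>\<^sub>R \<TT>) (product_measure \<SS> \<mu> \<TT> \<nu>)) \<and>
        (ring_measurable (S \<times> T) (sigma_finite_sets \<SS> \<mu> \<otimes>\<^sub>R sigma_finite_sets \<TT> \<nu>) f \<longrightarrow>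
         (\<forall>s\<in>S. (\<lambda>t. f (s, t)) \<in> nonneg_measurable T \<TT>) \<and>
         (\<forall>t\<in>T. (\<lambda>s. f (s, t)) \<in> nonneg_measurable S \<SS>) \<and>
         (\<lambda>s. extended_integral T \<TT> \<nu> (\<lambda>t. f (s, t))) \<in> nonneg_measurable S \<SS> \<and>
         (\<lambda>t. extended_integral S \<SS> \<mu> (\<lambda>s. f (s, t))) \<in> nonneg_measurable T \<TT> \<and>
         extended_integral (S \<times> T) (\<SS> \<otimes>\<^sub>R \<TT>) (product_measure \<SS> \<mu> \<TT> \<nu>) f =
           extended_integral S \<SS> \<mu> (\<lambda>s. extended_integral T \<TT> \<nu> (\<lambda>t. f (s, t))) \<and>
         extended_integral (S \<times> T) (\<SS> \<otimes>\<^sub>R \<TT>) (product_measure \<SS> \<mu> \<TT> \<nu>) f =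
           extended_integral T \<TT> \<nu> (\<lambda>t. extended_integral S \<SS> \<mu> (\<lambda>s. f (s, t))) \<and>
         (extended_integral (S \<times> T) (\<SS> \<otimes>\<^sub>R \<TT>) (product_measure \<SS> \<mu> \<TT> \<nu>) f < \<infinity> \<or>
          extended_integral S \<SS> \<mu> (\<lambda>s. extended_integral T \<TT> \<nu> (\<lambda>t. f (s, t))) < \<infinity> \<or>
          extended_integral T \<TT> \<nu> (\<lambda>t. extended_integral S \<SS> \<mu> (\<lambda>s. f (s, t))) < \<infinity> \<longrightarrow>
          ring_integrable (S \<times> T) (\<SS> \<otimes>\<^sub>R \<TT>) (product_measure \<SS> \<mu> \<TT> \<nu>) (\<lambda>x. enn2ereal (f x)))))"
proof -
  interpret ring_measure_pair S \<SS> \<mu> T \<TT> \<nu>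
    using assms by (rule ring_measure_pair.intro)
  show ?thesis
  proof (intro conjI allI ballI impI)
    fix f :: "'a \<times> 'b \<Rightarrow> real"
    assume "ring_measurable (S \<times> T) (\<SS> \<otimes>\<^sub>R \<TT>) f"
    then have f: "f \<in> borel_measurable MN" by (simp add: product.ring_measurable_iff)
    show "f \<in> lebesgue_space (S \<times> T) (\<SS> \<otimes>\<^sub>R \<TT>) (product_measure \<SS> \<mu> \<TT> \<nu>) \<longleftrightarrow>
        daniell_integrable (S \<times> T) (elementary_prod \<SS> \<mu> \<TT> \<nu>) (elementary_prod_functional \<SS> \<mu> \<TT> \<nu>) f"
      using daniell_integrable_iff[OF f] by (simp add: product.lebesgue_space_eq)
    show "lebesgue_functional (S \<times> T) (\<SS> \<otimes>\<^sub>R \<TT>) (product_measure \<SS> \<mu> \<TT> \<nu>) f =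
        daniell_integral (S \<times> T) (elementary_prod \<SS> \<mu> \<TT> \<nu>) (elementary_prod_functional \<SS> \<mu> \<TT> \<nu>) f"
      if "f \<in> lebesgue_space (S \<times> T) (\<SS> \<otimes>\<^sub>R \<TT>) (product_measure \<SS> \<mu> \<TT> \<nu>)"
      using that by (simp add: product.lebesgue_space_eq product.lebesgue_functional_eq daniell_integral_eq)
  next
    fix f :: "'a \<times> 'b \<Rightarrow> ereal"
    assume "ring_integrable (S \<times> T) (\<SS> \<otimes>\<^sub>R \<TT>) (product_measure \<SS> \<mu> \<TT> \<nu>) f"
    note fubini = fubini[OF this]
    show "has_ae_integral S \<SS> \<mu> (\<lambda>s. ring_integrable T \<TT> \<nu> (\<lambda>t. f (s, t)))
        (\<lambda>s. ereal (ring_integral T \<TT> \<nu> (\<lambda>t. f (s, t))))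
        (ring_integral (S \<times> T) (\<SS> \<otimes>\<^sub>R \<TT>) (product_measure \<SS> \<mu> \<TT> \<nu>) f)"
      by (rule fubini)
    show "has_ae_integral T \<TT> \<nu> (\<lambda>t. ring_integrable S \<SS> \<mu> (\<lambda>s. f (s, t)))
        (\<lambda>t. ereal (ring_integral S \<SS> \<mu> (\<lambda>s. f (s, t))))
        (ring_integral (S \<times> T) (\<SS> \<otimes>\<^sub>R \<TT>) (product_measure \<SS> \<mu> \<TT> \<nu>) f)"
      by (rule fubini)
  next
    fix f :: "'a \<times> 'b \<Rightarrow> ennreal"
    assume f: "f \<in> nonneg_measurable (S \<times> T) (\<SS> \<otimes>\<^sub>R \<TT>)"
    have f_ring: "ring_measurable (S \<times> T) (\<SS> \<otimes>\<^sub>R \<TT>) f" using f by (simp add: nonneg_measurable_def)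
    show iff: "ring_measurable (S \<times> T) (\<SS>\<^sub>\<sigma> \<otimes>\<^sub>R \<TT>\<^sub>\<sigma>) f \<longleftrightarrow>
        {x \<in> S \<times> T. f x \<noteq> 0} \<in> sigma_finite_sets (\<SS> \<otimes>\<^sub>R \<TT>) (product_measure \<SS> \<mu> \<TT> \<nu>)"
      unfolding sigma_finite_sets_product_measure by (rule ring_measurable_sigma_finite_iff[OF f_ring])
    assume "ring_measurable (S \<times> T) (\<SS>\<^sub>\<sigma> \<otimes>\<^sub>R \<TT>\<^sub>\<sigma>) f"
    then have supp: "{x \<in> S \<times> T. f x \<noteq> 0} \<in> \<SS>\<^sub>\<sigma> \<otimes>\<^sub>R \<TT>\<^sub>\<sigma>" by (simp add: ring_measurable_def)
    note tonelli = tonelli_extended_integral[OF f supp]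
    show "(\<lambda>s. extended_integral T \<TT> \<nu> (\<lambda>t. f (s, t))) \<in> nonneg_measurable S \<SS>"
      "(\<lambda>t. extended_integral S \<SS> \<mu> (\<lambda>s. f (s, t))) \<in> nonneg_measurable T \<TT>"
      "extended_integral (S \<times> T) (\<SS> \<otimes>\<^sub>R \<TT>) (product_measure \<SS> \<mu> \<TT> \<nu>) f =
        extended_integral S \<SS> \<mu> (\<lambda>s. extended_integral T \<TT> \<nu> (\<lambda>t. f (s, t)))"
      "extended_integral (S \<times> T) (\<SS> \<otimes>\<^sub>R \<TT>) (product_measure \<SS> \<mu> \<TT> \<nu>) f =
        extended_integral T \<TT> \<nu> (\<lambda>t. extended_integral S \<SS> \<mu> (\<lambda>s. f (s, t)))"
      by (rule tonelli)+
    show "(\<lambda>t. f (s, t)) \<in> nonneg_measurable T \<TT>" if "s \<in> S" for s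
      using ring_measurable_sections(1)[OF f_ring that] by (simp add: nonneg_measurable_def)
    show "(\<lambda>s. f (s, t)) \<in> nonneg_measurable S \<SS>" if "t \<in> T" for t
      using ring_measurable_sections(2)[OF f_ring that] by (simp add: nonneg_measurable_def)
    assume "extended_integral (S \<times> T) (\<SS> \<otimes>\<^sub>R \<TT>) (product_measure \<SS> \<mu> \<TT> \<nu>) f < \<infinity> \<or>
      extended_integral S \<SS> \<mu> (\<lambda>s. extended_integral T \<TT> \<nu> (\<lambda>t. f (s, t))) < \<infinity> \<or>
      extended_integral T \<TT> \<nu> (\<lambda>t. extended_integral S \<SS> \<mu> (\<lambda>s. f (s, t))) < \<infinity>"
    then have "extended_integral (S \<times> T) (\<SS> \<otimes>\<^sub>R \<TT>) (product_measure \<SS> \<mu> \<TT> \<nu>) f < \<infinity>"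
      using tonelli(3,4) by auto
    moreover have "(\<lambda>x. enn2ereal (f x)) \<in> borel_measurable MN"
      using f by (auto simp: product.nonneg_measurable_iff)
    moreover have "enn2ereal y = 0 \<longleftrightarrow> y = 0" for y
      using enn2ereal_inject[of y 0] by (simp add: zero_ennreal.rep_eq)
    ultimately show "ring_integrable (S \<times> T) (\<SS> \<otimes>\<^sub>R \<TT>) (product_measure \<SS> \<mu> \<TT> \<nu>) (\<lambda>x. enn2ereal (f x))"
      using f by (simp add: ring_integrable_def product.ring_measurable_iff product.nonneg_measurable_iff)
  qed
qed

end
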